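(* There exists a separable Banach space $X$ with a basis such that $X^{**}=X\oplus Y$, where $Y$ does not contain infinite-dimensional subspaces which are isomorphic to subspaces of $X$, but $X$ does not have the TPBA.
   Context: "Basis" means Schauder basis. A Banach space $X$ is identified with its canonical image in $X^{**}$, and $X^{**}=X\oplus Y$ means that $Y$ is a closed subspace of $X^{**}$ complementing $X$. A subspace $M\subset X^*$ is norming if there exists $c>0$ such that $\sup_{0\ne f\in M}|f(x)|/\|f\|\ge c\|x\|$ for all $x\in X$. A subspace $M\subset X^*$ is quasibasic if there exists a sequence of continuous finite-dimensional (i.e. finite-rank) linear operators $v_n:X\to X$ such that $\lim_{n\to\infty}\|v_n(x)-x\|=0$ for all $x\in X$, and $\mathrm{im}(v_n^* )\subset M$ for all $n$, where $v_n^*$ is the adjoint of $v_n$. A Banach space $X$ has the total property of bounded approximation (TPBA) if every norming subspace $M$ of $X^*$ is quasibasic. *)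

theory Defs
  imports "HOL-Analysis.Analysis" "HOL-Library.Function_Algebras"
begin

instantiation "fun" :: (type, real_vector) real_vector
begin

definition scaleR_fun :: "real \<Rightarrow> ('a \<Rightarrow> 'b) \<Rightarrow> 'a \<Rightarrow> 'b" where
  "scaleR_fun c f = (\<lambda>x. c *\<^sub>R f x)"

instance
  by standard (auto simp: scaleR_fun_def fun_eq_iff algebra_simps)

end

text \<open>
  Banach spaces have to be quantified over existentially, and their duals have to be formed, so
  a space is a value rather than a type: a linear subspace of an ambient real vector space with
  a norm on it. The ambient vector space contributes only the linear operations, and the values
  of \<open>nrm\<close> off \<open>vecs\<close> are irrelevant. For spaces with a Schauder basis the ambient space
  \<open>nat \<Rightarrow> real\<close> is no restriction: the coefficient functionals embed such a space linearly into
  it, and the norm can be transported along this embedding.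
\<close>

record 'a nspace =
  vecs :: "'a set"
  nrm :: "'a \<Rightarrow> real"

definition normed_space :: "'a::real_vector nspace \<Rightarrow> bool" where
  "normed_space X \<longleftrightarrow> subspace (vecs X) \<and>
     (\<forall>x\<in>vecs X. 0 \<le> nrm X x \<and> (nrm X x = 0 \<longleftrightarrow> x = 0)) \<and>
     (\<forall>c. \<forall>x\<in>vecs X. nrm X (c *\<^sub>R x) = \<bar>c\<bar> * nrm X x) \<and>
     (\<forall>x\<in>vecs X. \<forall>y\<in>vecs X. nrm X (x + y) \<le> nrm X x + nrm X y)"

text \<open>
  The guard is there because the locale \<open>Metric_space\<close> demands nonnegativity and symmetry for
  all arguments, not only those in the carrier.
\<close>

definition ndist :: "'a::real_vector nspace \<Rightarrow> 'a \<Rightarrow> 'a \<Rightarrow> real" where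
  "ndist X x y = (if x \<in> vecs X \<and> y \<in> vecs X then nrm X (x - y) else 0)"

lemma Metric_space_ndist:
  assumes "normed_space X"
  shows "Metric_space (vecs X) (ndist X)"
proof -
  have sub: "subspace (vecs X)"
    and nn: "\<And>x. x \<in> vecs X \<Longrightarrow> 0 \<le> nrm X x"
    and z: "\<And>x. x \<in> vecs X \<Longrightarrow> nrm X x = 0 \<longleftrightarrow> x = 0"
    and sc: "\<And>c x. x \<in> vecs X \<Longrightarrow> nrm X (c *\<^sub>R x) = \<bar>c\<bar> * nrm X x"
    and tri: "\<And>x y. x \<in> vecs X \<Longrightarrow> y \<in> vecs X \<Longrightarrow> nrm X (x + y) \<le> nrm X x + nrm X y"
    using assms unfolding normed_space_def by blast+
  have diff: "x - y \<in> vecs X" if "x \<in> vecs X" "y \<in> vecs X" for x y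
    using subspace_diff[OF sub] that by blast
  show ?thesis
  proof
    fix x y
    show "0 \<le> ndist X x y"
      by (simp add: ndist_def nn diff)
    show "ndist X x y = ndist X y x"
    proof (cases "x \<in> vecs X \<and> y \<in> vecs X")
      case True
      then show ?thesis
        using sc[of "x - y" "-1"] by (simp add: ndist_def diff)
    qed (auto simp: ndist_def)
    show "ndist X x y = 0 \<longleftrightarrow> x = y" if "x \<in> vecs X" "y \<in> vecs X"
      using that by (simp add: ndist_def z diff)
    fix w
    show "ndist X x w \<le> ndist X x y + ndist X y w"
      if "x \<in> vecs X" "y \<in> vecs X" "w \<in> vecs X"
      using that tri[of "x - y" "y - w"] by (simp add: ndist_def diff)
  qed
qed

definition ntop :: "'a::real_vector nspace \<Rightarrow> 'a topology" where
  "ntop X = Metric_space.mtopology (vecs X) (ndist X)"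

definition banach_space :: "'a::real_vector nspace \<Rightarrow> bool" where
  "banach_space X \<longleftrightarrow> normed_space X \<and> Metric_space.mcomplete (vecs X) (ndist X)"

definition restrict_nspace :: "'a nspace \<Rightarrow> 'a set \<Rightarrow> 'a nspace" where
  "restrict_nspace X W = \<lparr>vecs = W, nrm = nrm X\<rparr>"

definition finite_dim :: "'a::real_vector set \<Rightarrow> bool" where
  "finite_dim W \<longleftrightarrow> (\<exists>B. finite B \<and> W \<subseteq> span B)"

definition schauder_basis :: "'a::real_vector nspace \<Rightarrow> (nat \<Rightarrow> 'a) \<Rightarrow> bool" where
  "schauder_basis X b \<longleftrightarrow> range b \<subseteq> vecs X \<and>
     (\<forall>x\<in>vecs X. \<exists>!a :: nat \<Rightarrow> real.
        limitin (ntop X) (\<lambda>n. \<Sum>k<n. a k *\<^sub>R b k) x sequentially)"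

definition bounded_op ::
    "'a::real_vector nspace \<Rightarrow> 'b::real_vector nspace \<Rightarrow> ('a \<Rightarrow> 'b) \<Rightarrow> bool" where
  "bounded_op X Y T \<longleftrightarrow> T ` vecs X \<subseteq> vecs Y \<and>
     (\<forall>x\<in>vecs X. \<forall>y\<in>vecs X. T (x + y) = T x + T y) \<and>
     (\<forall>c. \<forall>x\<in>vecs X. T (c *\<^sub>R x) = c *\<^sub>R T x) \<and>
     (\<exists>K. \<forall>x\<in>vecs X. nrm Y (T x) \<le> K * nrm X x)"

definition isomorphic_nspaces ::
    "'a::real_vector nspace \<Rightarrow> 'b::real_vector nspace \<Rightarrow> bool" where
  "isomorphic_nspaces X Y \<longleftrightarrow> (\<exists>T S. bounded_op X Y T \<and> bounded_op Y X S \<and>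
     (\<forall>x\<in>vecs X. S (T x) = x) \<and> (\<forall>y\<in>vecs Y. T (S y) = y))"

definition real_line :: "real nspace" where
  "real_line = \<lparr>vecs = UNIV, nrm = abs\<rparr>"

text \<open>
  Functionals are extended by zero off \<open>vecs X\<close>, which makes the representation unique and
  compatible with the pointwise vector space operations.
\<close>

definition dual :: "'a::real_vector nspace \<Rightarrow> ('a \<Rightarrow> real) nspace" where
  "dual X = \<lparr>vecs = {f. bounded_op X real_line f \<and> (\<forall>x. x \<notin> vecs X \<longrightarrow> f x = 0)},
             nrm = (\<lambda>f. Sup {\<bar>f x\<bar> |x. x \<in> vecs X \<and> nrm X x \<le> 1})\<rparr>"

abbreviation bidual :: "'a::real_vector nspace \<Rightarrow> (('a \<Rightarrow> real) \<Rightarrow> real) nspace" where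
  "bidual X \<equiv> dual (dual X)"

definition canonical_emb :: "'a::real_vector nspace \<Rightarrow> 'a \<Rightarrow> ('a \<Rightarrow> real) \<Rightarrow> real" where
  "canonical_emb X x = (\<lambda>f. if f \<in> vecs (dual X) then f x else 0)"

definition adjoint_op ::
    "'a::real_vector nspace \<Rightarrow> ('a \<Rightarrow> 'b) \<Rightarrow> ('b \<Rightarrow> real) \<Rightarrow> 'a \<Rightarrow> real" where
  "adjoint_op X v f = (\<lambda>x. if x \<in> vecs X then f (v x) else 0)"

definition closed_complement ::
    "'a::real_vector nspace \<Rightarrow> 'a set \<Rightarrow> 'a set \<Rightarrow> bool" where
  "closed_complement Z U Y \<longleftrightarrow> subspace Y \<and> closedin (ntop Z) Y \<and>
     U \<inter> Y = {0} \<and> {u + y |u y. u \<in> U \<and> y \<in> Y} = vecs Z"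

text \<open>
  The supremum is taken in \<^typ>\<open>ennreal\<close>, where it is \<open>0\<close> for the zero subspace.
\<close>

definition norming :: "'a::real_vector nspace \<Rightarrow> ('a \<Rightarrow> real) set \<Rightarrow> bool" where
  "norming X M \<longleftrightarrow> (\<exists>c>0. \<forall>x\<in>vecs X.
     ennreal (c * nrm X x) \<le> (SUP f\<in>M - {0}. ennreal (\<bar>f x\<bar> / nrm (dual X) f)))"

definition quasibasic :: "'a::real_vector nspace \<Rightarrow> ('a \<Rightarrow> real) set \<Rightarrow> bool" where
  "quasibasic X M \<longleftrightarrow> (\<exists>v :: nat \<Rightarrow> 'a \<Rightarrow> 'a.
     (\<forall>n. bounded_op X X (v n) \<and> finite_dim (v n ` vecs X)) \<and>
     (\<forall>x\<in>vecs X. (\<lambda>n. nrm X (v n x - x)) \<longlonglongrightarrow> 0) \<and>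
     (\<forall>n. adjoint_op X (v n) ` vecs (dual X) \<subseteq> M))"

definition TPBA :: "'a::real_vector nspace \<Rightarrow> bool" where
  "TPBA X \<longleftrightarrow> (\<forall>M. subspace M \<and> M \<subseteq> vecs (dual X) \<and> norming X M \<longrightarrow> quasibasic X M)"

lemma dual_nrm_bound:
  assumes X: "normed_space X" and f: "f \<in> vecs (dual X)"
  shows "bdd_above {\<bar>f x\<bar> |x. x \<in> vecs X \<and> nrm X x \<le> 1}"
proof -
  obtain K where K: "\<And>x. x \<in> vecs X \<Longrightarrow> \<bar>f x\<bar> \<le> K * nrm X x"
    using f unfolding dual_def bounded_op_def real_line_def by fastforce
  have "\<bar>f x\<bar> \<le> \<bar>K\<bar>" if "x \<in> vecs X" "nrm X x \<le> 1" for x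
  proof -
    have "0 \<le> nrm X x"
      using X that by (simp add: normed_space_def)
    then have "K * nrm X x \<le> \<bar>K\<bar> * 1"
      using that by (intro mult_mono) auto
    then show ?thesis
      using K[OF that(1)] by linarith
  qed
  then show ?thesis
    by (auto intro!: bdd_aboveI[of _ "\<bar>K\<bar>"])
qed

lemma normed_space_dual:
  assumes X: "normed_space X"
  shows "normed_space (dual X)"
proof -
  let ?D = "vecs (dual X)"
  let ?A = "\<lambda>f. {\<bar>f x\<bar> |x. x \<in> vecs X \<and> nrm X x \<le> 1}"
  have sub: "subspace (vecs X)"
    and z: "\<And>x. x \<in> vecs X \<Longrightarrow> nrm X x = 0 \<longleftrightarrow> x = 0"
    and nn: "\<And>x. x \<in> vecs X \<Longrightarrow> 0 \<le> nrm X x"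
    and sc: "\<And>c x. x \<in> vecs X \<Longrightarrow> nrm X (c *\<^sub>R x) = \<bar>c\<bar> * nrm X x"
    using X unfolding normed_space_def by blast+
  have D: "f \<in> ?D \<longleftrightarrow> (\<forall>x\<in>vecs X. \<forall>y\<in>vecs X. f (x + y) = f x + f y) \<and>
      (\<forall>c. \<forall>x\<in>vecs X. f (c *\<^sub>R x) = c * f x) \<and>
      (\<exists>K. \<forall>x\<in>vecs X. \<bar>f x\<bar> \<le> K * nrm X x) \<and> (\<forall>x. x \<notin> vecs X \<longrightarrow> f x = 0)" for f
    by (simp add: dual_def bounded_op_def real_line_def)
  have N: "nrm (dual X) f = Sup (?A f)" for f
    by (simp add: dual_def)
  have x0: "0 \<in> vecs X" "nrm X 0 = 0"
    using sub z by (auto simp: subspace_0)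
  then have ne: "?A f \<noteq> {}" for f
    by (auto intro!: exI[of _ 0])
  have up: "\<bar>f x\<bar> \<le> nrm (dual X) f" if "f \<in> ?D" "x \<in> vecs X" "nrm X x \<le> 1" for f x
    unfolding N by (rule cSup_upper) (use that dual_nrm_bound[OF X] in auto)
  have le: "nrm (dual X) f \<le> c" if "\<And>x. x \<in> vecs X \<Longrightarrow> nrm X x \<le> 1 \<Longrightarrow> \<bar>f x\<bar> \<le> c" for f c
    unfolding N by (rule cSup_least) (use that ne in auto)
  have nonneg: "0 \<le> nrm (dual X) f" if "f \<in> ?D" for f
    using up[OF that x0(1)] x0(2) by simp
  have subD: "subspace ?D"
  proof (rule subspaceI)
    show "0 \<in> ?D"
      unfolding D by (auto intro!: exI[of _ 0])
  next
    fix f g assume f: "f \<in> ?D" and g: "g \<in> ?D"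
    obtain K L where "\<forall>x\<in>vecs X. \<bar>f x\<bar> \<le> K * nrm X x" "\<forall>x\<in>vecs X. \<bar>g x\<bar> \<le> L * nrm X x"
      using f g unfolding D by blast
    then have "\<forall>x\<in>vecs X. \<bar>(f + g) x\<bar> \<le> (K + L) * nrm X x"
      by (fastforce simp: algebra_simps)
    moreover have "\<forall>x\<in>vecs X. \<forall>y\<in>vecs X. (f + g) (x + y) = (f + g) x + (f + g) y"
      "\<forall>c. \<forall>x\<in>vecs X. (f + g) (c *\<^sub>R x) = c * (f + g) x" "\<forall>x. x \<notin> vecs X \<longrightarrow> (f + g) x = 0"
      using f g unfolding D by (auto simp: algebra_simps)
    ultimately show "f + g \<in> ?D"
      unfolding D by blast
  next
    fix c f assume f: "f \<in> ?D"
    obtain K where K: "\<forall>x\<in>vecs X. \<bar>f x\<bar> \<le> K * nrm X x"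
      using f unfolding D by blast
    have "\<forall>x\<in>vecs X. \<bar>(c *\<^sub>R f) x\<bar> \<le> (\<bar>c\<bar> * K) * nrm X x"
      using K by (auto simp: scaleR_fun_def abs_mult mult.assoc intro!: mult_left_mono)
    moreover have "\<forall>x\<in>vecs X. \<forall>y\<in>vecs X. (c *\<^sub>R f) (x + y) = (c *\<^sub>R f) x + (c *\<^sub>R f) y"
      "\<forall>d. \<forall>x\<in>vecs X. (c *\<^sub>R f) (d *\<^sub>R x) = d * (c *\<^sub>R f) x"
      "\<forall>x. x \<notin> vecs X \<longrightarrow> (c *\<^sub>R f) x = 0"
      using f unfolding D by (auto simp: scaleR_fun_def algebra_simps)
    ultimately show "c *\<^sub>R f \<in> ?D"
      unfolding D by blast
  qed
  have definite: "nrm (dual X) f = 0 \<longleftrightarrow> f = 0" if f: "f \<in> ?D" for f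
  proof
    assume n0: "nrm (dual X) f = 0"
    show "f = 0"
    proof
      fix x
      show "f x = 0 x"
      proof (cases "x \<in> vecs X \<and> x \<noteq> 0")
        case True
        then have pos: "0 < nrm X x"
          using nn[of x] z[of x] by simp
        let ?y = "(1 / nrm X x) *\<^sub>R x"
        have "?y \<in> vecs X"
          using True sub by (simp add: subspace_scale)
        moreover have "nrm X ?y \<le> 1"
          using sc[of x "1 / nrm X x"] True pos by simp
        ultimately have "f ?y = 0"
          using up[OF f] n0 by fastforce
        moreover have "f ?y = (1 / nrm X x) * f x"
          using f True unfolding D by blast
        ultimately show ?thesis
          using pos by simp
      next
        case False
        moreover have "f 0 = 0"
        proof -
          have "f (0 *\<^sub>R 0) = 0 * f 0"
            using f x0(1) unfolding D by blast
          then show ?thesis by simp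
        qed
        ultimately show ?thesis
          using f unfolding D by auto
      qed
    qed
  next
    assume "f = 0"
    then show "nrm (dual X) f = 0"
      using le[of f 0] nonneg[OF f] by simp
  qed
  have tri: "nrm (dual X) (f + g) \<le> nrm (dual X) f + nrm (dual X) g"
    if "f \<in> ?D" "g \<in> ?D" for f g
  proof (rule le)
    fix x assume "x \<in> vecs X" "nrm X x \<le> 1"
    then show "\<bar>(f + g) x\<bar> \<le> nrm (dual X) f + nrm (dual X) g"
      using up[OF that(1)] up[OF that(2)] by (fastforce intro: order_trans[OF abs_triangle_ineq])
  qed
  have scale_le: "nrm (dual X) (c *\<^sub>R f) \<le> \<bar>c\<bar> * nrm (dual X) f" if "f \<in> ?D" for c f
    by (rule le) (auto simp: scaleR_fun_def abs_mult intro!: mult_left_mono up[OF that])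
  have scale: "nrm (dual X) (c *\<^sub>R f) = \<bar>c\<bar> * nrm (dual X) f" if f: "f \<in> ?D" for c f
  proof (cases "c = 0")
    case True
    then show ?thesis
      using definite[of 0] subspace_0[OF subD] by simp
  next
    case False
    have "nrm (dual X) ((1/c) *\<^sub>R (c *\<^sub>R f)) \<le> \<bar>1/c\<bar> * nrm (dual X) (c *\<^sub>R f)"
      by (rule scale_le) (use subspace_scale[OF subD f] in simp)
    then have "\<bar>c\<bar> * nrm (dual X) f \<le> nrm (dual X) (c *\<^sub>R f)"
      using False by (simp add: field_simps)
    then show ?thesis
      using scale_le[OF f, of c] by linarith
  qed
  show ?thesis
    unfolding normed_space_def using subD nonneg definite scale tri by blast
qed

end

theory Submission
  imports Defs
begin

text \<open>
  The space is of James--Lindenstrauss type: the norm of \<open>x\<close> is the supremum of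
  \<open>(\<Sum> \<parallel>q(x restricted to I)\<parallel>\<^sup>2)^(1/2)\<close> over families of successive intervals \<open>I\<close>, where \<open>q\<close> maps every
  basis vector to a coordinate vector of an \<open>\<ell>\<^sub>4\<close>-sum of finite-dimensional spaces and hits every
  coordinate infinitely often. The basis is boundedly complete, so the annihilator of the coordinate
  functionals complements the space in its bidual. Averaging successive vectors kills everything but
  their images under \<open>q\<close>; hence the annihilator satisfies upper \<open>4\<close>-estimates, while block
  sequences in the space satisfy lower \<open>2\<close>-estimates, and the two have no isomorphic
  infinite-dimensional subspaces. The summands are \<open>\<ell>\<^sub>1(d) \<oplus> \<ell>\<^sub>\<infinity>(2^d)\<close>, and the second one contains
  \<open>\<ell>\<^sub>1(d)\<close> as the span of Rademacher functions, with projection constant of order \<open>d^(1/2)\<close>. The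
  norming subspace is the annihilator of a graph over these spans, of small multiples of their
  identification with the first summands. Finite-rank operators respecting it would provide uniformly
  bounded extensions of these maps to \<open>\<ell>\<^sub>\<infinity>(2^d)\<close>, which do not exist.
\<close>

section \<open>Sublinear functionals\<close>

text \<open>Every coordinate is the label of arbitrarily late basis vectors, so the complement
  contains elements acting as limits of basis vectors with a fixed label. The vectors behind
  \<open>thin\<close> are \<open>r + 2^(-n) e\<close>, with \<open>r\<close> a Rademacher
  combination of such limits and \<open>e\<close> a basis vector. If the adjoint of \<open>v\<close>
  maps into \<open>thin\<close>, its second adjoint kills them and sends \<open>r\<close> to
  \<open>- 2^(-n) v e\<close>, which is close to \<open>- 2^(-n) e\<close>. The weights serve two
  opposed ends: their sum is finite, so a finitely supported functional can be moved into
  \<open>thin\<close> at bounded cost, yet \<open>2^(-n)\<close> loses against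
  \<open>sqrt d = 4^n\<close>. The obstacle is that elements of the bidual are not given concretely,
  so their norm on the complement is found indirectly. Hahn-Banach yields vectors arbitrarily far
  out on which a functional stays large while the norms of their label images are controlled;
  averaging them leaves only the norm of these images.\<close>

definition sublin :: "('a::real_vector \<Rightarrow> real) \<Rightarrow> bool" where
  "sublin p \<longleftrightarrow> (\<forall>x y. p (x + y) \<le> p x + p y) \<and> (\<forall>c x. 0 < c \<longrightarrow> p (c *\<^sub>R x) = c * p x) \<and> p 0 = 0"

lemma sublin_add: "sublin p \<Longrightarrow> p (x + y) \<le> p x + p y"
  and sublin_scale: "sublin p \<Longrightarrow> 0 \<le> c \<Longrightarrow> p (c *\<^sub>R x) = c * p x"
  and sublin_0: "sublin p \<Longrightarrow> p 0 = 0"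
  by (cases "c = 0"; auto simp: sublin_def)+

lemma sublin_minus: "sublin p \<Longrightarrow> - p (- x) \<le> p x"
  using sublin_add[of p x "- x"] by (simp add: sublin_0)

lemma sublin_diff: "sublin p \<Longrightarrow> p x - p (- y) \<le> p (x + y)"
  using sublin_add[of p "x + y" "- y"] by simp

text \<open>It suffices that the index set absorbs sums and positive dilations; \<open>b\<close>
  keeps the infimum finite. Chains in Zorn's lemma and the infima that modify a given functional are
  all of this form.\<close>

lemma sublin_INF:
  fixes G :: "'i \<Rightarrow> 'a::real_vector \<Rightarrow> real"
  assumes i0: "i0 \<in> I" "G i0 0 \<le> 0"
    and lb: "\<And>i x. i \<in> I \<Longrightarrow> b x \<le> G i x" "b 0 = 0"
    and add: "\<And>i j x y. i \<in> I \<Longrightarrow> j \<in> I \<Longrightarrow> \<exists>k\<in>I. G k (x + y) \<le> G i x + G j y"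
    and scale: "\<And>i c x. i \<in> I \<Longrightarrow> 0 < c \<Longrightarrow> \<exists>k\<in>I. G k (c *\<^sub>R x) \<le> c * G i x"
  shows "sublin (\<lambda>x. INF i\<in>I. G i x)"
proof -
  define u where "u x = (INF i\<in>I. G i x)" for x
  have bdd: "bdd_below ((\<lambda>i. G i x) ` I)" for x
    using lb by (auto intro!: bdd_belowI2[of _ "b x"])
  have le: "u x \<le> G i x" if "i \<in> I" for i x
    unfolding u_def by (rule cINF_lower[OF bdd that])
  have ge: "c \<le> u x" if "\<And>i. i \<in> I \<Longrightarrow> c \<le> G i x" for c x
    unfolding u_def by (rule cINF_greatest) (use i0 that in auto)
  have tri: "u (x + y) \<le> u x + u y" for x y
  proof -
    have "u (x + y) - G j y \<le> u x" if j: "j \<in> I" for j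
    proof (rule ge)
      fix i assume i: "i \<in> I"
      obtain k where "k \<in> I" "G k (x + y) \<le> G i x + G j y" using add[OF i j] by blast
      then show "u (x + y) - G j y \<le> G i x" using le[of k "x + y"] by linarith
    qed
    then have "u (x + y) - u x \<le> u y" by (intro ge) (simp add: algebra_simps)
    then show ?thesis by linarith
  qed
  have scale1: "u (c *\<^sub>R x) \<le> c * u x" if c: "0 < c" for c x
  proof -
    have "u (c *\<^sub>R x) / c \<le> u x"
    proof (rule ge)
      fix i assume i: "i \<in> I"
      obtain k where "k \<in> I" "G k (c *\<^sub>R x) \<le> c * G i x" using scale[OF i c] by blast
      then have "u (c *\<^sub>R x) \<le> c * G i x" using le[of k "c *\<^sub>R x"] by linarith
      then show "u (c *\<^sub>R x) / c \<le> G i x" using c by (simp add: field_simps)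
    qed
    then show ?thesis using c by (simp add: field_simps)
  qed
  have "u (c *\<^sub>R x) = c * u x" if c: "0 < c" for c x
  proof (rule antisym[OF scale1[OF c]])
    have "u ((1/c) *\<^sub>R (c *\<^sub>R x)) \<le> (1/c) * u (c *\<^sub>R x)" by (rule scale1) (use c in simp)
    then show "c * u x \<le> u (c *\<^sub>R x)" using c by (simp add: field_simps)
  qed
  moreover have "u 0 = 0"
    using le[OF i0(1), of 0] i0(2) ge[of 0 0] lb by (metis order_antisym order_trans)
  ultimately have "sublin u" using tri unfolding sublin_def by blast
  then show ?thesis unfolding u_def .
qed

text \<open>The infimum over \<open>t \<ge> 0\<close> of \<open>p (x + t y) - t * p y\<close> is
  still sublinear, and \<open>t = 1\<close> gives the bound at \<open>- y\<close>. A minimal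
  \<open>p\<close> coincides with this infimum, which forces \<open>p (- y) = - p y\<close>; a
  linear functional below it attains \<open>p\<close> at \<open>y\<close>.\<close>

lemma sublin_below:
  assumes p: "sublin p"
  obtains q where "sublin q" "\<And>x. q x \<le> p x" "q (- y) \<le> - p y"
proof -
  define G where "G t x = p (x + t *\<^sub>R y) - t * p y" for t x
  have lb: "- p (- x) \<le> G t x" if "t \<in> {0..}" for t x
    using sublin_diff[OF p, of "t *\<^sub>R y" x] that by (simp add: G_def sublin_scale[OF p] add.commute)
  have "sublin (\<lambda>x. INF t\<in>{0::real..}. G t x)"
  proof (rule sublin_INF[where b = "\<lambda>x. - p (- x)" and ?i0.0 = 0])
    fix t u x z assume "t \<in> {0::real..}" "u \<in> {0::real..}"
    then show "\<exists>k\<in>{0..}. G k (x + z) \<le> G t x + G u z"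
      using sublin_add[OF p, of "x + t *\<^sub>R y" "z + u *\<^sub>R y"]
      by (intro bexI[of _ "t + u"]) (auto simp: G_def algebra_simps)
  next
    fix t x and c :: real assume "t \<in> {0::real..}" "0 < c"
    then show "\<exists>k\<in>{0..}. G k (c *\<^sub>R x) \<le> c * G t x"
      using sublin_scale[OF p, of c "x + t *\<^sub>R y"]
      by (intro bexI[of _ "c * t"]) (auto simp: G_def algebra_simps)
  qed (use lb in \<open>auto simp: G_def sublin_0[OF p]\<close>)
  moreover have bdd: "bdd_below ((\<lambda>t. G t x) ` {0..})" for x
    using lb by (auto intro!: bdd_belowI2[of _ "- p (- x)"])
  have "(INF t\<in>{0::real..}. G t x) \<le> p x" for x
    using cINF_lower[OF bdd, of 0 x] by (simp add: G_def)
  moreover have "(INF t\<in>{0::real..}. G t (- y)) \<le> - p y"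
    using cINF_lower[OF bdd, of 1 "- y"] by (simp add: G_def sublin_0[OF p])
  ultimately show thesis by (rule that)
qed

text \<open>A minimal sublinear functional is odd, hence linear.\<close>

lemma sublin_dominates_linear:
  fixes p :: "'a::real_vector \<Rightarrow> real"
  assumes p: "sublin p"
  obtains f where "linear f" "\<And>x. f x \<le> p x"
proof -
  define A where "A = {q. sublin q \<and> (\<forall>x. q x \<le> p x)}"
  define P where "P q r \<longleftrightarrow> (\<forall>x. r x \<le> q x)" for q r :: "'a \<Rightarrow> real"
  have "\<exists>m\<in>A. \<forall>a\<in>A. P m a \<longrightarrow> a = m"
  proof (rule predicate_Zorn)
    show "partial_order_on A (relation_of P A)"
      by (auto simp: partial_order_on_def preorder_on_def refl_on_def trans_def antisym_def
          relation_of_def P_def fun_eq_iff intro: order_trans order_antisym)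
  next
    fix C assume "C \<in> Chains (relation_of P A)"
    then have CA: "C \<subseteq> A" and chain: "\<And>q r. q \<in> C \<Longrightarrow> r \<in> C \<Longrightarrow> P q r \<or> P r q"
      by (auto simp: Chains_def relation_of_def)
    show "\<exists>u\<in>A. \<forall>a\<in>C. P a u"
    proof (cases "C = {}")
      case True
      then show ?thesis using p by (auto simp: A_def)
    next
      case False
      then obtain q0 where q0: "q0 \<in> C" by blast
      have sub: "sublin q" "q x \<le> p x" if "q \<in> C" for q x
        using CA that by (auto simp: A_def)
      have lb: "- p (- x) \<le> q x" if "q \<in> C" for q x
        using sublin_minus[OF sub(1)[OF that], of x] sub(2)[OF that, of "- x"] by linarith
      have "sublin (\<lambda>x. INF q\<in>C. q x)"
      proof (rule sublin_INF[where b = "\<lambda>x. - p (- x)" and ?i0.0 = q0])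
        fix q r x y assume qr: "q \<in> C" "r \<in> C"
        then show "\<exists>k\<in>C. k (x + y) \<le> q x + r y"
        proof (cases "P q r")
          case True
          then show ?thesis using qr sublin_add[OF sub(1)[OF qr(2)], of x y]
            by (intro bexI[of _ r]) (auto simp: P_def intro: order_trans)
        next
          case False
          then have "P r q" using chain qr by blast
          then show ?thesis using qr sublin_add[OF sub(1)[OF qr(1)], of x y]
            by (intro bexI[of _ q]) (auto simp: P_def intro: order_trans)
        qed
      next
        fix q x and c :: real assume "q \<in> C" "0 < c"
        then show "\<exists>k\<in>C. k (c *\<^sub>R x) \<le> c * q x"
          using sub(1) by (intro bexI[of _ q]) (auto simp: sublin_scale)
      qed (use q0 lb sub in \<open>auto simp: sublin_0[OF p] sublin_0[OF sub(1)]\<close>)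
      moreover have low: "(INF q\<in>C. q x) \<le> r x" if "r \<in> C" for r x
        by (rule cINF_lower[OF _ that]) (use lb in \<open>auto intro!: bdd_belowI2[of _ "- p (- x)"]\<close>)
      moreover have "(INF q\<in>C. q x) \<le> p x" for x
        using low[OF q0] sub(2)[OF q0] order_trans by blast
      ultimately show ?thesis
        by (intro bexI[of _ "\<lambda>x. INF q\<in>C. q x"]) (auto simp: A_def P_def)
    qed
  qed
  then obtain f where f: "f \<in> A" and min: "\<And>a. a \<in> A \<Longrightarrow> P f a \<Longrightarrow> a = f" by blast
  have sf: "sublin f" and fp: "\<And>x. f x \<le> p x" using f by (auto simp: A_def)
  have odd: "f (- y) = - f y" for y
  proof -
    obtain q where q: "sublin q" "\<And>x. q x \<le> f x" "q (- y) \<le> - f y" using sublin_below[OF sf] by blast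
    then have "q = f" by (intro min) (auto simp: A_def P_def intro: order_trans fp)
    then show ?thesis using q(3) sublin_minus[OF sf, of "- y"] by simp
  qed
  have "linear f"
  proof
    fix x y
    show "f (x + y) = f x + f y"
      using sublin_add[OF sf, of x y] sublin_add[OF sf, of "- x" "- y"] odd[of x] odd[of y] odd[of "x + y"]
      by simp
  next
    fix c :: real and x
    show "f (c *\<^sub>R x) = c *\<^sub>R f x"
    proof (cases "0 \<le> c")
      case False
      then show ?thesis using sublin_scale[OF sf, of "- c" x] odd[of "c *\<^sub>R x"] by simp
    qed (simp add: sublin_scale[OF sf])
  qed
  then show thesis using fp by (rule that)
qed

lemma hahn_banach_norming:
  assumes p: "sublin p"
  obtains f where "linear f" "\<And>x. f x \<le> p x" "f y = p y"
proof -
  obtain q where q: "sublin q" "\<And>x. q x \<le> p x" "q (- y) \<le> - p y" using sublin_below[OF p] by blast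
  obtain f where f: "linear f" "\<And>x. f x \<le> q x" using sublin_dominates_linear[OF q(1)] by blast
  have fp: "f x \<le> p x" for x using f(2) q(2) order_trans by blast
  have "p y \<le> f y" using f(2)[of "- y"] q(3) linear_neg[OF f(1), of y] by linarith
  then show thesis using that[OF f(1) fp] fp[of y] by simp
qed

text \<open>Duality for a sum of two norms: \<open>g\<close> is taken below the infimum of
  \<open>p (x + y) - f y + q y\<close> over \<open>y\<close>. The shift \<open>0\<close> gives
  \<open>g \<le> p\<close>; evaluating at \<open>- x\<close> with shift \<open>x\<close> gives
  \<open>f - g \<le> q\<close>.\<close>

lemma hahn_banach_split:
  assumes p: "sublin p" and q: "sublin q" and f: "linear f" and fpq: "\<And>x. f x \<le> p x + q x"
  obtains g where "linear g" "\<And>x. g x \<le> p x" "\<And>x. f x - g x \<le> q x"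
proof -
  define G where "G y x = p (x + y) - f y + q y" for x y
  have lb: "- p (- x) \<le> G y x" for x y
    using sublin_diff[OF p, of y x] fpq[of y] by (simp add: G_def add.commute)
  have "sublin (\<lambda>x. INF y\<in>UNIV. G y x)"
  proof (rule sublin_INF[where b = "\<lambda>x. - p (- x)" and ?i0.0 = 0])
    fix x y u v
    show "\<exists>k\<in>UNIV. G k (x + y) \<le> G u x + G v y"
      using sublin_add[OF p, of "x + u" "y + v"] sublin_add[OF q, of u v]
      by (intro bexI[of _ "u + v"]) (auto simp: G_def algebra_simps linear_add[OF f])
  next
    fix x y and c :: real assume "0 < c"
    then show "\<exists>k\<in>UNIV. G k (c *\<^sub>R x) \<le> c * G y x"
      using sublin_scale[OF p, of c "x + y"] sublin_scale[OF q, of c y]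
      by (intro bexI[of _ "c *\<^sub>R y"]) (auto simp: G_def algebra_simps linear_scale[OF f])
  qed (use lb in \<open>auto simp: G_def sublin_0[OF p] sublin_0[OF q] linear_0[OF f]\<close>)
  then obtain g where g: "linear g" "\<And>x. g x \<le> (INF y. G y x)" using sublin_dominates_linear by blast
  have gG: "g x \<le> G y x" for x y
    by (rule order_trans[OF g(2) cINF_lower]) (use lb in \<open>auto intro!: bdd_belowI2[of _ "- p (- x)"]\<close>)
  have "g x \<le> p x" for x
    using gG[of x 0] by (simp add: G_def sublin_0[OF q] linear_0[OF f])
  moreover have "f x - g x \<le> q x" for x
    using gG[of "- x" x] by (simp add: G_def sublin_0[OF p] linear_neg[OF g(1)])
  ultimately show thesis using g(1) that by blast
qed

text \<open>A purely algebraic projection, with no continuity claimed. It turns seminorms known on a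
  subspace into seminorms on the whole type, to which the Hahn-Banach lemmas above apply.\<close>

lemma projection_onto_subspace:
  fixes S :: "'a::real_vector set"
  assumes "subspace S"
  obtains \<pi> where "linear \<pi>" "\<And>x. \<pi> x \<in> S" "\<And>x. x \<in> S \<Longrightarrow> \<pi> x = x"
proof -
  have "\<exists>g. g ` UNIV \<subseteq> S \<and> linear g \<and> (\<forall>v\<in>S. g (id v) = v)"
    using linear_exists_left_inverse_on[of id S] assms linear_id by auto
  then show thesis using that by auto
qed

section \<open>Seminorms and their \<open>\<ell>\<^sub>2\<close> and \<open>\<ell>\<^sub>4\<close>
  combinations\<close>

definition seminorm :: "('a::real_vector \<Rightarrow> real) \<Rightarrow> bool" where
  "seminorm p \<longleftrightarrow> (\<forall>x y. p (x + y) \<le> p x + p y) \<and> (\<forall>c x. p (c *\<^sub>R x) = \<bar>c\<bar> * p x)"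

lemma seminormI:
  "(\<And>x y. p (x + y) \<le> p x + p y) \<Longrightarrow> (\<And>c x. p (c *\<^sub>R x) = \<bar>c\<bar> * p x) \<Longrightarrow> seminorm p"
  by (auto simp: seminorm_def)

lemma seminorm_add: "seminorm p \<Longrightarrow> p (x + y) \<le> p x + p y"
  and seminorm_scale: "seminorm p \<Longrightarrow> p (c *\<^sub>R x) = \<bar>c\<bar> * p x"
  by (auto simp: seminorm_def)

lemma seminorm_0: "seminorm p \<Longrightarrow> p 0 = 0"
  using seminorm_scale[of p 0 0] by simp

lemma seminorm_minus: "seminorm p \<Longrightarrow> p (- x) = p x"
  using seminorm_scale[of p "-1" x] by simp

lemma seminorm_nonneg: "seminorm p \<Longrightarrow> 0 \<le> p x"
  using seminorm_add[of p x "- x"] by (simp add: seminorm_0 seminorm_minus)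

lemma seminorm_sublin: "seminorm p \<Longrightarrow> sublin p"
  by (auto simp: sublin_def seminorm_add seminorm_scale seminorm_0)

lemma seminorm_sum:
  assumes "seminorm p"
  shows "p (\<Sum>i\<in>I. x i) \<le> (\<Sum>i\<in>I. p (x i))"
  by (induction I rule: infinite_finite_induct)
    (auto simp: seminorm_0[OF assms] intro: order_trans[OF seminorm_add[OF assms]])

lemma seminorm_comp: "seminorm p \<Longrightarrow> linear L \<Longrightarrow> seminorm (\<lambda>x. p (L x))"
  by (rule seminormI) (auto simp: linear_add linear_scale seminorm_add seminorm_scale)

lemma seminorm_cmult: "seminorm p \<Longrightarrow> 0 \<le> c \<Longrightarrow> seminorm (\<lambda>x. c * p x)"
  by (rule seminormI) (auto simp: seminorm_scale distrib_left[symmetric] intro: mult_left_mono seminorm_add)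

lemma linear_abs_le:
  assumes "seminorm p" "linear f" "\<And>x. f x \<le> p x"
  shows "\<bar>f x\<bar> \<le> p x"
  using assms(3)[of x] assms(3)[of "- x"] by (simp add: linear_neg[OF assms(2)] seminorm_minus[OF assms(1)])

lemma L2_set_power2: "(L2_set f A)\<^sup>2 = (\<Sum>i\<in>A. (f i)\<^sup>2)"
  by (simp add: L2_set_def sum_nonneg)

lemma seminorm_L2_set:
  assumes "\<And>i. i \<in> A \<Longrightarrow> seminorm (p i)"
  shows "seminorm (\<lambda>x. L2_set (\<lambda>i. p i x) A)"
proof (rule seminormI)
  fix x y
  have "L2_set (\<lambda>i. p i (x + y)) A \<le> L2_set (\<lambda>i. p i x + p i y) A"
    by (rule L2_set_mono) (use assms in \<open>auto simp: seminorm_add seminorm_nonneg\<close>)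
  also have "\<dots> \<le> L2_set (\<lambda>i. p i x) A + L2_set (\<lambda>i. p i y) A" by (rule L2_set_triangle_ineq)
  finally show "L2_set (\<lambda>i. p i (x + y)) A \<le> L2_set (\<lambda>i. p i x) A + L2_set (\<lambda>i. p i y) A" .
next
  fix c :: real and x
  have "L2_set (\<lambda>i. p i (c *\<^sub>R x)) A = L2_set (\<lambda>i. \<bar>c\<bar> * p i x) A"
    by (rule L2_set_cong) (use assms in \<open>auto simp: seminorm_scale\<close>)
  then show "L2_set (\<lambda>i. p i (c *\<^sub>R x)) A = \<bar>c\<bar> * L2_set (\<lambda>i. p i x) A"
    by (simp add: L2_set_right_distrib)
qed

text \<open>Written as the root of an \<open>L2_set\<close> of squares, so that the triangle
  inequality comes from that of \<open>L2_set\<close> together with Cauchy-Schwarz for the mixed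
  term of \<open>(f i + g i)\<^sup>2\<close>.\<close>

definition L4_set :: "('i \<Rightarrow> real) \<Rightarrow> 'i set \<Rightarrow> real" where
  "L4_set f A = sqrt (L2_set (\<lambda>i. (f i)\<^sup>2) A)"

lemma L4_set_power4: "(L4_set f A) ^ 4 = (\<Sum>i\<in>A. (f i) ^ 4)"
proof -
  have "(L4_set f A) ^ 4 = ((sqrt (L2_set (\<lambda>i. (f i)\<^sup>2) A))\<^sup>2)\<^sup>2"
    unfolding L4_set_def by (simp only: power_mult[symmetric]) simp
  also have "\<dots> = (\<Sum>i\<in>A. (f i) ^ 4)" by (simp add: L2_set_power2)
  finally show ?thesis .
qed

lemma L4_set_triangle: "L4_set (\<lambda>i. f i + g i) A \<le> L4_set f A + L4_set g A"
proof -
  define a b where "a = L2_set (\<lambda>i. (f i)\<^sup>2) A" and "b = L2_set (\<lambda>i. (g i)\<^sup>2) A"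
  have ab: "0 \<le> a" "0 \<le> b" by (simp_all add: a_def b_def)
  have fg: "L2_set (\<lambda>i. f i * g i) A \<le> sqrt (a * b)"
  proof (rule real_le_rsqrt)
    have "(L2_set (\<lambda>i. f i * g i) A)\<^sup>2 = (\<Sum>i\<in>A. \<bar>(f i)\<^sup>2\<bar> * \<bar>(g i)\<^sup>2\<bar>)"
      by (simp add: L2_set_power2 power_mult_distrib)
    also have "\<dots> \<le> a * b" unfolding a_def b_def by (rule L2_set_mult_ineq)
    finally show "(L2_set (\<lambda>i. f i * g i) A)\<^sup>2 \<le> a * b" .
  qed
  have "L2_set (\<lambda>i. (f i + g i)\<^sup>2) A = L2_set (\<lambda>i. ((f i)\<^sup>2 + 2 * (f i * g i)) + (g i)\<^sup>2) A"
    by (simp add: power2_sum algebra_simps)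
  also have "\<dots> \<le> L2_set (\<lambda>i. (f i)\<^sup>2 + 2 * (f i * g i)) A + b"
    unfolding b_def by (rule L2_set_triangle_ineq)
  also have "\<dots> \<le> a + L2_set (\<lambda>i. 2 * (f i * g i)) A + b"
    unfolding a_def using L2_set_triangle_ineq by simp
  also have "\<dots> = a + 2 * L2_set (\<lambda>i. f i * g i) A + b"
    using L2_set_right_distrib[of 2 "\<lambda>i. f i * g i" A] by simp
  also have "\<dots> \<le> a + 2 * sqrt (a * b) + b" using fg by simp
  also have "\<dots> = (sqrt a + sqrt b)\<^sup>2" using ab by (simp add: power2_sum real_sqrt_mult)
  finally show ?thesis
    unfolding L4_set_def a_def[symmetric] b_def[symmetric] by (intro real_le_lsqrt) (use ab in auto)
qed

lemma L4_set_mono: "(\<And>i. i \<in> A \<Longrightarrow> 0 \<le> f i \<and> f i \<le> g i) \<Longrightarrow> L4_set f A \<le> L4_set g A"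
  unfolding L4_set_def by (intro real_sqrt_le_mono L2_set_mono) (auto intro: power_mono)

lemma seminorm_L4_set:
  assumes "\<And>i. i \<in> A \<Longrightarrow> seminorm (p i)"
  shows "seminorm (\<lambda>x. L4_set (\<lambda>i. p i x) A)"
proof (rule seminormI)
  fix x y
  have "L4_set (\<lambda>i. p i (x + y)) A \<le> L4_set (\<lambda>i. p i x + p i y) A"
    by (rule L4_set_mono) (use assms in \<open>auto simp: seminorm_add seminorm_nonneg\<close>)
  also have "\<dots> \<le> L4_set (\<lambda>i. p i x) A + L4_set (\<lambda>i. p i y) A" by (rule L4_set_triangle)
  finally show "L4_set (\<lambda>i. p i (x + y)) A \<le> L4_set (\<lambda>i. p i x) A + L4_set (\<lambda>i. p i y) A" .
next
  fix c :: real and x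
  have "L2_set (\<lambda>i. (p i (c *\<^sub>R x))\<^sup>2) A = L2_set (\<lambda>i. c\<^sup>2 * (p i x)\<^sup>2) A"
    by (rule L2_set_cong) (use assms in \<open>auto simp: seminorm_scale power_mult_distrib\<close>)
  also have "\<dots> = c\<^sup>2 * L2_set (\<lambda>i. (p i x)\<^sup>2) A" by (simp add: L2_set_right_distrib)
  finally show "L4_set (\<lambda>i. p i (c *\<^sub>R x)) A = \<bar>c\<bar> * L4_set (\<lambda>i. p i x) A"
    by (simp add: L4_set_def real_sqrt_mult)
qed

section \<open>The James--Lindenstrauss norm\<close>

lemma scaleR_fun_apply [simp]: "(c *\<^sub>R f) x = c *\<^sub>R f x"
  by (simp add: scaleR_fun_def)

lemma sum_fun_apply: "(\<Sum>i\<in>I. f i) x = (\<Sum>i\<in>I. f i x)"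
  by (induction I rule: infinite_finite_induct) auto

text \<open>
  Coordinates are split into consecutive groups; the \<open>n\<close>-th one carries the norm of
  \<open>\<ell>\<^sub>1(d) \<oplus> \<ell>\<^sub>\<infinity>(2^d)\<close> with \<open>d = 16^n\<close>. The dimensions grow so fast that \<open>sqrt d\<close>
  beats the summable weights \<open>2^(-n)\<close> used below.
\<close>

definition dm :: "nat \<Rightarrow> nat" where "dm n = 16 ^ n"

definition off :: "nat \<Rightarrow> nat" where "off n = (\<Sum>m<n. dm m + 2 ^ dm m)"

definition gnorm :: "nat \<Rightarrow> (nat \<Rightarrow> real) \<Rightarrow> real" where
  "gnorm n w = (\<Sum>i<dm n. \<bar>w (off n + i)\<bar>) + Max ((\<lambda>t. \<bar>w (off n + dm n + t)\<bar>) ` {..<2 ^ dm n})"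

text \<open>Truncated after \<open>K\<close> groups, hence finite on every sequence. It increases
  with \<open>K\<close>, and the full \<open>\<ell>\<^sub>4\<close>-sum appears only as a supremum
  over \<open>K\<close>.\<close>

definition wnorm :: "nat \<Rightarrow> (nat \<Rightarrow> real) \<Rightarrow> real" where
  "wnorm K w = L4_set (\<lambda>n. gnorm n w) {..<K}"

lemma off_Suc: "off (Suc n) = off n + dm n + 2 ^ dm n"
  by (simp add: off_def)

lemma off_less_Suc: "off n < off (Suc n)"
  by (simp add: off_Suc)

lemma off_mono: "m \<le> n \<Longrightarrow> off m \<le> off n"
  using lift_Suc_mono_le[of off] off_less_Suc by (simp add: less_imp_le)

lemma off_ge: "n \<le> off n"
  by (induction n) (use off_less_Suc le_less_trans in \<open>auto simp: Suc_le_eq\<close>)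

lemma group_exists:
  obtains n where "off n \<le> c" "c < off (Suc n)"
proof -
  define n where "n = (LEAST n. c < off (Suc n))"
  have ex: "c < off (Suc c)" using off_ge[of "Suc c"] by simp
  have 1: "c < off (Suc n)" unfolding n_def by (rule LeastI[of "\<lambda>n. c < off (Suc n)", OF ex])
  have "off n \<le> c"
  proof (cases n)
    case (Suc m)
    then have "\<not> c < off (Suc m)" using not_less_Least[of m "\<lambda>n. c < off (Suc n)"] by (simp add: n_def)
    then show ?thesis using Suc by simp
  qed (simp add: off_def)
  with 1 show thesis by (rule that[rotated])
qed

lemma group_cases:
  assumes "off n \<le> c" "c < off (Suc n)"
  obtains (sum) i where "i < dm n" "c = off n + i" | (max) t where "t < 2 ^ dm n" "c = off n + dm n + t"
proof (cases "c < off n + dm n")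
  case True
  then show thesis using assms sum[of "c - off n"] by auto
next
  case False
  then show thesis using assms max[of "c - (off n + dm n)"] by (auto simp: off_Suc)
qed

lemma seminorm_abs_coord: "seminorm (\<lambda>w :: nat \<Rightarrow> real. \<bar>w c\<bar>)"
  by (rule seminormI) (auto simp: abs_mult)

lemma seminorm_Max:
  assumes I: "finite I" "I \<noteq> {}" and p: "\<And>i. i \<in> I \<Longrightarrow> seminorm (p i)"
  shows "seminorm (\<lambda>x. Max ((\<lambda>i. p i x) ` I))"
proof (rule seminormI)
  fix x y
  have "p i (x + y) \<le> Max ((\<lambda>i. p i x) ` I) + Max ((\<lambda>i. p i y) ` I)" if "i \<in> I" for i
    using seminorm_add[OF p[OF that], of x y] Max_ge[of "(\<lambda>i. p i x) ` I" "p i x"]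
      Max_ge[of "(\<lambda>i. p i y) ` I" "p i y"] that I by fastforce
  then show "Max ((\<lambda>i. p i (x + y)) ` I) \<le> Max ((\<lambda>i. p i x) ` I) + Max ((\<lambda>i. p i y) ` I)"
    using I by (simp add: Max_le_iff)
next
  fix c :: real and x
  have "Max ((\<lambda>i. p i (c *\<^sub>R x)) ` I) = Max ((\<lambda>r. \<bar>c\<bar> * r) ` (\<lambda>i. p i x) ` I)"
    unfolding image_image by (intro arg_cong[of _ _ Max] image_cong) (auto simp: seminorm_scale p)
  also have "\<dots> = \<bar>c\<bar> * Max ((\<lambda>i. p i x) ` I)"
    by (rule mono_Max_commute[symmetric]) (use I in \<open>auto simp: mono_def mult_left_mono\<close>)
  finally show "Max ((\<lambda>i. p i (c *\<^sub>R x)) ` I) = \<bar>c\<bar> * Max ((\<lambda>i. p i x) ` I)" .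
qed

lemma seminorm_plus: "seminorm p \<Longrightarrow> seminorm q \<Longrightarrow> seminorm (\<lambda>x. p x + q x)"
  by (rule seminormI) (auto simp: seminorm_scale distrib_left dest: seminorm_add[of p] seminorm_add[of q]
      intro: add_mono[THEN order_trans, OF seminorm_add seminorm_add])

lemma seminorm_sum_abs: "seminorm (\<lambda>w :: nat \<Rightarrow> real. \<Sum>i\<in>I. \<bar>w (h i)\<bar>)"
proof (rule seminormI)
  fix x y :: "nat \<Rightarrow> real"
  show "(\<Sum>i\<in>I. \<bar>(x + y) (h i)\<bar>) \<le> (\<Sum>i\<in>I. \<bar>x (h i)\<bar>) + (\<Sum>i\<in>I. \<bar>y (h i)\<bar>)"
    unfolding sum.distrib[symmetric] by (rule sum_mono) simp
qed (simp add: abs_mult sum_distrib_left)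

lemma seminorm_gnorm: "seminorm (gnorm n)"
  unfolding gnorm_def
  by (intro seminorm_plus seminorm_sum_abs seminorm_Max seminorm_abs_coord) (auto simp: lessThan_empty_iff)

lemma seminorm_wnorm: "seminorm (wnorm K)"
  unfolding wnorm_def by (intro seminorm_L4_set seminorm_gnorm)

lemma gnorm_nonneg: "0 \<le> gnorm n w"
  by (rule seminorm_nonneg[OF seminorm_gnorm])

lemma wnorm_nonneg: "0 \<le> wnorm K w"
  by (rule seminorm_nonneg[OF seminorm_wnorm])

lemma wnorm_power4: "wnorm K w ^ 4 = (\<Sum>n<K. gnorm n w ^ 4)"
  by (simp add: wnorm_def L4_set_power4)

lemma gnorm_cong:
  assumes "\<And>c. off n \<le> c \<Longrightarrow> c < off (Suc n) \<Longrightarrow> w c = w' c"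
  shows "gnorm n w = gnorm n w'"
proof -
  have "w (off n + i) = w' (off n + i)" if "i < dm n" for i
    using assms that by (simp add: off_Suc)
  moreover have "w (off n + dm n + t) = w' (off n + dm n + t)" if "t < 2 ^ dm n" for t
    using assms that by (simp add: off_Suc)
  ultimately show ?thesis
    unfolding gnorm_def by (intro arg_cong2[of _ _ _ _ "(+)"] sum.cong arg_cong[of _ _ Max] image_cong) auto
qed

lemma gnorm_eq_0: "(\<And>c. off n \<le> c \<Longrightarrow> c < off (Suc n) \<Longrightarrow> w c = 0) \<Longrightarrow> gnorm n w = 0"
  using gnorm_cong[of n w 0] seminorm_0[OF seminorm_gnorm] by simp

lemma wnorm_cong:
  assumes "\<And>c. c < off K \<Longrightarrow> w c = w' c"
  shows "wnorm K w = wnorm K w'"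
proof -
  have "gnorm n w = gnorm n w'" if "n < K" for n
    using assms off_mono[of "Suc n" K] that by (intro gnorm_cong) auto
  then show ?thesis unfolding wnorm_def L4_set_def by (intro arg_cong[of _ _ sqrt] L2_set_cong) auto
qed

lemma max_le_gnorm: "t < 2 ^ dm n \<Longrightarrow> \<bar>w (off n + dm n + t)\<bar> \<le> gnorm n w"
  unfolding gnorm_def by (rule add_increasing) (auto intro: sum_nonneg)

lemma sum_le_gnorm: "(\<Sum>i<dm n. \<bar>w (off n + i)\<bar>) \<le> gnorm n w"
proof -
  have "0 \<le> Max ((\<lambda>t. \<bar>w (off n + dm n + t)\<bar>) ` {..<2 ^ dm n})"
    by (rule order_trans[OF _ Max_ge, OF abs_ge_zero[of "w (off n + dm n + 0)"]]) (simp, rule imageI, simp)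
  then show ?thesis by (simp add: gnorm_def)
qed

lemma coord_le_gnorm:
  assumes "off n \<le> c" "c < off (Suc n)"
  shows "\<bar>w c\<bar> \<le> gnorm n w"
  using assms
proof (cases rule: group_cases)
  case (sum i)
  then have "\<bar>w c\<bar> \<le> (\<Sum>i<dm n. \<bar>w (off n + i)\<bar>)"
    by (auto intro: member_le_sum[of i "{..<dm n}" "\<lambda>i. \<bar>w (off n + i)\<bar>"])
  then show ?thesis using sum_le_gnorm order_trans by blast
qed (simp add: max_le_gnorm)

lemma gnorm_le_wnorm:
  assumes "n < K"
  shows "gnorm n w \<le> wnorm K w"
proof -
  have "gnorm n w ^ 4 \<le> wnorm K w ^ 4"
    unfolding wnorm_power4 by (rule member_le_sum) (use assms in auto)
  then show ?thesis using wnorm_nonneg power_le_imp_le_base[of _ 3] by (auto simp: numeral_eq_Suc)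
qed

lemma wnorm_mono:
  assumes "K \<le> K'"
  shows "wnorm K w \<le> wnorm K' w"
proof -
  have "wnorm K w ^ 4 \<le> wnorm K' w ^ 4"
    unfolding wnorm_power4 by (rule sum_mono2) (use assms in auto)
  then show ?thesis using wnorm_nonneg power_le_imp_le_base[of _ 3] by (auto simp: numeral_eq_Suc)
qed

definition unit_vec :: "nat \<Rightarrow> nat \<Rightarrow> real" where "unit_vec i = (\<lambda>j. if j = i then 1 else 0)"

lemma gnorm_unit: "gnorm n (unit_vec c) \<le> (if off n \<le> c \<and> c < off (Suc n) then 1 else 0)"
proof (cases "off n \<le> c \<and> c < off (Suc n)")
  case False
  then show ?thesis by (subst gnorm_eq_0) (auto simp: unit_vec_def)
next
  case True
  then have "off n \<le> c" "c < off (Suc n)" by auto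
  then show ?thesis
  proof (cases rule: group_cases)
    case (sum i)
    have "(\<lambda>t. \<bar>unit_vec c (off n + dm n + t)\<bar>) ` {..<2 ^ dm n} = {0}"
      using sum by (auto simp: unit_vec_def image_def intro: exI[of _ 0])
    moreover have "(\<Sum>j<dm n. \<bar>unit_vec c (off n + j)\<bar>) = (\<Sum>j<dm n. if j = i then 1 else 0)"
      using sum by (intro sum.cong) (auto simp: unit_vec_def)
    ultimately show ?thesis using True sum by (simp add: gnorm_def)
  next
    case (max t)
    have "(\<Sum>j<dm n. \<bar>unit_vec c (off n + j)\<bar>) = 0"
      using max by (intro sum.neutral) (auto simp: unit_vec_def)
    moreover have "Max ((\<lambda>t. \<bar>unit_vec c (off n + dm n + t)\<bar>) ` {..<2 ^ dm n}) \<le> 1"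
      by (rule Max.boundedI, simp, simp add: lessThan_empty_iff) (auto simp: unit_vec_def)
    ultimately show ?thesis using True by (simp add: gnorm_def)
  qed
qed

lemma group_unique:
  assumes "off n \<le> c" "c < off (Suc n)" "off m \<le> c" "c < off (Suc m)"
  shows "m = n"
  using assms off_mono[of "Suc n" m] off_mono[of "Suc m" n] by (metis not_less_eq_eq leD nle_le le_less_trans less_le_trans)

lemma wnorm_unit: "wnorm K (unit_vec c) \<le> 1"
proof -
  obtain n where n: "off n \<le> c" "c < off (Suc n)" using group_exists by blast
  have "gnorm m (unit_vec c) ^ 4 \<le> (if m = n then 1 else 0)" for m
    using gnorm_unit[of m c] gnorm_nonneg[of m "unit_vec c"] group_unique[OF n, of m]
    by (auto split: if_splits intro: power_le_one)
  then have "wnorm K (unit_vec c) ^ 4 \<le> (\<Sum>m<K. if m = n then 1 else 0)"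
    unfolding wnorm_power4 by (intro sum_mono)
  also have "\<dots> \<le> 1 ^ 4" by simp
  finally have "wnorm K (unit_vec c) ^ Suc 3 \<le> 1 ^ Suc 3" by (simp add: numeral_eq_Suc)
  then show ?thesis by (rule power_le_imp_le_base) simp
qed

text \<open>
  Basis index \<open>i\<close> maps to the coordinate \<open>lab i\<close>, and every coordinate is hit infinitely often;
  \<open>lsum x a b\<close> is the image of the segment \<open>[a, b)\<close> of \<open>x\<close>.
\<close>

definition lab :: "nat \<Rightarrow> nat" where "lab i = fst (prod_decode i)"

definition idx :: "nat \<Rightarrow> nat \<Rightarrow> nat" where "idx c m = prod_encode (c, m)"

definition lsum :: "(nat \<Rightarrow> real) \<Rightarrow> nat \<Rightarrow> nat \<Rightarrow> nat \<Rightarrow> real" where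
  "lsum x a b c = (\<Sum>i | i \<in> {a..<b} \<and> lab i = c. x i)"

section \<open>The label map on segments\<close>

lemma lab_idx [simp]: "lab (idx c m) = c"
  by (simp add: lab_def idx_def)

lemma idx_ge: "m \<le> idx c m"
  unfolding idx_def by (rule le_prod_encode_2)

lemma lab_le: "lab i \<le> i"
  unfolding lab_def by (metis le_prod_encode_1 prod.collapse prod_decode_inverse)

lemma linear_lsum: "linear (\<lambda>x. lsum x a b)"
  by (rule linearI) (auto simp: lsum_def fun_eq_iff sum.distrib sum_distrib_left)

lemma lsum_eq: "lsum x a b = (\<Sum>i=a..<b. x i *\<^sub>R unit_vec (lab i))"
proof
  fix c
  have "(\<Sum>i=a..<b. x i *\<^sub>R unit_vec (lab i)) c = (\<Sum>i=a..<b. if lab i = c then x i else 0)"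
    unfolding sum_fun_apply by (rule sum.cong) (auto simp: unit_vec_def)
  then show "lsum x a b c = (\<Sum>i=a..<b. x i *\<^sub>R unit_vec (lab i)) c"
    by (simp add: lsum_def sum.If_cases Int_def)
qed

lemma lsum_concat: "a \<le> b \<Longrightarrow> b \<le> c \<Longrightarrow> lsum x a b + lsum x b c = lsum x a c"
  unfolding lsum_eq by (rule sum.atLeastLessThan_concat)

lemma lsum_eq_0: "(\<And>i. a \<le> i \<Longrightarrow> i < b \<Longrightarrow> x i = 0) \<Longrightarrow> lsum x a b = 0"
  unfolding lsum_eq by (rule sum.neutral) auto

lemma lsum_unit: "a \<le> k \<Longrightarrow> k < b \<Longrightarrow> lsum (unit_vec k) a b = unit_vec (lab k)"
proof -
  assume k: "a \<le> k" "k < b"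
  have "lsum (unit_vec k) a b = (\<Sum>l=a..<b. if l = k then unit_vec (lab k) else 0)"
    unfolding lsum_eq by (rule sum.cong) (auto simp: unit_vec_def)
  then show ?thesis using k by simp
qed

lemma seminorm_wnorm_lsum: "seminorm (\<lambda>x. wnorm K (lsum x a b))"
  by (rule seminorm_comp[OF seminorm_wnorm linear_lsum])

lemma wnorm_lsum_le: "wnorm K (lsum x a b) \<le> (\<Sum>i=a..<b. \<bar>x i\<bar>)"
proof -
  have "wnorm K (lsum x a b) \<le> (\<Sum>i=a..<b. wnorm K (x i *\<^sub>R unit_vec (lab i)))"
    unfolding lsum_eq by (rule seminorm_sum[OF seminorm_wnorm])
  also have "\<dots> \<le> (\<Sum>i=a..<b. \<bar>x i\<bar>)"
    by (rule sum_mono) (simp add: seminorm_scale[OF seminorm_wnorm] mult_left_le wnorm_unit)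
  finally show ?thesis .
qed

text \<open>Monotone \<open>p\<close> admits empty segments. Clipping the division points by
  \<open>min\<close> or \<open>max\<close> with \<open>n\<close> therefore stays within the family,
  which is how heads and tails are treated.\<close>

definition variation :: "(nat \<Rightarrow> nat) \<Rightarrow> nat \<Rightarrow> nat \<Rightarrow> (nat \<Rightarrow> real) \<Rightarrow> real" where
  "variation p k K x = L2_set (\<lambda>s. wnorm K (lsum x (p s) (p (Suc s)))) {..<k}"

definition variations :: "(nat \<Rightarrow> real) \<Rightarrow> real set" where
  "variations x = {variation p k K x | p k K. mono p}"

definition jspace :: "(nat \<Rightarrow> real) nspace" where
  "jspace = \<lparr>vecs = {x. bdd_above (variations x)}, nrm = (\<lambda>x. Sup (variations x))\<rparr>"

abbreviation jvecs :: "(nat \<Rightarrow> real) set" where "jvecs \<equiv> vecs jspace"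

abbreviation jnorm :: "(nat \<Rightarrow> real) \<Rightarrow> real" where "jnorm \<equiv> nrm jspace"

definition head :: "nat \<Rightarrow> (nat \<Rightarrow> real) \<Rightarrow> nat \<Rightarrow> real" where
  "head n x = (\<lambda>i. if i < n then x i else 0)"

definition tail :: "nat \<Rightarrow> (nat \<Rightarrow> real) \<Rightarrow> nat \<Rightarrow> real" where
  "tail n x = (\<lambda>i. if n \<le> i then x i else 0)"

lemma seminorm_variation: "seminorm (variation p k K)"
  unfolding variation_def by (intro seminorm_L2_set seminorm_wnorm_lsum)

lemma variations_nonempty: "variations x \<noteq> {}"
  unfolding variations_def using mono_Suc by blast

lemma variation_le_jnorm: "x \<in> jvecs \<Longrightarrow> mono p \<Longrightarrow> variation p k K x \<le> jnorm x"
  unfolding jspace_def by (auto intro!: cSup_upper simp: variations_def)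

lemma jnorm_leI:
  assumes "\<And>p k K. mono p \<Longrightarrow> variation p k K x \<le> C"
  shows "x \<in> jvecs" "jnorm x \<le> C"
proof -
  have "v \<le> C" if "v \<in> variations x" for v using assms that by (auto simp: variations_def)
  then show "x \<in> jvecs" "jnorm x \<le> C"
    using variations_nonempty[of x] by (auto simp: jspace_def intro!: bdd_aboveI[of _ C] cSup_least)
qed

lemma jnorm_nonneg: "x \<in> jvecs \<Longrightarrow> 0 \<le> jnorm x"
  using variation_le_jnorm[of x "\<lambda>_. 0" 0 0] by (auto simp: variation_def mono_def)

lemma jvecs_add: "x \<in> jvecs \<Longrightarrow> y \<in> jvecs \<Longrightarrow> x + y \<in> jvecs"
  and jnorm_add: "x \<in> jvecs \<Longrightarrow> y \<in> jvecs \<Longrightarrow> jnorm (x + y) \<le> jnorm x + jnorm y"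
proof -
  assume "x \<in> jvecs" "y \<in> jvecs"
  then have "variation p k K (x + y) \<le> jnorm x + jnorm y" if "mono p" for p k K
    using that by (meson add_mono order_trans seminorm_add[OF seminorm_variation] variation_le_jnorm)
  then show "x + y \<in> jvecs" "jnorm (x + y) \<le> jnorm x + jnorm y" using jnorm_leI by blast+
qed

lemma jvecs_scale: "x \<in> jvecs \<Longrightarrow> c *\<^sub>R x \<in> jvecs"
  and jnorm_scale_le: "x \<in> jvecs \<Longrightarrow> jnorm (c *\<^sub>R x) \<le> \<bar>c\<bar> * jnorm x"
proof -
  assume "x \<in> jvecs"
  then have "variation p k K (c *\<^sub>R x) \<le> \<bar>c\<bar> * jnorm x" if "mono p" for p k K
    using that by (simp add: seminorm_scale[OF seminorm_variation] mult_left_mono variation_le_jnorm)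
  then show "c *\<^sub>R x \<in> jvecs" "jnorm (c *\<^sub>R x) \<le> \<bar>c\<bar> * jnorm x" using jnorm_leI by blast+
qed

lemma jvecs_0: "0 \<in> jvecs" and jnorm_0: "jnorm 0 = 0"
proof -
  have "variation p k K 0 \<le> 0" for p k K by (simp add: seminorm_0[OF seminorm_variation])
  then show "0 \<in> jvecs" "jnorm 0 = 0" using jnorm_leI[of 0 0] jnorm_nonneg[of 0] by auto
qed

lemma jnorm_scale: "x \<in> jvecs \<Longrightarrow> jnorm (c *\<^sub>R x) = \<bar>c\<bar> * jnorm x"
proof (cases "c = 0")
  case False
  assume x: "x \<in> jvecs"
  have "jnorm ((1/c) *\<^sub>R (c *\<^sub>R x)) \<le> \<bar>1/c\<bar> * jnorm (c *\<^sub>R x)"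
    by (intro jnorm_scale_le jvecs_scale x)
  then show ?thesis using jnorm_scale_le[OF x, of c] False by (simp add: field_simps)
qed (simp add: jnorm_0)

lemma jvecs_subspace: "subspace jvecs"
  by (auto simp: subspace_def jvecs_0 jvecs_add jvecs_scale)

lemma wnorm_le_jnorm: "x \<in> jvecs \<Longrightarrow> wnorm K (lsum x a b) \<le> jnorm x"
proof (cases "a \<le> b")
  case True
  assume "x \<in> jvecs"
  then have "variation (\<lambda>s. if s = 0 then a else b) 1 K x \<le> jnorm x"
    by (rule variation_le_jnorm) (use True in \<open>auto simp: mono_def\<close>)
  then show ?thesis by (simp add: variation_def L2_set_def wnorm_nonneg)
qed (simp add: jnorm_nonneg lsum_eq_0 seminorm_0[OF seminorm_wnorm])

lemma coord_le_jnorm: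
  assumes "x \<in> jvecs"
  shows "\<bar>x i\<bar> \<le> jnorm x"
proof -
  obtain n where n: "off n \<le> lab i" "lab i < off (Suc n)" using group_exists by blast
  have "\<bar>x i\<bar> = \<bar>lsum x i (Suc i) (lab i)\<bar>" by (simp add: lsum_eq unit_vec_def)
  also have "\<dots> \<le> gnorm n (lsum x i (Suc i))" by (rule coord_le_gnorm[OF n])
  also have "\<dots> \<le> wnorm (Suc n) (lsum x i (Suc i))" by (rule gnorm_le_wnorm) simp
  also have "\<dots> \<le> jnorm x" by (rule wnorm_le_jnorm[OF assms])
  finally show ?thesis .
qed

lemma normed_space_jspace: "normed_space jspace"
proof -
  have "jnorm x = 0 \<longleftrightarrow> x = 0" if "x \<in> jvecs" for x
    using coord_le_jnorm[OF that] jnorm_0 by fastforce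
  then show ?thesis
    unfolding normed_space_def by (simp add: jvecs_subspace jnorm_nonneg jnorm_scale jnorm_add)
qed

text \<open>A crude bound, but one that sees finitely many coordinates only: it puts finitely
  supported sequences into the space and makes each variation continuous under coordinatewise
  convergence.\<close>

lemma variation_le_sum:
  assumes "mono p"
  shows "variation p k K x \<le> (\<Sum>i<p k. \<bar>x i\<bar>)"
proof -
  have "(\<Sum>s<k. \<Sum>i=p s..<p (Suc s). \<bar>x i\<bar>) = (\<Sum>i=p 0..<p k. \<bar>x i\<bar>)"
  proof (induction k)
    case (Suc k)
    then show ?case using sum.atLeastLessThan_concat[of "p 0" "p k" "p (Suc k)" "\<lambda>i. \<bar>x i\<bar>"]
        monoD[OF assms, of 0 k] monoD[OF assms, of k "Suc k"] by simp
  qed simp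
  moreover have "(\<Sum>i=p 0..<p k. \<bar>x i\<bar>) \<le> (\<Sum>i<p k. \<bar>x i\<bar>)" by (rule sum_mono2) auto
  moreover have "variation p k K x \<le> (\<Sum>s<k. wnorm K (lsum x (p s) (p (Suc s))))"
    unfolding variation_def by (rule L2_set_le_sum) (simp add: wnorm_nonneg)
  moreover have "\<dots> \<le> (\<Sum>s<k. \<Sum>i=p s..<p (Suc s). \<bar>x i\<bar>)" by (intro sum_mono wnorm_lsum_le)
  ultimately show ?thesis by linarith
qed

section \<open>Heads, tails and the lower \<open>2\<close>-estimate\<close>

lemma linear_head: "linear (head n)" and linear_tail: "linear (tail n)"
  by (auto intro!: linearI simp: head_def tail_def fun_eq_iff)

lemma head_plus_tail: "head n x + tail n x = x"
  by (auto simp: head_def tail_def fun_eq_iff)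

lemma lsum_head: "lsum (head n x) a b = lsum x (min a n) (min b n)"
  unfolding lsum_def fun_eq_iff head_def by (auto intro!: sum.mono_neutral_cong_right split: if_splits)

lemma lsum_tail: "lsum (tail n x) a b = lsum x (max a n) (max b n)"
  unfolding lsum_def fun_eq_iff tail_def by (auto intro!: sum.mono_neutral_cong_right split: if_splits)

lemma variation_head: "variation p k K (head n x) = variation (\<lambda>s. min (p s) n) k K x"
  by (simp add: variation_def lsum_head)

lemma variation_tail: "variation p k K (tail n x) = variation (\<lambda>s. max (p s) n) k K x"
  by (simp add: variation_def lsum_tail)

lemma mono_min_max:
  assumes "mono p"
  shows "mono (\<lambda>s. min (p s) (n::nat))" "mono (\<lambda>s. max (p s) n)"
  by (intro monoI min.mono max.mono order_refl monoD[OF assms]; assumption)+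

lemma head_in_jvecs: "head n x \<in> jvecs"
  and jnorm_head_le_sum: "jnorm (head n x) \<le> (\<Sum>i<n. \<bar>x i\<bar>)"
proof -
  have "variation p k K (head n x) \<le> (\<Sum>i<n. \<bar>x i\<bar>)" if "mono p" for p k K
  proof -
    have "variation p k K (head n x) \<le> (\<Sum>i<min (p k) n. \<bar>x i\<bar>)"
      unfolding variation_head by (rule variation_le_sum[OF mono_min_max(1)[OF that]])
    also have "\<dots> \<le> (\<Sum>i<n. \<bar>x i\<bar>)" by (rule sum_mono2) auto
    finally show ?thesis .
  qed
  then show "head n x \<in> jvecs" "jnorm (head n x) \<le> (\<Sum>i<n. \<bar>x i\<bar>)" using jnorm_leI by blast+
qed

lemma jnorm_head: "x \<in> jvecs \<Longrightarrow> jnorm (head n x) \<le> jnorm x"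
  by (intro jnorm_leI(2)) (simp add: variation_head variation_le_jnorm mono_min_max)

lemma tail_in_jvecs: "x \<in> jvecs \<Longrightarrow> tail n x \<in> jvecs"
  and jnorm_tail: "x \<in> jvecs \<Longrightarrow> jnorm (tail n x) \<le> jnorm x"
  by (rule jnorm_leI[where C = "jnorm x"], simp add: variation_tail variation_le_jnorm mono_min_max)+

lemma variation_mono_K: "K \<le> K' \<Longrightarrow> variation p k K x \<le> variation p k K' x"
  unfolding variation_def by (intro L2_set_mono wnorm_mono wnorm_nonneg)

text \<open>A division clipped to the left of \<open>n\<close>, followed by one clipped to the right
  of \<open>n\<close>, is again a single division of \<open>x\<close>.\<close>

lemma variation_head_tail:
  assumes x: "x \<in> jvecs" and p: "mono p" and q: "mono q"
  shows "(variation p k K (head n x))\<^sup>2 + (variation q l L (tail n x))\<^sup>2 \<le> (jnorm x)\<^sup>2"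
proof -
  \<comment> \<open>Segment number \<open>k\<close> of \<open>r\<close> bridges from
    \<open>min (p k) n\<close> to \<open>max (q 0) n\<close>; its contribution is nonnegative and is
    dropped in the comparison of sums.\<close>
  define r where "r s = (if s \<le> k then min (p s) n else max (q (s - Suc k)) n)" for s
  define N where "N = max K L"
  define F where "F s = (wnorm N (lsum x (r s) (r (Suc s))))\<^sup>2" for s
  have r: "mono r"
  proof (rule monoI)
    fix s t :: nat assume "s \<le> t"
    then show "r s \<le> r t"
      using monoD[OF p, of s t] monoD[OF q diff_le_mono[OF \<open>s \<le> t\<close>, of "Suc k"]]
      by (auto simp: r_def min_def max_def)
  qed
  have "(\<Sum>s<k. F s) + (\<Sum>s<l. F (Suc k + s)) \<le> (\<Sum>s<Suc k + l. F s)"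
    by (induction l) (auto simp: F_def)
  moreover have "(\<Sum>s<k. F s) = (variation p k N (head n x))\<^sup>2"
    by (auto simp: F_def variation_def L2_set_power2 lsum_head r_def intro!: sum.cong)
  moreover have "(\<Sum>s<l. F (Suc k + s)) = (variation q l N (tail n x))\<^sup>2"
    by (auto simp: F_def variation_def L2_set_power2 lsum_tail r_def intro!: sum.cong)
  moreover have "(\<Sum>s<Suc k + l. F s) = (variation r (Suc k + l) N x)\<^sup>2"
    by (simp only: F_def variation_def L2_set_power2)
  moreover have "(variation r (Suc k + l) N x)\<^sup>2 \<le> (jnorm x)\<^sup>2"
    by (intro power_mono variation_le_jnorm x r seminorm_nonneg[OF seminorm_variation])
  moreover have "(variation p k K (head n x))\<^sup>2 \<le> (variation p k N (head n x))\<^sup>2"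
    "(variation q l L (tail n x))\<^sup>2 \<le> (variation q l N (tail n x))\<^sup>2"
    by (intro power_mono variation_mono_K seminorm_nonneg[OF seminorm_variation]; simp add: N_def)+
  ultimately show ?thesis by linarith
qed

lemma jnorm_head_tail:
  assumes x: "x \<in> jvecs"
  shows "(jnorm (head n x))\<^sup>2 + (jnorm (tail n x))\<^sup>2 \<le> (jnorm x)\<^sup>2"
proof -
  have 1: "variation p k K (head n x) \<le> sqrt ((jnorm x)\<^sup>2 - (variation q l L (tail n x))\<^sup>2)"
    if "mono p" "mono q" for p k K q l L
    by (rule real_le_rsqrt) (use variation_head_tail[OF x that] in \<open>simp add: algebra_simps\<close>)
  have 2: "(jnorm (head n x))\<^sup>2 + (variation q l L (tail n x))\<^sup>2 \<le> (jnorm x)\<^sup>2" if q: "mono q" for q l L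
  proof -
    have le: "jnorm (head n x) \<le> sqrt ((jnorm x)\<^sup>2 - (variation q l L (tail n x))\<^sup>2)"
      by (rule jnorm_leI(2)) (rule 1[OF _ q])
    have "(variation q l L (tail n x))\<^sup>2 \<le> (jnorm x)\<^sup>2"
      using variation_head_tail[OF x q q, of k K n l L] by (smt (verit) zero_le_power2)
    then show ?thesis
      using power_mono[OF le jnorm_nonneg[OF head_in_jvecs], of 2] by simp
  qed
  have "jnorm (tail n x) \<le> sqrt ((jnorm x)\<^sup>2 - (jnorm (head n x))\<^sup>2)"
    by (rule jnorm_leI(2), rule real_le_rsqrt) (use 2 in \<open>simp add: algebra_simps\<close>)
  moreover have "(jnorm (head n x))\<^sup>2 \<le> (jnorm x)\<^sup>2"
    by (intro power_mono jnorm_head x jnorm_nonneg head_in_jvecs)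
  ultimately show ?thesis
    using power_mono[of "jnorm (tail n x)" _ 2] jnorm_nonneg[OF tail_in_jvecs[OF x]] by fastforce
qed

text \<open>This is bounded completeness of the basis: each single variation only looks at the
  coordinates below its last division point, hence at a head.\<close>

lemma jvecs_if_heads_bounded:
  assumes "\<And>n. jnorm (head n x) \<le> C"
  shows "x \<in> jvecs" "jnorm x \<le> C"
proof -
  have "variation p k K x \<le> C" if p: "mono p" for p k K
  proof -
    have "variation p k K x = variation p k K (head (p k) x)"
      unfolding variation_head
      by (simp add: variation_def min_absorb1 monoD[OF p] cong: L2_set_cong_simp)
    also have "\<dots> \<le> C"
      using variation_le_jnorm[OF head_in_jvecs p] assms order_trans by blast
    finally show ?thesis .
  qed
  then show "x \<in> jvecs" "jnorm x \<le> C" using jnorm_leI by blast+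
qed

text \<open>If all tails had norm at least \<open>e\<close>, the \<open>2\<close>-estimate would
  bound all heads by \<open>sqrt ((jnorm x)\<^sup>2 - e\<^sup>2)\<close>, and bounded completeness
  would carry this bound over to \<open>x\<close> itself.\<close>

lemma tail_tendsto_0:
  assumes x: "x \<in> jvecs"
  shows "(\<lambda>n. jnorm (tail n x)) \<longlonglongrightarrow> 0"
proof (rule LIMSEQ_I)
  fix e :: real assume e: "0 < e"
  have "\<exists>n. \<not> (jnorm (tail n x) < e \<longrightarrow> False)"
  proof (rule ccontr)
    assume "\<not> ?thesis"
    then have ge: "e \<le> jnorm (tail n x)" for n by (meson not_le)
    then have le1: "e\<^sup>2 \<le> (jnorm (tail n x))\<^sup>2" for n using e by (intro power_mono) auto
    have "jnorm (head n x) \<le> sqrt ((jnorm x)\<^sup>2 - e\<^sup>2)" for n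
      by (rule real_le_rsqrt) (use jnorm_head_tail[OF x, of n] le1[of n] in linarith)
    then have "jnorm x \<le> sqrt ((jnorm x)\<^sup>2 - e\<^sup>2)" by (rule jvecs_if_heads_bounded(2))
    moreover have "e\<^sup>2 \<le> (jnorm x)\<^sup>2"
      using le1[of 0] jnorm_tail[OF x, of 0] ge[of 0] e by (smt (verit) power_mono)
    ultimately have "(jnorm x)\<^sup>2 \<le> (jnorm x)\<^sup>2 - e\<^sup>2"
      using power_mono[of "jnorm x" _ 2] jnorm_nonneg[OF x] by fastforce
    then show False using e by simp
  qed
  then obtain N where N: "jnorm (tail N x) < e" by blast
  have "norm (jnorm (tail n x) - 0) < e" if "N \<le> n" for n
  proof -
    have "tail n x = tail n (tail N x)" using that by (auto simp: tail_def fun_eq_iff)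
    then have "jnorm (tail n x) \<le> jnorm (tail N x)" using jnorm_tail[OF tail_in_jvecs[OF x]] by metis
    then show ?thesis using N jnorm_nonneg[OF tail_in_jvecs[OF x], of n] by simp
  qed
  then show "\<exists>no. \<forall>n\<ge>no. norm (jnorm (tail n x) - 0) < e" by blast
qed

section \<open>Normed spaces and their duals\<close>

lemma
  assumes "normed_space X"
  shows nspace_subspace: "subspace (vecs X)"
    and nspace_nonneg: "x \<in> vecs X \<Longrightarrow> 0 \<le> nrm X x"
    and nspace_eq_0: "x \<in> vecs X \<Longrightarrow> nrm X x = 0 \<longleftrightarrow> x = 0"
    and nspace_scale: "x \<in> vecs X \<Longrightarrow> nrm X (c *\<^sub>R x) = \<bar>c\<bar> * nrm X x"
    and nspace_add: "x \<in> vecs X \<Longrightarrow> y \<in> vecs X \<Longrightarrow> nrm X (x + y) \<le> nrm X x + nrm X y"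
  using assms unfolding normed_space_def by blast+

lemma nspace_minus: "normed_space X \<Longrightarrow> x \<in> vecs X \<Longrightarrow> nrm X (- x) = nrm X x"
  using nspace_scale[of X x "-1"] by simp

lemma nspace_triangle_minus:
  assumes X: "normed_space X" and x: "x \<in> vecs X" and y: "y \<in> vecs X"
  shows "nrm X x - nrm X y \<le> nrm X (x + y)"
proof -
  have "x + y \<in> vecs X" "- y \<in> vecs X"
    using x y nspace_subspace[OF X] by (auto intro: subspace_add subspace_neg)
  then show ?thesis using nspace_add[OF X, of "x + y" "- y"] nspace_minus[OF X y] by simp
qed

lemma limitin_ntop:
  assumes X: "normed_space X" and s: "\<And>n. \<sigma> n \<in> vecs X" and x: "x \<in> vecs X"
  shows "limitin (ntop X) \<sigma> x sequentially \<longleftrightarrow> (\<lambda>n. nrm X (\<sigma> n - x)) \<longlonglongrightarrow> 0"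
proof -
  interpret Metric_space "vecs X" "ndist X" by (rule Metric_space_ndist[OF X])
  have "\<sigma> n - x \<in> vecs X" for n using s x nspace_subspace[OF X] by (blast intro: subspace_diff)
  then show ?thesis
    using s x unfolding ntop_def limitin_metric tendsto_iff
    by (simp add: ndist_def nspace_nonneg[OF X])
qed

lemma dual_iff:
  "f \<in> vecs (dual X) \<longleftrightarrow> (\<forall>x\<in>vecs X. \<forall>y\<in>vecs X. f (x + y) = f x + f y) \<and>
      (\<forall>c. \<forall>x\<in>vecs X. f (c *\<^sub>R x) = c * f x) \<and>
      (\<exists>K. \<forall>x\<in>vecs X. \<bar>f x\<bar> \<le> K * nrm X x) \<and> (\<forall>x. x \<notin> vecs X \<longrightarrow> f x = 0)"
  by (simp add: dual_def bounded_op_def real_line_def)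

lemma dual_add: "f \<in> vecs (dual X) \<Longrightarrow> x \<in> vecs X \<Longrightarrow> y \<in> vecs X \<Longrightarrow> f (x + y) = f x + f y"
  and dual_scale: "f \<in> vecs (dual X) \<Longrightarrow> x \<in> vecs X \<Longrightarrow> f (c *\<^sub>R x) = c * f x"
  and dual_outside: "f \<in> vecs (dual X) \<Longrightarrow> x \<notin> vecs X \<Longrightarrow> f x = 0"
  unfolding dual_iff by blast+

lemma dual_at_0: "normed_space X \<Longrightarrow> f \<in> vecs (dual X) \<Longrightarrow> f 0 = 0"
  using dual_scale[of f X 0 0] subspace_0[OF nspace_subspace] by fastforce

lemma dual_diff:
  assumes X: "normed_space X" and "f \<in> vecs (dual X)" "x \<in> vecs X" "y \<in> vecs X"
  shows "f (x - y) = f x - f y"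
  using dual_add[of f X x "(-1) *\<^sub>R y"] dual_scale[of f X y "-1"] assms
    subspace_scale[OF nspace_subspace[OF X], of y "-1"] by simp

lemma dual_sum:
  assumes X: "normed_space X" and f: "f \<in> vecs (dual X)" and x: "\<And>i. i \<in> I \<Longrightarrow> x i \<in> vecs X"
  shows "f (\<Sum>i\<in>I. x i) = (\<Sum>i\<in>I. f (x i))"
  using x
proof (induction I rule: infinite_finite_induct)
  case (insert i I)
  then show ?case
    using dual_add[OF f, of "x i" "\<Sum>i\<in>I. x i"] subspace_sum[OF nspace_subspace[OF X], of I x] by simp
qed (auto simp: dual_at_0[OF X f])

lemma dual_abs_le:
  assumes X: "normed_space X" and f: "f \<in> vecs (dual X)"
  shows "x \<in> vecs X \<Longrightarrow> \<bar>f x\<bar> \<le> nrm (dual X) f * nrm X x"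
proof (cases "x = 0")
  case False
  assume x: "x \<in> vecs X"
  then have pos: "0 < nrm X x" using False nspace_eq_0[OF X x] nspace_nonneg[OF X x] by simp
  let ?y = "(1 / nrm X x) *\<^sub>R x"
  have "?y \<in> vecs X" "nrm X ?y \<le> 1"
    using x pos by (auto simp: nspace_scale[OF X] subspace_scale[OF nspace_subspace[OF X]])
  then have "\<bar>f ?y\<bar> \<le> nrm (dual X) f"
    unfolding dual_def nspace.simps by (intro cSup_upper dual_nrm_bound[OF X f]) auto
  then show ?thesis using pos by (simp add: dual_scale[OF f x] abs_mult field_simps)
next
  case True
  moreover assume "x \<in> vecs X"
  ultimately have "nrm X x = 0" using nspace_eq_0[OF X] by blast
  then show ?thesis by (simp add: True dual_at_0[OF X f])
qed

lemma dual_norm_le: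
  assumes X: "normed_space X" and C: "0 \<le> C" and f: "\<And>x. x \<in> vecs X \<Longrightarrow> \<bar>f x\<bar> \<le> C * nrm X x"
  shows "nrm (dual X) f \<le> C"
proof -
  have "\<bar>f x\<bar> \<le> C" if "x \<in> vecs X" "nrm X x \<le> 1" for x
    using f[OF that(1)] mult_left_mono[OF that(2) C] by simp
  moreover have "0 \<in> vecs X" "nrm X 0 \<le> 1"
    using subspace_0[OF nspace_subspace[OF X]] nspace_eq_0[OF X, of 0] by auto
  ultimately show ?thesis
    unfolding dual_def nspace.simps by (intro cSup_least) auto
qed

lemma dual_normI:
  assumes X: "normed_space X" and C: "0 \<le> C" and f: "\<And>x. x \<in> vecs X \<Longrightarrow> \<bar>f x\<bar> \<le> C * nrm X x"
    and "\<And>x y. x \<in> vecs X \<Longrightarrow> y \<in> vecs X \<Longrightarrow> f (x + y) = f x + f y"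
    and "\<And>c x. x \<in> vecs X \<Longrightarrow> f (c *\<^sub>R x) = c * f x" and "\<And>x. x \<notin> vecs X \<Longrightarrow> f x = 0"
  shows "f \<in> vecs (dual X)" "nrm (dual X) f \<le> C"
  using assms dual_norm_le[OF X C f] unfolding dual_iff by blast+

lemma canonical_emb_in_bidual:
  assumes X: "normed_space X" and x: "x \<in> vecs X"
  shows "canonical_emb X x \<in> vecs (bidual X)"
proof (rule dual_normI(1)[OF normed_space_dual[OF X] nspace_nonneg[OF X x]])
  have D: "subspace (vecs (dual X))" by (rule nspace_subspace[OF normed_space_dual[OF X]])
  show "\<bar>canonical_emb X x f\<bar> \<le> nrm X x * nrm (dual X) f" if "f \<in> vecs (dual X)" for f
    using dual_abs_le[OF X that x] that by (simp add: canonical_emb_def mult.commute)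
  show "canonical_emb X x (f + g) = canonical_emb X x f + canonical_emb X x g"
    if "f \<in> vecs (dual X)" "g \<in> vecs (dual X)" for f g
    using that subspace_add[OF D] by (simp add: canonical_emb_def)
  show "canonical_emb X x (c *\<^sub>R f) = c * canonical_emb X x f" if "f \<in> vecs (dual X)" for c f
    using that subspace_scale[OF D] by (simp add: canonical_emb_def)
qed (simp add: canonical_emb_def)

section \<open>Completeness, basis and dual of the space\<close>

abbreviation dvecs :: "((nat \<Rightarrow> real) \<Rightarrow> real) set" where "dvecs \<equiv> vecs (dual jspace)"

abbreviation dnorm :: "((nat \<Rightarrow> real) \<Rightarrow> real) \<Rightarrow> real" where "dnorm \<equiv> nrm (dual jspace)"

abbreviation bvecs :: "(((nat \<Rightarrow> real) \<Rightarrow> real) \<Rightarrow> real) set" where "bvecs \<equiv> vecs (bidual jspace)"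

abbreviation bnorm :: "(((nat \<Rightarrow> real) \<Rightarrow> real) \<Rightarrow> real) \<Rightarrow> real" where "bnorm \<equiv> nrm (bidual jspace)"

lemmas normed_J = normed_space_jspace
lemmas normed_DJ = normed_space_dual[OF normed_space_jspace]
lemmas normed_BJ = normed_space_dual[OF normed_DJ]

text \<open>The limit is formed coordinatewise. A fixed variation depends on finitely many
  coordinates, so it inherits the Cauchy bound, uniformly over all divisions.\<close>

lemma jspace_complete_seq:
  assumes \<sigma>: "\<And>n. \<sigma> n \<in> jvecs"
    and cauchy: "\<And>e. 0 < e \<Longrightarrow> \<exists>N. \<forall>m\<ge>N. \<forall>n\<ge>N. jnorm (\<sigma> m - \<sigma> n) < e"
  obtains x where "x \<in> jvecs" "(\<lambda>n. jnorm (\<sigma> n - x)) \<longlonglongrightarrow> 0"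
proof -
  have sub: "\<sigma> m - \<sigma> n \<in> jvecs" for m n by (intro subspace_diff jvecs_subspace \<sigma>)
  have "Cauchy (\<lambda>n. \<sigma> n i)" for i
  proof (rule CauchyI)
    fix e :: real assume "0 < e"
    then obtain N where N: "\<And>m n. m \<ge> N \<Longrightarrow> n \<ge> N \<Longrightarrow> jnorm (\<sigma> m - \<sigma> n) < e" using cauchy by blast
    then have "norm (\<sigma> m i - \<sigma> n i) < e" if "m \<ge> N" "n \<ge> N" for m n
      using coord_le_jnorm[OF sub, of m n i] N[OF that] by simp
    then show "\<exists>M. \<forall>m\<ge>M. \<forall>n\<ge>M. norm (\<sigma> m i - \<sigma> n i) < e" by blast
  qed
  then have "\<exists>l. (\<lambda>n. \<sigma> n i) \<longlonglongrightarrow> l" for i using Cauchy_convergent convergent_def by blast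
  then obtain x where x: "\<And>i. (\<lambda>n. \<sigma> n i) \<longlonglongrightarrow> x i" by metis
  have close: "\<exists>N. \<forall>m\<ge>N. \<sigma> m - x \<in> jvecs \<and> jnorm (\<sigma> m - x) \<le> e" if e: "0 < e" for e
  proof -
    obtain N where N: "\<And>m n. m \<ge> N \<Longrightarrow> n \<ge> N \<Longrightarrow> jnorm (\<sigma> m - \<sigma> n) < e" using cauchy e by blast
    have "variation p k K (\<sigma> m - x) \<le> e" if m: "m \<ge> N" and p: "mono p" for m p k K
    proof (rule LIMSEQ_le_const)
      have "(\<lambda>n. e + (\<Sum>i<p k. \<bar>\<sigma> n i - x i\<bar>)) \<longlonglongrightarrow> e + (\<Sum>i<p k. \<bar>x i - x i\<bar>)"
        by (intro tendsto_intros x)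
      then show "(\<lambda>n. e + (\<Sum>i<p k. \<bar>\<sigma> n i - x i\<bar>)) \<longlonglongrightarrow> e" by simp
      have "variation p k K (\<sigma> m - x) \<le> e + (\<Sum>i<p k. \<bar>\<sigma> n i - x i\<bar>)" if n: "n \<ge> N" for n
      proof -
        have "variation p k K ((\<sigma> m - \<sigma> n) + (\<sigma> n - x)) \<le>
            variation p k K (\<sigma> m - \<sigma> n) + variation p k K (\<sigma> n - x)"
          by (rule seminorm_add[OF seminorm_variation])
        moreover have "variation p k K (\<sigma> m - \<sigma> n) \<le> e"
          using variation_le_jnorm[OF sub p, of k K m n] N[OF m n] by linarith
        moreover have "variation p k K (\<sigma> n - x) \<le> (\<Sum>i<p k. \<bar>\<sigma> n i - x i\<bar>)"
          using variation_le_sum[OF p, of k K "\<sigma> n - x"] by simp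
        ultimately show ?thesis by simp
      qed
      then show "\<exists>N. \<forall>n\<ge>N. variation p k K (\<sigma> m - x) \<le> e + (\<Sum>i<p k. \<bar>\<sigma> n i - x i\<bar>)" by blast
    qed
    then show ?thesis using jnorm_leI by blast
  qed
  obtain N where "\<sigma> N - x \<in> jvecs" using close[of 1] by force
  then have xJ: "x \<in> jvecs" using subspace_diff[OF jvecs_subspace \<sigma>[of N]] by force
  moreover have "(\<lambda>n. jnorm (\<sigma> n - x)) \<longlonglongrightarrow> 0"
  proof (rule LIMSEQ_I)
    fix e :: real assume "0 < e"
    then obtain N where N: "\<forall>m\<ge>N. \<sigma> m - x \<in> jvecs \<and> jnorm (\<sigma> m - x) \<le> e / 2"
      using close[of "e / 2"] by auto
    then have "norm (jnorm (\<sigma> m - x) - 0) < e" if "m \<ge> N" for m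
      using that \<open>0 < e\<close> jnorm_nonneg[of "\<sigma> m - x"] by force
    then show "\<exists>no. \<forall>n\<ge>no. norm (jnorm (\<sigma> n - x) - 0) < e" by blast
  qed
  ultimately show thesis by (rule that)
qed

lemma banach_space_jspace: "banach_space jspace"
proof -
  interpret Metric_space jvecs "ndist jspace" by (rule Metric_space_ndist[OF normed_J])
  have "\<exists>x. limitin mtopology \<sigma> x sequentially" if s: "MCauchy \<sigma>" for \<sigma>
  proof -
    have \<sigma>: "\<sigma> n \<in> jvecs" for n using s by (auto simp: MCauchy_def)
    obtain x where "x \<in> jvecs" "(\<lambda>n. jnorm (\<sigma> n - x)) \<longlonglongrightarrow> 0"
    proof (rule jspace_complete_seq[OF \<sigma>])
      fix e :: real assume "0 < e"
      then show "\<exists>N. \<forall>m\<ge>N. \<forall>n\<ge>N. jnorm (\<sigma> m - \<sigma> n) < e"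
        using s unfolding MCauchy_def by (simp add: ndist_def \<sigma>)
    qed
    then show ?thesis using limitin_ntop[OF normed_J, of \<sigma> x] \<sigma> unfolding ntop_def by blast
  qed
  then show ?thesis unfolding banach_space_def mcomplete_def using normed_J by blast
qed

lemma sum_unit_vec: "(\<Sum>k<n. a k *\<^sub>R unit_vec k) = head n a"
proof
  fix i
  have "(\<Sum>k<n. a k *\<^sub>R unit_vec k) i = (\<Sum>k<n. if i = k then a k else 0)"
    unfolding sum_fun_apply by (rule sum.cong) (auto simp: unit_vec_def)
  then show "(\<Sum>k<n. a k *\<^sub>R unit_vec k) i = head n a i" by (simp add: head_def)
qed

lemma unit_vec_in_jvecs: "unit_vec i \<in> jvecs"
proof -
  have "unit_vec i = head (Suc i) (unit_vec i)" by (auto simp: head_def unit_vec_def fun_eq_iff)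
  then show ?thesis using head_in_jvecs by metis
qed

lemma jnorm_head_diff: "x \<in> jvecs \<Longrightarrow> jnorm (head n x - x) = jnorm (tail n x)"
proof -
  assume x: "x \<in> jvecs"
  have "head n x - x = - tail n x" using head_plus_tail[of n x] by (simp add: algebra_simps)
  then show ?thesis using nspace_minus[OF normed_J tail_in_jvecs[OF x]] by simp
qed

lemma head_tendsto: "x \<in> jvecs \<Longrightarrow> (\<lambda>n. jnorm (head n x - x)) \<longlonglongrightarrow> 0"
  using tail_tendsto_0 by (simp add: jnorm_head_diff)

lemma schauder_basis_unit_vec: "schauder_basis jspace unit_vec"
proof -
  have "\<exists>!a. limitin (ntop jspace) (\<lambda>n. \<Sum>k<n. a k *\<^sub>R unit_vec k) x sequentially"
    if x: "x \<in> jvecs" for x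
  proof (rule ex1I[of _ x])
    show "limitin (ntop jspace) (\<lambda>n. \<Sum>k<n. x k *\<^sub>R unit_vec k) x sequentially"
      using limitin_ntop[OF normed_J head_in_jvecs x] head_tendsto[OF x] by (simp add: sum_unit_vec)
    fix a assume "limitin (ntop jspace) (\<lambda>n. \<Sum>k<n. a k *\<^sub>R unit_vec k) x sequentially"
    then have lim: "(\<lambda>n. jnorm (head n a - x)) \<longlonglongrightarrow> 0"
      using limitin_ntop[OF normed_J head_in_jvecs x] by (simp add: sum_unit_vec)
    show "a = x"
    proof
      fix i
      have "\<bar>a i - x i\<bar> \<le> jnorm (head n a - x)" if "Suc i \<le> n" for n
        using coord_le_jnorm[OF subspace_diff[OF jvecs_subspace head_in_jvecs x], of n a i] that
        by (simp add: head_def)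
      then have "\<bar>a i - x i\<bar> \<le> 0" by (intro LIMSEQ_le_const[OF lim]) blast
      then show "a i = x i" by simp
    qed
  qed
  then show ?thesis by (auto simp: schauder_basis_def unit_vec_in_jvecs)
qed

lemma separable_jspace: "separable_space (ntop jspace)"
proof -
  interpret Metric_space jvecs "ndist jspace" by (rule Metric_space_ndist[OF normed_J])
  define u where "u l = (\<lambda>i. if i < length l then real_of_rat (l ! i) else 0)" for l :: "rat list"
  have uJ: "u l \<in> jvecs" for l
  proof -
    have "u l = head (length l) (u l)" by (auto simp: u_def head_def)
    then show ?thesis using head_in_jvecs by metis
  qed
  have "\<exists>y\<in>range u. y \<in> mball x r" if x: "x \<in> jvecs" and r: "0 < r" for x r
  proof -
    obtain n where n: "jnorm (tail n x) < r / 2"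
      using order_tendstoD(2)[OF tail_tendsto_0[OF x], of "r / 2"] r
      by (auto simp: eventually_sequentially)
    define d where "d = r / (2 * (real n + 1))"
    have d: "0 < d" using r by (simp add: d_def)
    have "\<exists>q. \<bar>x i - real_of_rat q\<bar> < d" for i
    proof -
      obtain r where "r \<in> \<rat>" "x i - d < r" "r < x i" using Rats_dense_in_real[of "x i - d" "x i"] d by auto
      moreover from this obtain q where "r = real_of_rat q" using Rats_cases by metis
      ultimately show ?thesis by (intro exI[of _ q]) auto
    qed
    then obtain q where q: "\<And>i. \<bar>x i - real_of_rat (q i)\<bar> < d" by metis
    define l where "l = map q [0..<n]"
    have "x - u l = head n (x - (\<lambda>i. real_of_rat (q i))) + tail n x"
      by (auto simp: u_def l_def head_def tail_def fun_eq_iff)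
    then have "jnorm (x - u l) \<le> jnorm (head n (x - (\<lambda>i. real_of_rat (q i)))) + jnorm (tail n x)"
      using jnorm_add[OF head_in_jvecs tail_in_jvecs[OF x]] by metis
    also have "jnorm (head n (x - (\<lambda>i. real_of_rat (q i)))) \<le> (\<Sum>i<n. d)"
      by (rule order_trans[OF jnorm_head_le_sum sum_mono]) (use less_imp_le[OF q] in auto)
    also have "(\<Sum>i<n. d) \<le> r / 2" using r by (simp add: d_def field_simps)
    finally have "jnorm (x - u l) < r" using n by linarith
    then show ?thesis using x uJ by (auto simp: mball_def ndist_def)
  qed
  then have "mtopology closure_of range u = jvecs"
    using uJ by (auto simp: metric_closure_of)
  then show ?thesis
    unfolding separable_space_def ntop_def using uJ
    by (intro exI[of _ "range u"]) (auto simp: countable_image)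
qed

section \<open>Functionals given by their coefficients\<close>

definition coef_bound :: "real \<Rightarrow> (nat \<Rightarrow> real) \<Rightarrow> bool" where
  "coef_bound C b \<longleftrightarrow> 0 \<le> C \<and> (\<forall>n. \<forall>x\<in>jvecs. \<bar>\<Sum>i<n. b i * x i\<bar> \<le> C * jnorm x)"

definition seqfun :: "(nat \<Rightarrow> real) \<Rightarrow> (nat \<Rightarrow> real) \<Rightarrow> real" where
  "seqfun b x = (if x \<in> jvecs then lim (\<lambda>n. \<Sum>i<n. b i * x i) else 0)"

text \<open>The difference of the partial sums up to \<open>n\<close> and up to \<open>m\<close> is
  a partial sum at \<open>tail m x\<close>, whose norm tends to zero; the uniform bound then makes
  the partial sums Cauchy.\<close>

lemma seqfun_lim:
  assumes b: "coef_bound C b" and x: "x \<in> jvecs"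
  shows "(\<lambda>n. \<Sum>i<n. b i * x i) \<longlonglongrightarrow> seqfun b x"
proof -
  have C: "0 \<le> C" using b by (simp add: coef_bound_def)
  have le: "\<bar>(\<Sum>i<n. b i * x i) - (\<Sum>i<m. b i * x i)\<bar> \<le> C * jnorm (tail m x)" if "m \<le> n" for m n
  proof -
    have "(\<Sum>i<n. b i * x i) - (\<Sum>i<m. b i * x i) = (\<Sum>i\<in>{..<n} - {..<m}. b i * x i)"
      using that by (subst sum_diff) auto
    also have "\<dots> = (\<Sum>i<n. b i * tail m x i)"
      by (rule sum.mono_neutral_cong_left) (auto simp: tail_def)
    finally show ?thesis using b tail_in_jvecs[OF x, of m] by (simp add: coef_bound_def)
  qed
  have "Cauchy (\<lambda>n. \<Sum>i<n. b i * x i)"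
  proof (rule CauchyI')
    fix e :: real assume e: "0 < e"
    have "(\<lambda>n. C * jnorm (tail n x)) \<longlonglongrightarrow> C * 0" by (intro tendsto_intros tail_tendsto_0 x)
    then obtain M where M: "\<And>m. m \<ge> M \<Longrightarrow> C * jnorm (tail m x) < e"
      using order_tendstoD(2)[of _ "C * 0" sequentially e] e by (auto simp: eventually_sequentially)
    then show "\<exists>M. \<forall>m\<ge>M. \<forall>n>m. dist (\<Sum>i<m. b i * x i) (\<Sum>i<n. b i * x i) < e"
    proof (intro exI[of _ M] allI impI)
      fix m n assume "M \<le> m" "m < n"
      then show "dist (\<Sum>i<m. b i * x i) (\<Sum>i<n. b i * x i) < e"
        using le[of m n] M[of m] by (simp add: dist_real_def abs_minus_commute)
    qed
  qed
  then show ?thesis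
    using x by (simp add: seqfun_def real_Cauchy_convergent convergent_LIMSEQ_iff[symmetric])
qed

lemma seqfun_bound:
  assumes b: "coef_bound C b" and x: "x \<in> jvecs"
  shows "\<bar>seqfun b x\<bar> \<le> C * jnorm x"
  using tendsto_rabs[OF seqfun_lim[OF b x]] b x
  by (intro LIMSEQ_le_const2[of "\<lambda>n. \<bar>\<Sum>i<n. b i * x i\<bar>"]) (auto simp: coef_bound_def)

lemma seqfun_dual:
  assumes b: "coef_bound C b"
  shows "seqfun b \<in> dvecs" "dnorm (seqfun b) \<le> C"
proof -
  have add: "seqfun b (x + y) = seqfun b x + seqfun b y" if "x \<in> jvecs" "y \<in> jvecs" for x y
    using tendsto_add[OF seqfun_lim[OF b that(1)] seqfun_lim[OF b that(2)]]
      seqfun_lim[OF b jvecs_add[OF that]]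
    by (simp add: algebra_simps sum.distrib LIMSEQ_unique)
  have scale: "seqfun b (c *\<^sub>R x) = c * seqfun b x" if "x \<in> jvecs" for c x
    using tendsto_mult[OF tendsto_const[of c] seqfun_lim[OF b that]] seqfun_lim[OF b jvecs_scale[OF that, of c]]
    by (simp add: sum_distrib_left mult.left_commute LIMSEQ_unique)
  have outside: "seqfun b x = 0" if "x \<notin> jvecs" for x using that by (simp add: seqfun_def)
  have C: "0 \<le> C" using b by (simp add: coef_bound_def)
  show "seqfun b \<in> dvecs" "dnorm (seqfun b) \<le> C"
    by (rule dual_normI[OF normed_J C]; simp add: seqfun_bound[OF b] add scale outside)+
qed

lemma seqfun_finite:
  assumes x: "\<And>i. n \<le> i \<Longrightarrow> x i = 0"
  shows "seqfun b x = (\<Sum>i<n. b i * x i)"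
proof -
  have "x = head n x" using x by (auto simp: head_def fun_eq_iff)
  then have "x \<in> jvecs" using head_in_jvecs by metis
  moreover have "(\<Sum>i<m. b i * x i) = (\<Sum>i<n. b i * x i)" if "n \<le> m" for m
    using that x by (intro sum.mono_neutral_right) auto
  then have "(\<lambda>m. \<Sum>i<m. b i * x i) \<longlonglongrightarrow> (\<Sum>i<n. b i * x i)"
    by (intro tendsto_eventually eventually_sequentiallyI[of n])
  ultimately show ?thesis by (simp add: seqfun_def limI)
qed

lemma seqfun_unit: "seqfun b (unit_vec i) = b i"
  by (subst seqfun_finite[of "Suc i"]) (auto simp: unit_vec_def)

lemma dual_head:
  assumes f: "f \<in> dvecs"
  shows "f (head n x) = (\<Sum>i<n. f (unit_vec i) * x i)"
proof -
  have "f (head n x) = (\<Sum>i<n. f (x i *\<^sub>R unit_vec i))"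
    unfolding sum_unit_vec[symmetric] by (intro dual_sum[OF normed_J f] jvecs_scale unit_vec_in_jvecs)
  then show ?thesis by (simp add: dual_scale[OF f unit_vec_in_jvecs] mult.commute)
qed

lemma dual_head_lim:
  assumes f: "f \<in> dvecs" and x: "x \<in> jvecs"
  shows "(\<lambda>n. f (head n x)) \<longlonglongrightarrow> f x"
proof (rule LIM_zero_cancel, rule Lim_null_comparison)
  have "\<bar>f (head n x) - f x\<bar> \<le> dnorm f * jnorm (head n x - x)" for n
    using dual_abs_le[OF normed_J f subspace_diff[OF jvecs_subspace head_in_jvecs x], of n x]
    by (simp add: dual_diff[OF normed_J f head_in_jvecs x])
  then show "\<forall>\<^sub>F n in sequentially. norm (f (head n x) - f x) \<le> dnorm f * jnorm (head n x - x)"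
    by simp
  show "(\<lambda>n. dnorm f * jnorm (head n x - x)) \<longlonglongrightarrow> 0"
    using tendsto_mult[OF tendsto_const head_tendsto[OF x], of "dnorm f"] by simp
qed

lemma dual_ext:
  assumes f: "f \<in> dvecs" and g: "g \<in> dvecs"
    and eq: "\<And>i. f (unit_vec i) = g (unit_vec i)"
  shows "f = g"
proof
  fix x
  show "f x = g x"
  proof (cases "x \<in> jvecs")
    case True
    have "f (head n x) = g (head n x)" for n by (simp add: dual_head[OF f] dual_head[OF g] eq)
    then show ?thesis using dual_head_lim[OF f True] dual_head_lim[OF g True] LIMSEQ_unique by simp
  qed (simp add: dual_outside[OF f] dual_outside[OF g])
qed

lemma dual_norm_nonneg: "f \<in> dvecs \<Longrightarrow> 0 \<le> dnorm f"
  by (rule nspace_nonneg[OF normed_DJ])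

text \<open>\<open>jnorm (head n x)\<close> is a seminorm on all sequences, so Hahn-Banach applies
  to it directly. A functional dominated by it vanishes on tails and is thus determined by its first
  \<open>n\<close> coefficients.\<close>

lemma norming_functional:
  obtains f where "f \<in> dvecs" "dnorm f \<le> 1"
    "f (head n x) = jnorm (head n x)" "\<And>i. n \<le> i \<Longrightarrow> f (unit_vec i) = 0"
proof -
  have "seminorm (\<lambda>x. jnorm (head n x))"
    by (rule seminormI) (simp_all add: linear_add[OF linear_head] linear_scale[OF linear_head]
        jnorm_add jnorm_scale head_in_jvecs)
  note sn = this
  obtain g where g: "linear g" "\<And>x. g x \<le> jnorm (head n x)" "g x = jnorm (head n x)"
    using hahn_banach_norming[OF seminorm_sublin[OF sn], of x] by blast
  note gle = linear_abs_le[OF sn g(1,2)]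
  define b where "b i = (if i < n then g (unit_vec i) else 0)" for i
  have gb: "(\<Sum>i<m. b i * y i) = g (head (min m n) y)" for m y
  proof -
    have "g (head (min m n) y) = (\<Sum>i<min m n. g (unit_vec i) * y i)"
      unfolding sum_unit_vec[symmetric] by (simp add: linear_sum[OF g(1)] linear_scale[OF g(1)] mult.commute)
    also have "\<dots> = (\<Sum>i<m. b i * y i)" by (rule sum.mono_neutral_cong_left) (auto simp: b_def)
    finally show ?thesis by simp
  qed
  have hh: "head n (head (min m n) y) = head (min m n) y" for m y by (auto simp: head_def fun_eq_iff)
  have "\<bar>\<Sum>i<m. b i * y i\<bar> \<le> 1 * jnorm y" if "y \<in> jvecs" for m y
    using gle[of "head (min m n) y"] jnorm_head[OF that, of "min m n"] by (simp add: gb hh)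
  then have b: "coef_bound 1 b" by (simp add: coef_bound_def)
  have "head n (tail n x) = 0" by (auto simp: head_def tail_def fun_eq_iff)
  then have "g (tail n x) = 0"
    using gle[of "tail n x"] jnorm_0 by simp
  then have "g (head n x) = g x"
    using linear_add[OF g(1), of "head n x" "tail n x"] by (simp add: head_plus_tail)
  moreover have "seqfun b (head n x) = (\<Sum>i<n. b i * head n x i)"
    by (rule seqfun_finite) (simp add: head_def)
  ultimately have "seqfun b (head n x) = jnorm (head n x)"
    using gb[of "head n x" n] hh[of n x] by (simp add: g(3))
  then show thesis using that[OF seqfun_dual[OF b]] by (simp add: seqfun_unit b_def)
qed

section \<open>Coordinate functionals and the splitting of the bidual\<close>

definition coord_fun :: "nat \<Rightarrow> (nat \<Rightarrow> real) \<Rightarrow> real" where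
  "coord_fun i = (\<lambda>x. if x \<in> jvecs then x i else 0)"

lemma coord_fun_dual: "coord_fun i \<in> dvecs"
  by (rule dual_normI(1)[OF normed_J, of 1]) (auto simp: coord_fun_def coord_le_jnorm jvecs_add jvecs_scale)

lemma coord_fun_unit: "coord_fun i (unit_vec j) = (if i = j then 1 else 0)"
  by (simp add: coord_fun_def unit_vec_in_jvecs) (simp add: unit_vec_def)

lemma dual_finite_eq:
  assumes f: "f \<in> dvecs" and 0: "\<And>i. n \<le> i \<Longrightarrow> f (unit_vec i) = 0"
  shows "f = (\<Sum>i<n. f (unit_vec i) *\<^sub>R coord_fun i)"
proof (rule dual_ext[OF f])
  show "(\<Sum>i<n. f (unit_vec i) *\<^sub>R coord_fun i) \<in> dvecs"
    by (intro subspace_sum subspace_scale nspace_subspace[OF normed_DJ] coord_fun_dual)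
  fix j
  have "(\<Sum>i<n. f (unit_vec i) *\<^sub>R coord_fun i) (unit_vec j) = (\<Sum>i<n. if j = i then f (unit_vec i) else 0)"
    unfolding sum_fun_apply by (rule sum.cong) (auto simp: coord_fun_unit)
  then show "f (unit_vec j) = (\<Sum>i<n. f (unit_vec i) *\<^sub>R coord_fun i) (unit_vec j)"
    using 0[of j] by simp
qed

lemma bidual_finite:
  assumes \<Phi>: "\<Phi> \<in> bvecs" and f: "f \<in> dvecs"
    and 0: "\<And>i. n \<le> i \<Longrightarrow> f (unit_vec i) = 0"
  shows "\<Phi> f = (\<Sum>i<n. f (unit_vec i) * \<Phi> (coord_fun i))"
proof -
  have "\<Phi> f = \<Phi> (\<Sum>i<n. f (unit_vec i) *\<^sub>R coord_fun i)" using dual_finite_eq[OF f 0] by simp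
  also have "\<dots> = (\<Sum>i<n. \<Phi> (f (unit_vec i) *\<^sub>R coord_fun i))"
    by (intro dual_sum[OF normed_DJ \<Phi>] subspace_scale[OF nspace_subspace[OF normed_DJ]] coord_fun_dual)
  finally show ?thesis by (simp add: dual_scale[OF \<Phi> coord_fun_dual])
qed

text \<open>A functional norming a head of the coordinate sequence has finitely many coefficients,
  so \<open>\<Phi>\<close> evaluates it as that sequence would. Hence all heads are bounded by
  \<open>bnorm \<Phi>\<close>, and bounded completeness applies.\<close>

lemma bidual_coords:
  assumes \<Phi>: "\<Phi> \<in> bvecs"
  shows "(\<lambda>i. \<Phi> (coord_fun i)) \<in> jvecs"
proof (rule jvecs_if_heads_bounded(1))
  fix n
  let ?x = "\<lambda>i. \<Phi> (coord_fun i)"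
  obtain f where f: "f \<in> dvecs" "dnorm f \<le> 1"
    "f (head n ?x) = jnorm (head n ?x)" "\<And>i. n \<le> i \<Longrightarrow> f (unit_vec i) = 0"
    using norming_functional by blast
  have "jnorm (head n ?x) = \<Phi> f"
    using bidual_finite[OF \<Phi> f(1,4)] dual_head[OF f(1), of n ?x] f(3) by simp
  also have "\<dots> \<le> bnorm \<Phi> * dnorm f"
    using dual_abs_le[OF normed_DJ \<Phi> f(1)] by simp
  also have "\<dots> \<le> bnorm \<Phi>"
    by (rule mult_left_le[OF f(2) nspace_nonneg[OF normed_BJ \<Phi>]])
  finally show "jnorm (head n ?x) \<le> bnorm \<Phi>" .
qed

definition coord_annihilator :: "(((nat \<Rightarrow> real) \<Rightarrow> real) \<Rightarrow> real) set" where
  "coord_annihilator = {\<Phi> \<in> bvecs. \<forall>i. \<Phi> (coord_fun i) = 0}"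

text \<open>The component of \<open>\<Phi>\<close> in the space is its own coordinate sequence; what
  remains annihilates every coordinate functional.\<close>

lemma closed_complement_jspace:
  "closed_complement (bidual jspace) (canonical_emb jspace ` jvecs) coord_annihilator"
proof -
  let ?Y = coord_annihilator and ?B = bvecs
  interpret Metric_space ?B "ndist (bidual jspace)" by (rule Metric_space_ndist[OF normed_BJ])
  have B: "subspace ?B" by (rule nspace_subspace[OF normed_BJ])
  have emb: "canonical_emb jspace x (coord_fun i) = x i" if "x \<in> jvecs" for x i
    using that by (simp add: canonical_emb_def coord_fun_dual) (simp add: coord_fun_def)
  have emb0: "canonical_emb jspace 0 = 0"
    by (auto simp: canonical_emb_def fun_eq_iff dual_at_0[OF normed_J])
  have "subspace ?Y"
    using B by (auto simp: subspace_def coord_annihilator_def)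
  moreover have "closedin (ntop (bidual jspace)) ?Y"
    unfolding ntop_def closedin_metric
  proof (intro conjI allI impI)
    show "?Y \<subseteq> ?B" by (auto simp: coord_annihilator_def)
    fix \<Phi> assume "\<Phi> \<in> ?B - ?Y"
    then obtain i where \<Phi>: "\<Phi> \<in> ?B" "\<Phi> (coord_fun i) \<noteq> 0" by (auto simp: coord_annihilator_def)
    define N where "N = dnorm (coord_fun i) + 1"
    have N: "0 < N" using dual_norm_nonneg[OF coord_fun_dual] by (simp add: N_def add_nonneg_pos)
    define r where "r = \<bar>\<Phi> (coord_fun i)\<bar> / N"
    have "False" if \<Psi>: "\<Psi> \<in> ?Y" "\<Psi> \<in> mball \<Phi> r" for \<Psi>
    proof -
      have \<Psi>B: "\<Psi> \<in> ?B" and d: "bnorm (\<Phi> - \<Psi>) < r"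
        using \<Psi> \<Phi> by (auto simp: coord_annihilator_def mball_def ndist_def)
      have D: "\<Phi> - \<Psi> \<in> ?B" by (intro subspace_diff B \<Phi> \<Psi>B)
      have "\<bar>\<Phi> (coord_fun i)\<bar> = \<bar>(\<Phi> - \<Psi>) (coord_fun i)\<bar>" using \<Psi> by (simp add: coord_annihilator_def)
      also have "\<dots> \<le> bnorm (\<Phi> - \<Psi>) * dnorm (coord_fun i)"
        by (rule dual_abs_le[OF normed_DJ D coord_fun_dual])
      also have "\<dots> \<le> bnorm (\<Phi> - \<Psi>) * N"
        by (rule mult_left_mono) (use nspace_nonneg[OF normed_BJ D] in \<open>auto simp: N_def\<close>)
      also have "\<dots> < r * N" using d N by simp
      finally show False using N by (simp add: r_def)
    qed
    moreover have "0 < r" using \<Phi> N by (simp add: r_def)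
    ultimately show "\<exists>r>0. disjnt ?Y (mball \<Phi> r)" by (auto simp: disjnt_iff)
  qed
  moreover have "canonical_emb jspace ` jvecs \<inter> ?Y = {0}"
  proof (intro equalityI subsetI)
    fix \<Phi> assume "\<Phi> \<in> canonical_emb jspace ` jvecs \<inter> ?Y"
    then obtain x where x: "x \<in> jvecs" "\<Phi> = canonical_emb jspace x" "\<And>i. \<Phi> (coord_fun i) = 0"
      by (auto simp: coord_annihilator_def)
    have "x = 0"
    proof
      fix i show "x i = 0 i" using emb[OF x(1), of i] x(2,3) by simp
    qed
    then show "\<Phi> \<in> {0}" using x(2) emb0 by simp
  next
    fix \<Phi> :: "((nat \<Rightarrow> real) \<Rightarrow> real) \<Rightarrow> real" assume "\<Phi> \<in> {0}"
    then show "\<Phi> \<in> canonical_emb jspace ` jvecs \<inter> ?Y"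
      using emb0 jvecs_0 subspace_0[OF \<open>subspace ?Y\<close>] by force
  qed
  moreover have "{u + y |u y. u \<in> canonical_emb jspace ` jvecs \<and> y \<in> ?Y} = ?B"
  proof (intro equalityI subsetI)
    fix \<Phi> assume "\<Phi> \<in> {u + y |u y. u \<in> canonical_emb jspace ` jvecs \<and> y \<in> ?Y}"
    then show "\<Phi> \<in> ?B"
      by (auto simp: coord_annihilator_def intro!: subspace_add[OF B] canonical_emb_in_bidual[OF normed_J])
  next
    fix \<Phi> assume \<Phi>: "\<Phi> \<in> ?B"
    define x where "x i = \<Phi> (coord_fun i)" for i
    have x: "x \<in> jvecs" unfolding x_def by (rule bidual_coords[OF \<Phi>])
    have "\<Phi> - canonical_emb jspace x \<in> ?Y"
      by (auto simp: coord_annihilator_def emb[OF x] x_def[symmetric]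
          intro: subspace_diff[OF B \<Phi> canonical_emb_in_bidual[OF normed_J x]])
    then show "\<Phi> \<in> {u + y |u y. u \<in> canonical_emb jspace ` jvecs \<and> y \<in> ?Y}"
      using x by (intro CollectI exI[of _ "canonical_emb jspace x"] exI[of _ "\<Phi> - canonical_emb jspace x"]) auto
  qed
  ultimately show ?thesis by (simp add: closed_complement_def)
qed

section \<open>Averages of successive vectors\<close>

lemma sum_power2_at_most_one:
  assumes "\<And>s s'. s < N \<Longrightarrow> s' < N \<Longrightarrow> P s \<Longrightarrow> P s' \<Longrightarrow> s = s'"
  shows "(\<Sum>s<N. if P s then a s else 0)\<^sup>2 \<le> (\<Sum>s<(N::nat). (a s :: real)\<^sup>2)"
proof (cases "\<exists>s<N. P s")
  case True
  then obtain s0 where s0: "s0 < N" "P s0" by blast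
  have "(\<Sum>s<N. if P s then a s else 0) = (\<Sum>s<N. if s = s0 then a s else 0)"
    using assms s0 by (intro sum.cong) auto
  also have "\<dots> = a s0" using s0 by simp
  finally show ?thesis using member_le_sum[of s0 "{..<N}" "\<lambda>s. (a s)\<^sup>2"] s0 by simp
qed (auto intro: sum_nonneg)

text \<open>For a fixed division, blocks lying inside a segment contribute at most
  \<open>\<omega>\<close> each. Every other contribution comes from a block cut by an end point of
  the segment. Each end point cuts at most one block, and these contributions add up in the
  \<open>\<ell>\<^sub>2\<close> sense to at most \<open>C * sqrt N\<close> per end. After division
  by \<open>N\<close>, only \<open>\<omega>\<close> survives for large \<open>N\<close>.\<close>

lemma jnorm_sum_le:
  fixes L :: "nat \<Rightarrow> nat"
  assumes L: "mono L"
    and supp: "\<And>s i. s < N \<Longrightarrow> i < L s \<or> L (Suc s) \<le> i \<Longrightarrow> y s i = 0"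
    and y: "\<And>s. s < N \<Longrightarrow> y s \<in> jvecs" "\<And>s. s < N \<Longrightarrow> jnorm (y s) \<le> C"
    and w: "\<And>s K. s < N \<Longrightarrow> wnorm K (lsum (y s) (L s) (L (Suc s))) \<le> \<omega>"
    and pos: "0 \<le> C" "0 \<le> \<omega>"
  shows "jnorm (\<Sum>s<N. y s) \<le> \<omega> * N + 2 * C * sqrt N"
proof (rule jnorm_leI)
  fix p :: "nat \<Rightarrow> nat" and k K assume p: "mono p"
  define v where "v t s = wnorm K (lsum (y s) (p t) (p (Suc t)))" for t s
  have v0: "0 \<le> v t s" for t s by (simp add: v_def wnorm_nonneg)
  \<comment> \<open>Empty blocks are excluded: such a block could lie in several segments, and
    \<open>full_unique\<close> would fail.\<close>
  define full where "full t s \<longleftrightarrow> L s < L (Suc s) \<and> p t \<le> L s \<and> L (Suc s) \<le> p (Suc t)" for t s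
  define inner where "inner a s \<longleftrightarrow> L s < a \<and> a < L (Suc s)" for a s
  have Lmono: "L (Suc s) \<le> L s'" if "s < s'" for s s' using monoD[OF L, of "Suc s" s'] that by simp
  have pmono: "p (Suc t) \<le> p t'" if "t < t'" for t t' using monoD[OF p, of "Suc t" t'] that by simp
  have inner_unique: "s = s'" if "inner a s" "inner a s'" for a s s'
    using that Lmono[of s s'] Lmono[of s' s] unfolding inner_def by (cases s s' rule: linorder_cases) auto
  have full_unique: "t = t'" if "full t s" "full t' s" for t t' s
    using that pmono[of t t'] pmono[of t' t] unfolding full_def by (cases t t' rule: linorder_cases) auto
  have split: "v t s \<le> (if full t s then \<omega> else 0) + (if inner (p t) s then v t s else 0)
      + (if inner (p (Suc t)) s then v t s else 0)" if s: "s < N" for t s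
  proof (cases "inner (p t) s \<or> inner (p (Suc t)) s")
    case True
    then show ?thesis using v0[of t s] pos by auto
  next
    case no: False
    show ?thesis
    proof (cases "full t s")
      case True
      have "lsum (y s) (p t) (p (Suc t)) =
          lsum (y s) (p t) (L s) + lsum (y s) (L s) (L (Suc s)) + lsum (y s) (L (Suc s)) (p (Suc t))"
        using True by (simp add: lsum_concat full_def)
      also have "\<dots> = lsum (y s) (L s) (L (Suc s))"
        using supp[OF s] by (simp add: lsum_eq_0)
      finally have "v t s \<le> \<omega>" unfolding v_def using w[OF s] by simp
      then show ?thesis using True v0[of t s] by auto
    next
      case False
      have "y s i = 0" if "p t \<le> i" "i < p (Suc t)" for i
        using no False that supp[OF s, of i] unfolding inner_def full_def by force
      then have "v t s = 0" unfolding v_def by (simp add: lsum_eq_0 seminorm_0[OF seminorm_wnorm])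
      then show ?thesis using pos by simp
    qed
  qed
  define A where "A t = (\<Sum>s<N. if full t s then \<omega> else 0)" for t
  define B where "B t = (\<Sum>s<N. if inner (p t) s then v t s else 0)" for t
  define B' where "B' t = (\<Sum>s<N. if inner (p (Suc t)) s then v t s else 0)" for t
  have vsum: "(\<Sum>t<k. \<Sum>s<N. (v t s)\<^sup>2) \<le> N * C\<^sup>2"
  proof -
    have "(\<Sum>t<k. (v t s)\<^sup>2) \<le> C\<^sup>2" if s: "s < N" for s
    proof -
      have "(\<Sum>t<k. (v t s)\<^sup>2) = (variation p k K (y s))\<^sup>2"
        by (simp add: variation_def L2_set_power2 v_def)
      also have "\<dots> \<le> C\<^sup>2"
        using variation_le_jnorm[OF y(1)[OF s] p, of k K] y(2)[OF s]
        by (intro power_mono seminorm_nonneg[OF seminorm_variation]) auto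
      finally show ?thesis .
    qed
    then have "(\<Sum>s<N. \<Sum>t<k. (v t s)\<^sup>2) \<le> (\<Sum>s<N. C\<^sup>2)" by (intro sum_mono) auto
    then show ?thesis by (subst sum.swap) simp
  qed
  \<comment> \<open>Stated for arbitrary \<open>q\<close>, since it is applied to the left end
    points \<open>p t\<close> and to the right end points \<open>p (Suc t)\<close>.\<close>
  have bb: "L2_set (\<lambda>t. \<Sum>s<N. if inner (q t) s then v t s else 0) {..<k} \<le> C * sqrt N" for q
  proof -
    have "(L2_set (\<lambda>t. \<Sum>s<N. if inner (q t) s then v t s else 0) {..<k})\<^sup>2 \<le> (\<Sum>t<k. \<Sum>s<N. (v t s)\<^sup>2)"
      unfolding L2_set_power2 by (intro sum_mono sum_power2_at_most_one) (rule inner_unique)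
    also have "\<dots> \<le> (C * sqrt N)\<^sup>2" using vsum by (simp add: power_mult_distrib mult.commute)
    finally show ?thesis by (rule power2_le_imp_le) (use pos in simp)
  qed
  \<comment> \<open>Bounding by the plain sum loses nothing that matters here, because each block is
    full in at most one segment.\<close>
  have "L2_set A {..<k} \<le> (\<Sum>t<k. A t)"
    by (rule L2_set_le_sum) (auto simp: A_def pos intro: sum_nonneg)
  also have "\<dots> = (\<Sum>s<N. \<Sum>t<k. if full t s then \<omega> else 0)" unfolding A_def by (rule sum.swap)
  also have "\<dots> \<le> (\<Sum>s<N. \<omega>)"
  proof (rule sum_mono)
    fix s
    show "(\<Sum>t<k. if full t s then \<omega> else 0) \<le> \<omega>"
    proof (cases "\<exists>t<k. full t s")
      case True
      then obtain t0 where t0: "t0 < k" "full t0 s" by blast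
      have "(\<Sum>t<k. if full t s then \<omega> else 0) = (\<Sum>t<k. if t = t0 then \<omega> else 0)"
        using full_unique t0 by (intro sum.cong) auto
      then show ?thesis using t0 by simp
    qed (use pos in simp)
  qed
  finally have AA: "L2_set A {..<k} \<le> \<omega> * N" by (simp add: mult.commute)
  have "variation p k K (\<Sum>s<N. y s) \<le> L2_set (\<lambda>t. A t + B t + B' t) {..<k}"
    unfolding variation_def
  proof (rule L2_set_mono)
    fix t
    have "wnorm K (lsum (\<Sum>s<N. y s) (p t) (p (Suc t))) \<le> (\<Sum>s<N. v t s)"
      unfolding v_def by (rule seminorm_sum[OF seminorm_wnorm_lsum])
    also have "\<dots> \<le> A t + B t + B' t"
      unfolding A_def B_def B'_def sum.distrib[symmetric] by (rule sum_mono) (use split in auto)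
    finally show "wnorm K (lsum (\<Sum>s<N. y s) (p t) (p (Suc t))) \<le> A t + B t + B' t" .
  qed (rule wnorm_nonneg)
  also have "\<dots> \<le> L2_set (\<lambda>t. A t + B t) {..<k} + L2_set B' {..<k}" by (rule L2_set_triangle_ineq)
  also have "L2_set (\<lambda>t. A t + B t) {..<k} \<le> L2_set A {..<k} + L2_set B {..<k}" by (rule L2_set_triangle_ineq)
  finally show "variation p k K (\<Sum>s<N. y s) \<le> \<omega> * N + 2 * C * sqrt N"
    using AA bb[of p, folded B_def] bb[of "\<lambda>t. p (Suc t)", folded B'_def] by simp
qed

section \<open>Functionals depending on labels only\<close>

lemma power4_le_imp_le: "a ^ 4 \<le> b ^ 4 \<Longrightarrow> 0 \<le> b \<Longrightarrow> a \<le> (b::real)"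
  using power_le_imp_le_base[of a 3 b] by (simp add: numeral_eq_Suc)

lemma gnorm_head: "gnorm n (head (off m) w) = (if n < m then gnorm n w else 0)"
proof (cases "n < m")
  case True
  then show ?thesis using off_mono[of "Suc n" m] by (auto intro!: gnorm_cong simp: head_def)
next
  case False
  then show ?thesis using off_mono[of m n] by (auto intro!: gnorm_eq_0 simp: head_def)
qed

lemma gnorm_tail: "gnorm n (tail (off m) w) = (if m \<le> n then gnorm n w else 0)"
proof (cases "m \<le> n")
  case True
  then show ?thesis using off_mono[of m n] by (auto intro!: gnorm_cong simp: tail_def)
next
  case False
  then show ?thesis using off_mono[of "Suc n" m] by (auto intro!: gnorm_eq_0 simp: tail_def)
qed

lemma wnorm_head_power4: "wnorm K (head (off m) w) ^ 4 = wnorm (min K m) w ^ 4"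
  unfolding wnorm_power4 gnorm_head by (rule sum.mono_neutral_cong_right) auto

lemma wnorm_head: "wnorm K (head (off m) w) = wnorm (min K m) w"
  by (rule antisym; rule power4_le_imp_le[OF _ wnorm_nonneg]) (simp_all add: wnorm_head_power4)

lemma wnorm_tail_split: "m \<le> K \<Longrightarrow> wnorm K w ^ 4 = wnorm m w ^ 4 + wnorm K (tail (off m) w) ^ 4"
proof -
  assume mK: "m \<le> K"
  have "(\<Sum>n<K. gnorm n (tail (off m) w) ^ 4) = (\<Sum>n=m..<K. gnorm n w ^ 4)"
    unfolding gnorm_tail by (rule sum.mono_neutral_cong_right) auto
  then show ?thesis
    unfolding wnorm_power4 using mK by (simp add: lessThan_atLeast0 sum.atLeastLessThan_concat)
qed

lemma wnorm_tail_le: "wnorm K (tail (off m) w) \<le> wnorm K w"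
proof (rule power4_le_imp_le[OF _ wnorm_nonneg])
  show "wnorm K (tail (off m) w) ^ 4 \<le> wnorm K w ^ 4"
    unfolding wnorm_power4 by (rule sum_mono) (simp add: gnorm_tail gnorm_nonneg)
qed

text \<open>\<open>\<beta>\<close> is a functional of norm at most \<open>C\<close> on the
  \<open>\<ell>\<^sub>4\<close>-sum of the groups, tested on its truncations.\<close>

definition wdual :: "real \<Rightarrow> (nat \<Rightarrow> real) \<Rightarrow> bool" where
  "wdual C \<beta> \<longleftrightarrow> 0 \<le> C \<and> (\<forall>K w. \<bar>\<Sum>c<off K. \<beta> c * w c\<bar> \<le> C * wnorm K w)"

text \<open>The cut at \<open>N\<close> allows a label functional to be added to another functional
  without changing its first \<open>N\<close> coefficients.\<close>

definition labtail :: "nat \<Rightarrow> (nat \<Rightarrow> real) \<Rightarrow> nat \<Rightarrow> real" where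
  "labtail N \<beta> i = (if N \<le> i then \<beta> (lab i) else 0)"

text \<open>Grouping the partial sum by labels turns it into the pairing of \<open>\<beta>\<close>
  with the label image \<open>lsum x N n\<close> of one segment, whose norm is at most
  \<open>jnorm x\<close>.\<close>

lemma wdual_coef_bound:
  assumes \<beta>: "wdual C \<beta>"
  shows "coef_bound C (labtail N \<beta>)"
proof -
  have "\<bar>\<Sum>i<n. labtail N \<beta> i * x i\<bar> \<le> C * jnorm x" if x: "x \<in> jvecs" for n x
  proof -
    have "(\<Sum>i<n. labtail N \<beta> i * x i) = (\<Sum>i=N..<n. \<beta> (lab i) * x i)"
      by (rule sum.mono_neutral_cong_right) (auto simp: labtail_def)
    also have "\<dots> = (\<Sum>c<off n. \<Sum>i | i \<in> {N..<n} \<and> lab i = c. \<beta> (lab i) * x i)"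
    proof (rule sum.group[symmetric])
      show "lab ` {N..<n} \<subseteq> {..<off n}"
        using le_less_trans[OF lab_le] less_le_trans[OF _ off_ge] by fastforce
    qed auto
    also have "\<dots> = (\<Sum>c<off n. \<beta> c * lsum x N n c)"
      unfolding lsum_def sum_distrib_left by (intro sum.cong) auto
    also have "\<bar>\<dots>\<bar> \<le> C * wnorm n (lsum x N n)" using \<beta> by (simp add: wdual_def)
    also have "\<dots> \<le> C * jnorm x" using \<beta> by (intro mult_left_mono wnorm_le_jnorm x) (simp add: wdual_def)
    finally show ?thesis .
  qed
  then show ?thesis using \<beta> by (simp add: coef_bound_def wdual_def)
qed

definition labfun :: "(nat \<Rightarrow> real) \<Rightarrow> (nat \<Rightarrow> real) \<Rightarrow> real" where
  "labfun \<beta> = seqfun (labtail 0 \<beta>)"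

lemma labfun_dual:
  assumes "wdual C \<beta>"
  shows "labfun \<beta> \<in> dvecs" "dnorm (labfun \<beta>) \<le> C"
  unfolding labfun_def using seqfun_dual[OF wdual_coef_bound[OF assms]] by auto

lemma labfun_unit: "labfun \<beta> (unit_vec i) = \<beta> (lab i)"
  by (simp add: labfun_def seqfun_unit labtail_def)

lemma sum_head_off: "(\<Sum>c<off K. head (off m) \<beta> c * w c) = (\<Sum>c<off (min K m). \<beta> c * w c)"
proof (rule sum.mono_neutral_cong_right)
  show "{..<off (min K m)} \<subseteq> {..<off K}" using off_mono[of "min K m" K] by auto
  show "\<forall>i\<in>{..<off K} - {..<off (min K m)}. head (off m) \<beta> i * w i = 0"
    by (auto simp: head_def min_def split: if_splits)
  show "\<And>c. c \<in> {..<off (min K m)} \<Longrightarrow> head (off m) \<beta> c * w c = \<beta> c * w c"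
    using off_mono[of "min K m" m] by (auto simp: head_def)
qed simp

lemma wdual_head: "wdual C \<beta> \<Longrightarrow> wdual C (head (off m) \<beta>)"
  unfolding wdual_def
proof (intro conjI allI)
  fix K w assume \<beta>: "0 \<le> C \<and> (\<forall>K w. \<bar>\<Sum>c<off K. \<beta> c * w c\<bar> \<le> C * wnorm K w)"
  then have "\<bar>\<Sum>c<off K. head (off m) \<beta> c * w c\<bar> \<le> C * wnorm (min K m) w" by (simp add: sum_head_off)
  also have "\<dots> \<le> C * wnorm K w" using \<beta> by (intro mult_left_mono wnorm_mono) auto
  finally show "\<bar>\<Sum>c<off K. head (off m) \<beta> c * w c\<bar> \<le> C * wnorm K w" .
qed auto

lemma wdual_tail: "wdual C \<beta> \<Longrightarrow> wdual C (tail (off m) \<beta>)"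
  unfolding wdual_def
proof (intro conjI allI)
  fix K w assume \<beta>: "0 \<le> C \<and> (\<forall>K w. \<bar>\<Sum>c<off K. \<beta> c * w c\<bar> \<le> C * wnorm K w)"
  have "(\<Sum>c<off K. tail (off m) \<beta> c * w c) = (\<Sum>c<off K. \<beta> c * tail (off m) w c)"
    by (rule sum.cong) (auto simp: tail_def)
  then have "\<bar>\<Sum>c<off K. tail (off m) \<beta> c * w c\<bar> \<le> C * wnorm K (tail (off m) w)" using \<beta> by simp
  also have "\<dots> \<le> C * wnorm K w" using \<beta> by (intro mult_left_mono wnorm_tail_le) auto
  finally show "\<bar>\<Sum>c<off K. tail (off m) \<beta> c * w c\<bar> \<le> C * wnorm K w" .
qed auto

lemma wdual_unit: "wdual 1 (unit_vec c)"
  unfolding wdual_def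
proof (intro conjI allI)
  fix K w
  have eq: "(\<Sum>d<off K. unit_vec c d * w d) = (\<Sum>d<off K. if d = c then w d else 0)"
    by (rule sum.cong) (auto simp: unit_vec_def)
  show "\<bar>\<Sum>d<off K. unit_vec c d * w d\<bar> \<le> 1 * wnorm K w"
  proof (cases "c < off K")
    case True
    obtain n where n: "off n \<le> c" "c < off (Suc n)" using group_exists by blast
    have "n < K" using n(1) True off_mono[of K n] by (meson leD le_less_trans not_le)
    then have "\<bar>w c\<bar> \<le> wnorm K w" using coord_le_gnorm[OF n, of w] gnorm_le_wnorm order_trans by blast
    then show ?thesis unfolding eq using True by simp
  next
    case False
    then show ?thesis unfolding eq by (simp add: wnorm_nonneg)
  qed
qed simp

text \<open>These are the coordinates of the image of \<open>\<Phi>\<close> under the second adjoint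
  of the label map.\<close>

definition labval :: "(((nat \<Rightarrow> real) \<Rightarrow> real) \<Rightarrow> real) \<Rightarrow> nat \<Rightarrow> real" where
  "labval \<Phi> c = \<Phi> (labfun (unit_vec c))"

lemma bidual_labfun_finite:
  assumes \<Phi>: "\<Phi> \<in> bvecs" and \<beta>: "wdual C \<beta>" and supp: "\<And>c. k \<le> c \<Longrightarrow> \<beta> c = 0"
  shows "\<Phi> (labfun \<beta>) = (\<Sum>c<k. \<beta> c * labval \<Phi> c)"
proof -
  note D = nspace_subspace[OF normed_DJ]
  have "labfun \<beta> = (\<Sum>c<k. \<beta> c *\<^sub>R labfun (unit_vec c))"
  proof (rule dual_ext[OF labfun_dual(1)[OF \<beta>]])
    show "(\<Sum>c<k. \<beta> c *\<^sub>R labfun (unit_vec c)) \<in> dvecs"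
      by (intro subspace_sum subspace_scale D labfun_dual(1)[OF wdual_unit])
    fix i
    have "(\<Sum>c<k. \<beta> c *\<^sub>R labfun (unit_vec c)) (unit_vec i) = (\<Sum>c<k. if c = lab i then \<beta> c else 0)"
      unfolding sum_fun_apply by (rule sum.cong) (simp_all add: labfun_unit, simp add: unit_vec_def)
    then show "labfun \<beta> (unit_vec i) = (\<Sum>c<k. \<beta> c *\<^sub>R labfun (unit_vec c)) (unit_vec i)"
      using supp[of "lab i"] by (auto simp: labfun_unit)
  qed
  then have "\<Phi> (labfun \<beta>) = (\<Sum>c<k. \<Phi> (\<beta> c *\<^sub>R labfun (unit_vec c)))"
    using dual_sum[OF normed_DJ \<Phi>, of "{..<k}" "\<lambda>c. \<beta> c *\<^sub>R labfun (unit_vec c)"]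
      subspace_scale[OF D labfun_dual(1)[OF wdual_unit]] by simp
  then show ?thesis by (simp add: dual_scale[OF \<Phi> labfun_dual(1)[OF wdual_unit]] labval_def)
qed

text \<open>A functional norming the first \<open>K\<close> groups of \<open>labval \<Phi>\<close>
  has finite support, so its composition with the label map is evaluated by \<open>\<Phi>\<close> as
  a finite sum.\<close>

lemma wnorm_labval_le:
  assumes \<Phi>: "\<Phi> \<in> bvecs"
  shows "wnorm K (labval \<Phi>) \<le> bnorm \<Phi>"
proof -
  obtain g where g: "linear g" "\<And>w. g w \<le> wnorm K w" "g (labval \<Phi>) = wnorm K (labval \<Phi>)"
    using hahn_banach_norming[OF seminorm_sublin[OF seminorm_wnorm]] by blast
  note gle = linear_abs_le[OF seminorm_wnorm g(1,2)]
  define \<beta> where "\<beta> = head (off K) (\<lambda>c. g (unit_vec c))"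
  have sum: "(\<Sum>c<off m. g (unit_vec c) * w c) = g (head (off m) w)" for m w
    unfolding sum_unit_vec[symmetric] by (simp add: linear_sum[OF g(1)] linear_scale[OF g(1)] mult.commute)
  have \<beta>_sum: "(\<Sum>c<off m. \<beta> c * w c) = g (head (off (min K m)) w)" for m w
    unfolding \<beta>_def sum_head_off min.commute[of K] by (rule sum)
  have "wdual 1 \<beta>"
    unfolding wdual_def
  proof (intro conjI allI)
    fix m w
    have "\<bar>\<Sum>c<off m. \<beta> c * w c\<bar> \<le> wnorm K (head (off (min K m)) w)" unfolding \<beta>_sum by (rule gle)
    also have "\<dots> \<le> 1 * wnorm m w" unfolding wnorm_head by (simp add: wnorm_mono)
    finally show "\<bar>\<Sum>c<off m. \<beta> c * w c\<bar> \<le> 1 * wnorm m w" .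
  qed simp
  note \<beta>D = labfun_dual[OF this] and \<Phi>\<beta> = bidual_labfun_finite[OF \<Phi> this, of "off K"]
  have "g (labval \<Phi>) = g (head (off K) (labval \<Phi>)) + g (tail (off K) (labval \<Phi>))"
    using linear_add[OF g(1)] head_plus_tail by metis
  moreover have "g (tail (off K) (labval \<Phi>)) = 0"
  proof -
    have "wnorm K (tail (off K) (labval \<Phi>)) = wnorm K 0"
      by (rule wnorm_cong) (simp add: tail_def)
    then show ?thesis using gle[of "tail (off K) (labval \<Phi>)"] by (simp add: seminorm_0[OF seminorm_wnorm])
  qed
  ultimately have "wnorm K (labval \<Phi>) = \<Phi> (labfun \<beta>)"
    using g(3) \<beta>_sum[of "labval \<Phi>" K] \<Phi>\<beta> by (simp add: \<beta>_def head_def)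
  also have "\<dots> \<le> bnorm \<Phi> * dnorm (labfun \<beta>)"
    using dual_abs_le[OF normed_DJ \<Phi> \<beta>D(1)] by simp
  also have "\<dots> \<le> bnorm \<Phi>"
    by (rule mult_left_le[OF \<beta>D(2) nspace_nonneg[OF normed_BJ \<Phi>]])
  finally show ?thesis .
qed

text \<open>
  A functional whose tails stay large would be large on each of \<open>r\<close> disjoint unit blocks, whose
  sum has norm at most \<open>r^(1/4)\<close>.
\<close>

lemma wdual_tail_small:
  assumes \<beta>: "wdual 1 \<beta>" and \<delta>: "0 < \<delta>"
  obtains m where "wdual \<delta> (tail (off m) \<beta>)"
proof (rule ccontr)
  assume "\<not> thesis"
  then have no: "\<not> wdual \<delta> (tail (off m) \<beta>)" for m using that by blast
  have blocks: "\<exists>M y. head (off M) y = y \<and> wnorm M y ^ 4 \<le> real r \<and> real r * \<delta> \<le> (\<Sum>c<off M. \<beta> c * y c)" for r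
  proof (induction r)
    case 0
    show ?case by (intro exI[of _ 0] conjI) (auto simp: wnorm_power4 head_def fun_eq_iff)
  next
    case (Suc r)
    then obtain M y where y: "head (off M) y = y" "wnorm M y ^ 4 \<le> real r"
      "real r * \<delta> \<le> (\<Sum>c<off M. \<beta> c * y c)" by blast
    obtain K u where u: "\<delta> * wnorm K u < \<bar>\<Sum>c<off K. tail (off M) \<beta> c * u c\<bar>"
      using no[of M] \<delta> unfolding wdual_def by (auto simp: not_le)
    define a where "a = wnorm K u"
    define s where "s = (\<Sum>c<off K. tail (off M) \<beta> c * u c)"
    have "\<bar>s\<bar> \<le> a" unfolding s_def a_def using wdual_tail[OF \<beta>, of M] by (simp add: wdual_def)
    moreover have "\<delta> * a < \<bar>s\<bar>" using u by (simp add: a_def s_def)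
    ultimately have a: "0 < a" using wnorm_nonneg[of K u] by (cases "a = 0") (auto simp: a_def)
    \<comment> \<open>The sign makes the pairing with \<open>\<beta>\<close> positive,
      \<open>a\<close> normalizes, and cutting off the first \<open>M\<close> groups makes
      \<open>z\<close> disjoint from the blocks already summed in \<open>y\<close>.\<close>
    define z where "z = (sgn s / a) *\<^sub>R tail (off M) (head (off K) u)"
    define M' where "M' = max M K"
    have zK: "z c = 0" if "off K \<le> c" for c using that by (simp add: z_def tail_def head_def)
    have zM: "z c = 0" if "c < off M" for c using that by (simp add: z_def tail_def)
    have yM: "y c = 0" if "off M \<le> c" for c using fun_cong[OF y(1), of c] that by (simp add: head_def)
    have M': "off M \<le> off M'" "off K \<le> off M'" by (auto intro!: off_mono simp: M'_def)
    have "wnorm M' z \<le> 1"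
    proof -
      have "wnorm M' z = \<bar>sgn s / a\<bar> * wnorm M' (tail (off M) (head (off K) u))"
        unfolding z_def by (rule seminorm_scale[OF seminorm_wnorm])
      also have "\<dots> \<le> \<bar>sgn s / a\<bar> * wnorm M' (head (off K) u)" by (intro mult_left_mono wnorm_tail_le) simp
      also have "wnorm M' (head (off K) u) = a" unfolding wnorm_head a_def by (simp add: M'_def)
      finally show ?thesis using a by (simp add: sgn_if split: if_splits)
    qed
    then have z1: "wnorm M' z ^ 4 \<le> 1" using wnorm_nonneg by (intro power_le_one) auto
    have e1: "wnorm M' (y + z) ^ 4 = wnorm M (y + z) ^ 4 + wnorm M' (tail (off M) (y + z)) ^ 4"
      by (rule wnorm_tail_split) (simp add: M'_def)
    have e2: "wnorm M (y + z) = wnorm M y" by (rule wnorm_cong) (simp add: zM)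
    have e3: "tail (off M) (y + z) = z" using yM zM by (auto simp: tail_def fun_eq_iff)
    have 1: "wnorm M' (y + z) ^ 4 \<le> real (Suc r)" unfolding e1 e2 e3 using y(2) z1 by linarith
    have "(\<Sum>c<off M'. \<beta> c * z c) = (\<Sum>c<off K. \<beta> c * z c)"
      using zK M' by (intro sum.mono_neutral_right) auto
    also have "\<dots> = (\<Sum>c<off K. (sgn s / a) * (tail (off M) \<beta> c * u c))"
      by (rule sum.cong) (auto simp: z_def tail_def head_def)
    also have "\<dots> = \<bar>s\<bar> / a" unfolding sum_distrib_left[symmetric] s_def[symmetric] by (simp add: sgn_if)
    finally have z_eq: "(\<Sum>c<off M'. \<beta> c * z c) = \<bar>s\<bar> / a" .
    have "\<delta> \<le> (\<Sum>c<off M'. \<beta> c * z c)"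
      unfolding z_eq using \<open>\<delta> * a < \<bar>s\<bar>\<close> a by (simp add: pos_le_divide_eq)
    moreover have "(\<Sum>c<off M'. \<beta> c * y c) = (\<Sum>c<off M. \<beta> c * y c)"
      using yM M' by (intro sum.mono_neutral_right) auto
    ultimately have 2: "real (Suc r) * \<delta> \<le> (\<Sum>c<off M'. \<beta> c * (y + z) c)"
      using y(3) by (simp add: distrib_left sum.distrib algebra_simps)
    have "head (off M') (y + z) = y + z" using yM zK M' by (auto simp: head_def fun_eq_iff)
    then show ?case using 1 2 by blast
  qed
  \<comment> \<open>The sum of \<open>r\<close> blocks pairs to at least \<open>r * \<delta>\<close>
    but has norm at most \<open>r^(1/4)\<close>, so \<open>r^3 * \<delta>^4 \<le> 1\<close>, which
    fails once \<open>r * \<delta>^4 > 1\<close>.\<close>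
  obtain r where r1: "1 / \<delta> ^ 4 < real r" using reals_Archimedean2 by blast
  moreover have "0 < 1 / \<delta> ^ 4" using \<delta> by simp
  ultimately have r: "1 / \<delta> ^ 4 < real r" "0 < r" by linarith+
  obtain M y where y: "wnorm M y ^ 4 \<le> real r" "real r * \<delta> \<le> (\<Sum>c<off M. \<beta> c * y c)"
    using blocks[of r] by blast
  have "(\<Sum>c<off M. \<beta> c * y c) \<le> 1 * wnorm M y" using \<beta> unfolding wdual_def by (meson abs_le_D1)
  then have "(real r * \<delta>) ^ 4 \<le> wnorm M y ^ 4" using y(2) \<delta> by (intro power_mono) auto
  then have "real r ^ 4 * \<delta> ^ 4 \<le> real r" using y(1) by (simp add: power_mult_distrib)
  then have "real r * (real r ^ 3 * \<delta> ^ 4) \<le> real r * 1" by (simp add: numeral_eq_Suc mult.assoc)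
  then have "real r ^ 3 * \<delta> ^ 4 \<le> 1" using r(2) by (subst (asm) mult_le_cancel_left_pos) auto
  moreover have "real r * \<delta> ^ 4 \<le> real r ^ 3 * \<delta> ^ 4"
    using r(2) \<delta> self_le_power[of "real r" 3] by (intro mult_right_mono) auto
  moreover have "1 < real r * \<delta> ^ 4" using r(1) \<delta> by (simp add: pos_divide_less_eq)
  ultimately show False by linarith
qed

text \<open>Finitely supported \<open>\<beta>\<close> only see \<open>labval \<Phi>\<close>, and by
  \<open>wdual_tail_small\<close> they are dense in the dual of the
  \<open>\<ell>\<^sub>4\<close>-sum. So \<open>\<Phi>\<close> has no part on label functionals
  beyond its label values.\<close>

lemma bidual_labfun_le:
  assumes \<Phi>: "\<Phi> \<in> bvecs" and \<beta>: "wdual \<gamma> \<beta>" and \<gamma>: "0 < \<gamma>"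
    and \<omega>: "\<And>K. wnorm K (labval \<Phi>) \<le> \<omega>"
  shows "\<Phi> (labfun \<beta>) \<le> \<gamma> * \<omega>"
proof -
  have main: "\<Phi> (labfun \<beta>) \<le> \<omega>" if \<beta>: "wdual 1 \<beta>" for \<beta>
  proof (rule field_le_epsilon)
    fix e :: real assume e: "0 < e"
    define N where "N = bnorm \<Phi> + 1"
    have N: "0 < N" using nspace_nonneg[OF normed_BJ \<Phi>] by (simp add: N_def)
    obtain m where m: "wdual (e / N) (tail (off m) \<beta>)" using wdual_tail_small[OF \<beta>] e N by (metis divide_pos_pos)
    note h = wdual_head[OF \<beta>, of m]
    have "labfun \<beta> = labfun (head (off m) \<beta>) + labfun (tail (off m) \<beta>)"
    proof (rule dual_ext[OF labfun_dual(1)[OF \<beta>] subspace_add[OF nspace_subspace[OF normed_DJ]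
            labfun_dual(1)[OF h] labfun_dual(1)[OF m]]])
      fix i show "labfun \<beta> (unit_vec i) = (labfun (head (off m) \<beta>) + labfun (tail (off m) \<beta>)) (unit_vec i)"
        by (simp add: labfun_unit head_def tail_def)
    qed
    then have "\<Phi> (labfun \<beta>) = \<Phi> (labfun (head (off m) \<beta>)) + \<Phi> (labfun (tail (off m) \<beta>))"
      using dual_add[OF \<Phi> labfun_dual(1)[OF h] labfun_dual(1)[OF m]] by simp
    moreover have "\<Phi> (labfun (head (off m) \<beta>)) \<le> \<omega>"
    proof -
      have "\<Phi> (labfun (head (off m) \<beta>)) = (\<Sum>c<off m. head (off m) \<beta> c * labval \<Phi> c)"
        by (rule bidual_labfun_finite[OF \<Phi> h]) (simp add: head_def)
      also have "\<dots> \<le> 1 * wnorm m (labval \<Phi>)" using h unfolding wdual_def by (meson abs_le_D1)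
      finally show ?thesis using \<omega>[of m] by simp
    qed
    moreover have "\<Phi> (labfun (tail (off m) \<beta>)) \<le> e"
    proof -
      have "\<Phi> (labfun (tail (off m) \<beta>)) \<le> bnorm \<Phi> * dnorm (labfun (tail (off m) \<beta>))"
        using dual_abs_le[OF normed_DJ \<Phi> labfun_dual(1)[OF m]] by simp
      also have "\<dots> \<le> N * (e / N)"
        using labfun_dual(2)[OF m] N nspace_nonneg[OF normed_BJ \<Phi>] dual_norm_nonneg[OF labfun_dual(1)[OF m]]
        by (intro mult_mono) (auto simp: N_def)
      finally show ?thesis using N by simp
    qed
    ultimately show "\<Phi> (labfun \<beta>) \<le> \<omega> + e" by linarith
  qed
  define \<beta>' where "\<beta>' = (\<lambda>c. \<beta> c / \<gamma>)"
  have "wdual 1 \<beta>'"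
    using \<beta> \<gamma> unfolding wdual_def \<beta>'_def
    by (simp add: sum_divide_distrib[symmetric] field_simps)
  note b = this labfun_dual(1)[OF this]
  have "labfun \<beta> = \<gamma> *\<^sub>R labfun \<beta>'"
  proof (rule dual_ext[OF labfun_dual(1)[OF \<beta>] subspace_scale[OF nspace_subspace[OF normed_DJ] b(2)]])
    fix i show "labfun \<beta> (unit_vec i) = (\<gamma> *\<^sub>R labfun \<beta>') (unit_vec i)"
      using \<gamma> by (simp add: labfun_unit \<beta>'_def)
  qed
  then have "\<Phi> (labfun \<beta>) = \<gamma> * \<Phi> (labfun \<beta>')" using dual_scale[OF \<Phi> b(2)] by simp
  then show ?thesis using main[OF b(1)] \<gamma> by simp
qed

section \<open>The norm on the complement\<close>

definition c00 :: "(nat \<Rightarrow> real) set" where "c00 = {x. \<exists>n. head n x = x}"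

text \<open>For finitely supported \<open>x\<close> the sequence is eventually constant, so this is
  the full norm of the label image of \<open>x\<close>.\<close>

definition quot :: "(nat \<Rightarrow> real) \<Rightarrow> real" where "quot x = lim (\<lambda>n. wnorm n (lsum x 0 n))"

lemma head_eq_iff: "head n x = x \<longleftrightarrow> (\<forall>i\<ge>n. x i = 0)"
  by (auto simp: head_def fun_eq_iff)

lemma tail_eq_iff: "tail n x = x \<longleftrightarrow> (\<forall>i<n. x i = 0)"
  by (auto simp: tail_def fun_eq_iff)

lemma head_eq_mono: "head n x = x \<Longrightarrow> n \<le> m \<Longrightarrow> head m x = x"
  by (auto simp: head_eq_iff)

lemma c00_jvecs: "x \<in> c00 \<Longrightarrow> x \<in> jvecs"
proof -
  assume "x \<in> c00"
  then obtain n where "head n x = x" by (auto simp: c00_def)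
  then show ?thesis using head_in_jvecs[of n x] by simp
qed

lemma c00_subspace: "subspace c00"
proof (rule subspaceI)
  show "0 \<in> c00" by (auto simp: c00_def head_eq_iff)
  fix x y assume "x \<in> c00" "y \<in> c00"
  then obtain n m where "head n x = x" "head m y = y" by (auto simp: c00_def)
  then have "head (max n m) (x + y) = x + y" by (auto simp: head_eq_iff)
  then show "x + y \<in> c00" by (auto simp: c00_def)
next
  fix c x assume "x \<in> c00"
  then show "c *\<^sub>R x \<in> c00" by (auto simp: c00_def head_eq_iff)
qed

lemma tail_c00: "x \<in> c00 \<Longrightarrow> tail L x \<in> c00"
  by (auto simp: c00_def head_eq_iff tail_def)

lemma head_c00: "head n x \<in> c00"
  unfolding c00_def head_eq_iff by (auto simp: head_def intro: exI[of _ n])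

text \<open>Since \<open>lab i \<le> i\<close>, a vector supported below \<open>N\<close> has a
  label image supported below \<open>N\<close>, hence within the first \<open>N\<close> groups; no
  later truncation changes its norm.\<close>

lemma wnorm_lsum_le_quot:
  assumes x: "head N x = x"
  shows "N \<le> n \<Longrightarrow> wnorm n (lsum x 0 n) = quot x" "wnorm K (lsum x 0 N) \<le> quot x"
proof -
  have "lsum x 0 N c = 0" if "N \<le> c" for c
  proof -
    have "N \<le> i" if "lab i = c" for i using that \<open>N \<le> c\<close> lab_le[of i] by linarith
    then show ?thesis unfolding lsum_def by (intro sum.neutral) fastforce
  qed
  then have v: "head (off N) (lsum x 0 N) = lsum x 0 N"
    using off_ge[of N] by (auto simp: head_eq_iff)
  have const: "wnorm n (lsum x 0 n) = wnorm N (lsum x 0 N)" if "N \<le> n" for n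
  proof -
    have "lsum x 0 n = lsum x 0 N + lsum x N n" using that by (simp add: lsum_concat)
    also have "lsum x N n = 0" using x by (intro lsum_eq_0) (auto simp: head_eq_iff)
    finally show ?thesis using wnorm_head[of n N "lsum x 0 N"] v that by simp
  qed
  then have qx: "quot x = wnorm N (lsum x 0 N)"
    unfolding quot_def by (intro limI tendsto_eventually eventually_sequentiallyI[of N])
  show "N \<le> n \<Longrightarrow> wnorm n (lsum x 0 n) = quot x" by (rule trans[OF const qx[symmetric]])
  show "wnorm K (lsum x 0 N) \<le> quot x"
    using wnorm_head[of K N "lsum x 0 N"] v wnorm_mono[of "min K N" N] qx by simp
qed

lemma quot_add: "x \<in> c00 \<Longrightarrow> y \<in> c00 \<Longrightarrow> quot (x + y) \<le> quot x + quot y"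
proof -
  assume "x \<in> c00" "y \<in> c00"
  then obtain n m where nm: "head n x = x" "head m y = y" by (auto simp: c00_def)
  define N where "N = max n m"
  have N: "head N x = x" "head N y = y" using nm by (auto intro: head_eq_mono simp: N_def)
  then have Nxy: "head N (x + y) = x + y" by (simp add: linear_add[OF linear_head])
  show ?thesis
    using seminorm_add[OF seminorm_wnorm_lsum, of N x y 0 N]
    by (simp add: wnorm_lsum_le_quot(1)[OF N(1)] wnorm_lsum_le_quot(1)[OF N(2)] wnorm_lsum_le_quot(1)[OF Nxy])
qed

lemma quot_scale: "x \<in> c00 \<Longrightarrow> quot (c *\<^sub>R x) = \<bar>c\<bar> * quot x"
proof -
  assume "x \<in> c00"
  then obtain N where N: "head N x = x" by (auto simp: c00_def)
  then have Nc: "head N (c *\<^sub>R x) = c *\<^sub>R x" by (simp add: linear_scale[OF linear_head])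
  show ?thesis
    using seminorm_scale[OF seminorm_wnorm_lsum, of N c x 0 N]
    by (simp add: wnorm_lsum_le_quot(1)[OF N] wnorm_lsum_le_quot(1)[OF Nc])
qed

text \<open>
  If no such vector existed, \<open>f\<close> would be dominated on \<open>tail L\<close> by
  \<open>(a / c\<^sub>1) * jnorm + (a / c\<^sub>2) * quot\<close>, so it would split into a part of small norm and a part
  depending on labels only, and evaluating \<open>\<Phi>\<close> on both parts would give less than \<open>a\<close>.
\<close>

lemma spread_vector:
  assumes \<Phi>: "\<Phi> \<in> coord_annihilator" and f: "f \<in> dvecs"
    and \<omega>: "\<And>K. wnorm K (labval \<Phi>) \<le> \<omega>"
    and a: "\<Phi> f = a" "0 < a" and c: "0 < c1" "0 < c2"
    and less: "bnorm \<Phi> / c1 + \<omega> / c2 < 1"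
  obtains x n where "head n x = x" "tail L x = x" "a \<le> f x" "jnorm x \<le> c1" "quot x \<le> c2"
proof (rule ccontr)
  assume "\<not> thesis"
  note found = that
  have no: "c1 < jnorm x \<or> c2 < quot x" if x: "x \<in> c00" "tail L x = x" "a \<le> f x" for x
  proof -
    obtain n where "head n x = x" using x(1) by (auto simp: c00_def)
    then show ?thesis using found[of n x] x(2,3) \<open>\<not> thesis\<close> by (meson not_le)
  qed
  have \<Phi>B: "\<Phi> \<in> bvecs" and \<Phi>0: "\<And>i. \<Phi> (coord_fun i) = 0"
    using \<Phi> by (auto simp: coord_annihilator_def)
  \<comment> \<open>\<open>quot\<close> behaves as a seminorm on \<open>c00\<close> only; composing
    with a projection extends it, and \<open>f\<close> as well, to all sequences.\<close>
  obtain \<pi> :: "(nat \<Rightarrow> real) \<Rightarrow> nat \<Rightarrow> real"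
    where \<pi>: "linear \<pi>" "\<And>x. \<pi> x \<in> c00" "\<And>x. x \<in> c00 \<Longrightarrow> \<pi> x = x"
    using projection_onto_subspace[OF c00_subspace] by blast
  define \<tau> where "\<tau> x = tail L (\<pi> x)" for x
  have \<tau>: "linear \<tau>" using linear_compose[OF \<pi>(1) linear_tail] unfolding \<tau>_def comp_def .
  have \<tau>c: "\<tau> x \<in> c00" for x unfolding \<tau>_def by (intro tail_c00 \<pi>(2))
  note \<tau>J = c00_jvecs[OF \<tau>c]
  have \<tau>unit: "\<tau> (unit_vec i) = (if L \<le> i then unit_vec i else 0)" for i
  proof -
    have "unit_vec i \<in> c00" by (auto simp: c00_def head_eq_iff unit_vec_def intro!: exI[of _ "Suc i"])
    then show ?thesis by (auto simp: \<tau>_def \<pi>(3) tail_def unit_vec_def fun_eq_iff)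
  qed
  define p where "p x = (a / c1) * jnorm (\<tau> x)" for x
  define q where "q x = (a / c2) * quot (\<tau> x)" for x
  define F where "F x = f (\<tau> x)" for x
  have "seminorm (\<lambda>x. jnorm (\<tau> x))"
    by (rule seminormI) (simp_all add: linear_add[OF \<tau>] linear_scale[OF \<tau>] jnorm_add jnorm_scale \<tau>J)
  then have p: "seminorm p" unfolding p_def by (rule seminorm_cmult) (use a c in simp)
  have "seminorm (\<lambda>x. quot (\<tau> x))"
    by (rule seminormI) (simp_all add: linear_add[OF \<tau>] linear_scale[OF \<tau>] quot_add quot_scale \<tau>c)
  then have q: "seminorm q" unfolding q_def by (rule seminorm_cmult) (use a c in simp)
  have F: "linear F"
    unfolding F_def by (rule linearI) (simp_all add: linear_add[OF \<tau>] linear_scale[OF \<tau>] dual_add[OF f] dual_scale[OF f] \<tau>J)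
  have Fpq: "F x \<le> p x + q x" for x
  proof (cases "F x \<le> 0")
    case True
    then show ?thesis using seminorm_nonneg[OF p, of x] seminorm_nonneg[OF q, of x] by linarith
  next
    case False
    \<comment> \<open>Rescaled so that \<open>f\<close> takes the value \<open>a\<close>, the vector
      violates one of the two norm bounds; by homogeneity \<open>F x \<le> p x\<close> or
      \<open>F x \<le> q x\<close>.\<close>
    define r where "r = a / F x"
    have r: "0 < r" "r * F x = a" using False a by (auto simp: r_def)
    let ?y = "r *\<^sub>R \<tau> x"
    have "?y \<in> c00" by (intro subspace_scale c00_subspace \<tau>c)
    moreover have "tail L ?y = ?y" by (auto simp: tail_eq_iff \<tau>_def tail_def)
    moreover have "a \<le> f ?y" using r by (simp add: dual_scale[OF f \<tau>J] F_def)
    ultimately have "c1 < r * jnorm (\<tau> x) \<or> c2 < r * quot (\<tau> x)"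
      using no[of ?y] r by (simp add: jnorm_scale[OF \<tau>J] quot_scale[OF \<tau>c])
    then have "F x \<le> p x \<or> F x \<le> q x"
      using c False a unfolding p_def q_def r_def by (auto simp: field_simps)
    then show ?thesis using seminorm_nonneg[OF p, of x] seminorm_nonneg[OF q, of x] by linarith
  qed
  obtain g where g: "linear g" "\<And>x. g x \<le> p x" "\<And>x. F x - g x \<le> q x"
    using hahn_banach_split[OF seminorm_sublin[OF p] seminorm_sublin[OF q] F Fpq] by blast
  define h where "h x = F x - g x" for x
  have h: "linear h" unfolding h_def by (intro linear_compose_sub F g(1))
  have habs: "\<bar>h x\<bar> \<le> q x" for x by (rule linear_abs_le[OF q h]) (use g(3) in \<open>simp add: h_def\<close>)
  note gabs = linear_abs_le[OF p g(1,2)]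
  define b where "b i = g (unit_vec i)" for i
  have b: "coef_bound (a / c1) b"
    unfolding coef_bound_def
  proof (intro conjI allI ballI)
    fix n x assume x: "x \<in> jvecs"
    have "(\<Sum>i<n. b i * x i) = g (head n x)"
      unfolding sum_unit_vec[symmetric] b_def by (simp add: linear_sum[OF g(1)] linear_scale[OF g(1)] mult.commute)
    also have "\<bar>\<dots>\<bar> \<le> (a / c1) * jnorm (tail L (head n x))"
      using gabs[of "head n x"] by (simp add: p_def \<tau>_def \<pi>(3) head_c00)
    also have "\<dots> \<le> (a / c1) * jnorm x"
      by (intro mult_left_mono order_trans[OF jnorm_tail[OF head_in_jvecs] jnorm_head[OF x]]) (use a c in simp)
    finally show "\<bar>\<Sum>i<n. b i * x i\<bar> \<le> (a / c1) * jnorm x" .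
  qed (use a c in simp)
  define \<beta> where "\<beta> k = h (unit_vec (idx k L))" for k
  \<comment> \<open>Far unit vectors with the same label differ by a vector of zero label image. As
    \<open>h\<close> is dominated by \<open>q\<close>, it cannot tell them apart.\<close>
  have h_lab: "h (unit_vec i) = \<beta> (lab i)" if i: "L \<le> i" for i
  proof -
    define j where "j = idx (lab i) L"
    have j: "L \<le> j" "lab j = lab i" unfolding j_def by (auto simp: idx_ge)
    define N where "N = Suc (max i j)"
    have N: "head N (unit_vec i - unit_vec j) = unit_vec i - unit_vec j"
      by (auto simp: head_eq_iff unit_vec_def N_def)
    have "lsum (unit_vec i - unit_vec j) 0 N = lsum (unit_vec i) 0 N - lsum (unit_vec j) 0 N"
      by (rule linear_diff[OF linear_lsum])
    also have "lsum (unit_vec i) 0 N - lsum (unit_vec j) 0 N = 0" using j by (simp add: lsum_unit N_def)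
    finally have "quot (unit_vec i - unit_vec j) = 0"
      using wnorm_lsum_le_quot(1)[OF N order_refl] by (simp add: seminorm_0[OF seminorm_wnorm])
    then have "q (unit_vec i - unit_vec j) = 0"
      using i j by (simp add: q_def linear_diff[OF \<tau>] \<tau>unit)
    then have "h (unit_vec i - unit_vec j) = 0" using habs[of "unit_vec i - unit_vec j"] by simp
    then show ?thesis by (simp add: linear_diff[OF h] \<beta>_def j_def)
  qed
  have \<beta>: "wdual (a / c2) \<beta>"
    unfolding wdual_def
  proof (intro conjI allI)
    fix K w
    \<comment> \<open>A lift of \<open>w\<close> through the label map: each coordinate is placed at
      a single index beyond \<open>L\<close>, so that \<open>quot y\<close> is the norm of a
      truncation of \<open>w\<close>.\<close>
    define y where "y = (\<Sum>k<off K. w k *\<^sub>R unit_vec (idx k L))"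
    define N where "N = Suc (\<Sum>k<off K. idx k L) + K"
    have iN: "idx k L < N" if "k < off K" for k
      using member_le_sum[of k "{..<off K}" "\<lambda>k. idx k L"] that by (simp add: N_def)
    have y_at: "y i = (if lab i < off K \<and> i = idx (lab i) L then w (lab i) else 0)" for i
    proof -
      have "y i = (\<Sum>k<off K. if k = lab i then (if i = idx (lab i) L then w k else 0) else 0)"
        unfolding y_def sum_fun_apply by (rule sum.cong) (auto simp: unit_vec_def)
      then show ?thesis by simp
    qed
    have yN: "head N y = y" unfolding head_eq_iff using y_at iN by (metis leD)
    have yL: "\<tau> y = y"
    proof -
      have "\<tau> y = (\<Sum>k<off K. w k *\<^sub>R \<tau> (unit_vec (idx k L)))"
        unfolding y_def by (simp add: linear_sum[OF \<tau>] linear_scale[OF \<tau>])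
      also have "\<dots> = y" unfolding y_def by (intro sum.cong refl) (simp add: \<tau>unit idx_ge)
      finally show ?thesis .
    qed
    have "lsum y 0 N = head (off K) w"
    proof
      fix k
      have "lsum y 0 N k = (\<Sum>i | i \<in> {0..<N} \<and> lab i = k. if i = idx k L then head (off K) w k else 0)"
        unfolding lsum_def by (rule sum.cong) (auto simp: y_at head_def)
      also have "\<dots> = (if idx k L \<in> {i. i \<in> {0..<N} \<and> lab i = k} then head (off K) w k else 0)"
        by (rule sum.delta) simp
      also have "\<dots> = head (off K) w k" using iN[of k] by (simp add: head_def)
      finally show "lsum y 0 N k = head (off K) w k" .
    qed
    then have "quot y = wnorm (min N K) w"
      using wnorm_lsum_le_quot(1)[OF yN order_refl] by (simp add: wnorm_head)
    then have qy: "quot y \<le> wnorm K w" by (simp add: wnorm_mono)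
    have "(\<Sum>k<off K. \<beta> k * w k) = h y"
      unfolding y_def \<beta>_def by (simp add: linear_sum[OF h] linear_scale[OF h] mult.commute)
    also have "\<bar>\<dots>\<bar> \<le> (a / c2) * quot y" using habs[of y] by (simp add: q_def yL)
    also have "\<dots> \<le> (a / c2) * wnorm K w" using qy a c by (intro mult_left_mono) auto
    finally show "\<bar>\<Sum>k<off K. \<beta> k * w k\<bar> \<le> (a / c2) * wnorm K w" .
  qed (use a c in simp)
  note D = nspace_subspace[OF normed_DJ] and bD = seqfun_dual[OF b] and \<beta>D = labfun_dual[OF \<beta>]
  define e where "e = f - (seqfun b + labfun \<beta>)"
  have eD: "e \<in> dvecs" unfolding e_def by (intro subspace_diff subspace_add D f bD \<beta>D)
  \<comment> \<open>Here the choice of \<open>\<Phi>\<close> enters: \<open>e\<close> has at most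
    \<open>L\<close> nonzero coefficients, so an element of the annihilator kills it and sees only
    the two parts of the split.\<close>
  have "e (unit_vec i) = 0" if "L \<le> i" for i
    using h_lab[OF that] that by (simp add: e_def seqfun_unit labfun_unit b_def h_def F_def \<tau>unit)
  then have "\<Phi> e = 0" using bidual_finite[OF \<Phi>B eD, of L] by (simp add: \<Phi>0)
  then have "\<Phi> f = \<Phi> (seqfun b) + \<Phi> (labfun \<beta>)"
    unfolding e_def using dual_diff[OF normed_DJ \<Phi>B f subspace_add[OF D bD(1) \<beta>D(1)]]
      dual_add[OF \<Phi>B bD(1) \<beta>D(1)] by simp
  moreover have "\<Phi> (seqfun b) \<le> bnorm \<Phi> * (a / c1)"
  proof -
    have "\<Phi> (seqfun b) \<le> bnorm \<Phi> * dnorm (seqfun b)"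
      using dual_abs_le[OF normed_DJ \<Phi>B bD(1)] by simp
    also have "\<dots> \<le> bnorm \<Phi> * (a / c1)"
      by (intro mult_left_mono bD(2) nspace_nonneg[OF normed_BJ \<Phi>B])
    finally show ?thesis .
  qed
  moreover have "\<Phi> (labfun \<beta>) \<le> (a / c2) * \<omega>"
    by (rule bidual_labfun_le[OF \<Phi>B \<beta> _ \<omega>]) (use a c in simp)
  ultimately have "a \<le> bnorm \<Phi> * (a / c1) + (a / c2) * \<omega>"
    using a(1) by linarith
  also have "\<dots> = a * (bnorm \<Phi> / c1 + \<omega> / c2)" by (simp add: distrib_left mult.commute)
  also have "\<dots> < a * 1" using less a(2) by (intro mult_strict_left_mono)
  finally show False by simp
qed

text \<open>
  Averages of vectors that spread out to infinity lose everything but their image under the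
  label map, so the complement carries exactly the norm of the label values.
\<close>

lemma annihilator_norm_le:
  assumes \<Phi>: "\<Phi> \<in> coord_annihilator" and \<omega>: "\<And>K. wnorm K (labval \<Phi>) \<le> \<omega>"
  shows "bnorm \<Phi> \<le> \<omega>"
proof -
  have \<Phi>B: "\<Phi> \<in> bvecs" using \<Phi> by (auto simp: coord_annihilator_def)
  have \<omega>0: "0 \<le> \<omega>" using \<omega>[of 0] wnorm_nonneg order_trans by blast
  have main: "\<Phi> f \<le> \<omega> * dnorm f" if f: "f \<in> dvecs" for f
  proof (rule ccontr)
    assume no: "\<not> ?thesis"
    define a \<nu> where "a = \<Phi> f" and "\<nu> = dnorm f"
    have a: "\<omega> * \<nu> < a" using no by (simp add: a_def \<nu>_def)
    have \<nu>0: "0 \<le> \<nu>" unfolding \<nu>_def by (rule dual_norm_nonneg[OF f])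
    have a0: "0 < a" using a mult_nonneg_nonneg[OF \<omega>0 \<nu>0] by linarith
    have "a \<le> bnorm \<Phi> * \<nu>"
      unfolding a_def \<nu>_def using dual_abs_le[OF normed_DJ \<Phi>B f] by simp
    then have \<nu>: "0 < \<nu>" using \<nu>0 a0 by (cases "\<nu> = 0") auto
    \<comment> \<open>The midpoint of \<open>\<omega>\<close> and \<open>a / \<nu>\<close>: being
      above \<open>\<omega>\<close> leaves room for a finite \<open>c1\<close>, and being below
      \<open>a / \<nu>\<close> is what the averages contradict.\<close>
    define c2 where "c2 = (\<omega> + a / \<nu>) / 2"
    have c2: "\<omega> < c2" "c2 < a / \<nu>" using a \<nu> by (auto simp: c2_def field_simps)
    then have c2pos: "0 < c2" using \<omega>0 by linarith
    define u where "u = 1 - \<omega> / c2"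
    have u: "0 < u" using c2 c2pos by (simp add: u_def)
    define c1 where "c1 = (bnorm \<Phi> + 1) / u"
    have n0: "0 \<le> bnorm \<Phi>" by (rule nspace_nonneg[OF normed_BJ \<Phi>B])
    have c1: "0 < c1" using u n0 by (simp add: c1_def)
    have "bnorm \<Phi> / c1 = bnorm \<Phi> * u / (bnorm \<Phi> + 1)"
      by (simp add: c1_def)
    also have "\<dots> < u" using u n0 by (simp add: divide_less_eq algebra_simps)
    finally have less: "bnorm \<Phi> / c1 + \<omega> / c2 < 1" by (simp add: u_def)
    have "\<exists>x n. head n x = x \<and> tail L x = x \<and> a \<le> f x \<and> jnorm x \<le> c1 \<and> quot x \<le> c2" for L
      using spread_vector[OF \<Phi> f \<omega> a_def[symmetric] a0 c1 c2pos less, of L] by blast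
    then obtain X nx where X: "\<And>L. head (nx L) (X L) = X L" "\<And>L. tail L (X L) = X L"
      "\<And>L. a \<le> f (X L)" "\<And>L. jnorm (X L) \<le> c1" "\<And>L. quot (X L) \<le> c2" by metis
    \<comment> \<open>Each vector is chosen beyond the support of the preceding ones, which makes
      the \<open>y s\<close> successive.\<close>
    define L where "L s = ((\<lambda>l. max l (nx l)) ^^ s) 0" for s
    have LSuc: "L (Suc s) = max (L s) (nx (L s))" for s by (simp add: L_def)
    have L: "mono L" unfolding incseq_Suc_iff by (simp add: LSuc)
    define y where "y s = X (L s)" for s
    have yJ: "y s \<in> jvecs" for s using X(1)[of "L s"] head_in_jvecs[of "nx (L s)" "y s"] by (simp add: y_def)
    have yL: "head (L (Suc s)) (y s) = y s" for s
      unfolding y_def by (rule head_eq_mono[OF X(1)]) (simp add: LSuc)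
    have y0: "y s i = 0" if "i < L s \<or> L (Suc s) \<le> i" for s i
      using that yL[of s] X(2)[of "L s"] unfolding head_eq_iff tail_eq_iff by (auto simp: y_def)
    have bound: "jnorm (\<Sum>s<N. y s) \<le> c2 * N + 2 * c1 * sqrt N" for N
    proof (rule jnorm_sum_le[OF L])
      fix s K assume "s < N"
      have "lsum (y s) 0 (L s) + lsum (y s) (L s) (L (Suc s)) = lsum (y s) 0 (L (Suc s))"
        using monoD[OF L, of s "Suc s"] by (simp add: lsum_concat)
      moreover have "lsum (y s) 0 (L s) = 0" by (rule lsum_eq_0) (simp add: y0)
      ultimately show "wnorm K (lsum (y s) (L s) (L (Suc s))) \<le> c2"
        using wnorm_lsum_le_quot(2)[OF yL[of s], of K] X(5)[of "L s"] by (simp add: y_def)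
    qed (use y0 yJ X(4) c1 c2pos in \<open>auto simp: y_def\<close>)
    define d where "d = a / \<nu> - c2"
    have d: "0 < d" using c2 by (simp add: d_def)
    \<comment> \<open>\<open>f\<close> is at least \<open>N * a\<close> on the sum of
      \<open>N\<close> vectors, whereas the norm of the sum grows like \<open>c2 * N\<close> up to a
      term of order \<open>sqrt N\<close>.\<close>
    have le: "d * sqrt N \<le> 2 * c1" if N: "0 < N" for N :: nat
    proof -
      have sJ: "(\<Sum>s<N. y s) \<in> jvecs" by (intro subspace_sum jvecs_subspace yJ)
      have "N * a = (\<Sum>s<N. a)" by simp
      also have "\<dots> \<le> (\<Sum>s<N. f (y s))" by (rule sum_mono) (simp add: y_def X(3))
      also have "\<dots> = f (\<Sum>s<N. y s)" by (rule dual_sum[OF normed_J f yJ, symmetric])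
      also have "\<dots> \<le> \<nu> * jnorm (\<Sum>s<N. y s)"
        using dual_abs_le[OF normed_J f sJ] by (simp add: \<nu>_def)
      also have "\<dots> \<le> \<nu> * (c2 * N + 2 * c1 * sqrt N)" by (intro mult_left_mono bound \<nu>0)
      finally have "N * (a / \<nu>) \<le> c2 * N + 2 * c1 * sqrt N" using \<nu> by (simp add: field_simps)
      then have "d * N \<le> 2 * c1 * sqrt N" by (simp add: d_def algebra_simps)
      then have "(d * sqrt N) * sqrt N \<le> (2 * c1) * sqrt N" by (simp add: mult.assoc)
      then show ?thesis using N by simp
    qed
    obtain N :: nat where N: "(2 * c1 / d)\<^sup>2 < real N" using reals_Archimedean2 by blast
    then have "0 < real N" using zero_le_power2[of "2 * c1 / d"] by linarith
    then have "2 * c1 / d < sqrt N" using N c1 d by (intro real_less_rsqrt) auto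
    then show False using le[of N] \<open>0 < real N\<close> d by (simp add: field_simps)
  qed
  show ?thesis
  proof (rule dual_norm_le[OF normed_DJ \<omega>0])
    fix f assume f: "f \<in> dvecs"
    have "- f \<in> dvecs" by (rule subspace_neg[OF nspace_subspace[OF normed_DJ] f])
    then have "\<Phi> (- f) \<le> \<omega> * dnorm (- f)" by (rule main)
    moreover have "\<Phi> (- f) = - \<Phi> f" using dual_scale[OF \<Phi>B f, of "-1"] by simp
    ultimately show "\<bar>\<Phi> f\<bar> \<le> \<omega> * dnorm f"
      using main[OF f] nspace_minus[OF normed_DJ f] by simp
  qed
qed

section \<open>Total incomparability\<close>

text \<open>Each functional costs at most one dimension: a spanning set for the next kernel,
  enlarged by one vector on which the functional does not vanish, spans the previous kernel.\<close>

lemma infinite_dim_kernel: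
  fixes W :: "'a::real_vector set" and lf :: "nat \<Rightarrow> 'a \<Rightarrow> real"
  assumes W: "subspace W" "\<not> finite_dim W"
    and add: "\<And>j x y. x \<in> W \<Longrightarrow> y \<in> W \<Longrightarrow> lf j (x + y) = lf j x + lf j y"
    and scale: "\<And>j c x. x \<in> W \<Longrightarrow> lf j (c *\<^sub>R x) = c * lf j x"
  obtains x where "x \<in> W" "x \<noteq> 0" "\<And>j. j < r \<Longrightarrow> lf j x = 0"
proof -
  define N where "N r = {x \<in> W. \<forall>j<r. lf j x = 0}" for r
  have N: "subspace (N r)" for r
  proof (rule subspaceI)
    show "0 \<in> N r" using subspace_0[OF W(1)] scale[of 0 _ 0] by (simp add: N_def)
  qed (auto simp: N_def add scale subspace_add[OF W(1)] subspace_scale[OF W(1)])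
  have "\<not> finite_dim (N r)"
  proof (induction r)
    case 0
    then show ?case using W by (simp add: N_def)
  next
    case (Suc r)
    show ?case
    proof
      assume "finite_dim (N (Suc r))"
      then obtain B where B: "finite B" "N (Suc r) \<subseteq> span B" by (auto simp: finite_dim_def)
      show False
      proof (cases "\<forall>x\<in>N r. lf r x = 0")
        case True
        then have "N (Suc r) = N r" by (auto simp: N_def less_Suc_eq)
        then show False using Suc B by (auto simp: finite_dim_def)
      next
        case False
        then obtain x0 where x0: "x0 \<in> N r" "lf r x0 \<noteq> 0" by blast
        have "x \<in> span (insert x0 B)" if x: "x \<in> N r" for x
        proof -
          define k where "k = - (lf r x / lf r x0)"
          have m: "x + k *\<^sub>R x0 \<in> N r" by (intro subspace_add subspace_scale N x x0)
          have xW: "x \<in> W" "x0 \<in> W" using x x0 by (simp_all add: N_def)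
          have "lf r (x + k *\<^sub>R x0) = lf r x + k * lf r x0"
            by (simp only: add[OF xW(1) subspace_scale[OF W(1) xW(2)]] scale[OF xW(2)])
          then have "lf r (x + k *\<^sub>R x0) = 0" using x0(2) by (simp add: k_def)
          then have "x + k *\<^sub>R x0 \<in> N (Suc r)" using m by (auto simp: N_def less_Suc_eq)
          then have "x + k *\<^sub>R x0 \<in> span (insert x0 B)"
            using B(2) span_mono[of B "insert x0 B"] by blast
          moreover have "k *\<^sub>R x0 \<in> span (insert x0 B)" by (intro span_scale span_base) simp
          ultimately have "(x + k *\<^sub>R x0) - k *\<^sub>R x0 \<in> span (insert x0 B)" by (rule span_diff)
          then show ?thesis by simp
        qed
        then have "finite_dim (N r)" using B(1) unfolding finite_dim_def by (intro exI[of _ "insert x0 B"]) auto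
        then show False using Suc by simp
      qed
    qed
  qed
  then have "\<not> N r \<subseteq> span {}" unfolding finite_dim_def by blast
  then obtain x where "x \<in> N r" "x \<noteq> 0" by auto
  then show thesis using that by (auto simp: N_def)
qed

text \<open>Fourth powers add over groups and are bounded, so they converge and their remainders
  become small.\<close>

lemma wnorm_tails_small:
  assumes bound: "\<And>K. wnorm K w \<le> \<omega>" and e: "0 < e"
  obtains n where "\<And>K. wnorm K (tail (off n) w) \<le> e"
proof -
  have "incseq (\<lambda>K. wnorm K w ^ 4)"
    by (intro monoI power_mono wnorm_mono wnorm_nonneg)
  moreover have "wnorm K w ^ 4 \<le> \<omega> ^ 4" for K by (intro power_mono bound wnorm_nonneg)
  ultimately obtain l where l: "(\<lambda>K. wnorm K w ^ 4) \<longlonglongrightarrow> l" "\<And>K. wnorm K w ^ 4 \<le> l"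
    using incseq_convergent[of "\<lambda>K. wnorm K w ^ 4" "\<omega> ^ 4"] by blast
  have "\<forall>\<^sub>F n in sequentially. l - e ^ 4 < wnorm n w ^ 4"
    using e by (intro order_tendstoD(1)[OF l(1)]) simp
  then obtain n where n: "l - e ^ 4 < wnorm n w ^ 4" by (auto simp: eventually_sequentially)
  have "wnorm K (tail (off n) w) \<le> e" for K
  proof -
    have "wnorm (max K n) (tail (off n) w) ^ 4 \<le> e ^ 4"
      using wnorm_tail_split[of n "max K n" w] l(2)[of "max K n"] n by simp
    then have "wnorm (max K n) (tail (off n) w) \<le> e" by (rule power4_le_imp_le) (use e in simp)
    then show ?thesis using wnorm_mono[of K "max K n" "tail (off n) w"] by simp
  qed
  then show thesis by (rule that)
qed

text \<open>A squared form of \<open>X - t \<le> h\<close> that also covers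
  \<open>X \<le> t\<close>, where the left-hand side is not positive. It transfers the
  \<open>2\<close>-estimate to vectors that are only almost disjoint.\<close>

lemma square_diff_le:
  fixes h X t :: real
  assumes "0 \<le> h" "0 \<le> X" "0 \<le> t" "X \<le> h + t"
  shows "X\<^sup>2 - 2 * X * t \<le> h\<^sup>2"
proof (cases "X \<le> t")
  case True
  then have "X * X \<le> X * t" by (intro mult_left_mono assms)
  then have "X\<^sup>2 \<le> X * t" by (simp add: power2_eq_square)
  then show ?thesis using zero_le_power2[of h] mult_nonneg_nonneg[OF assms(2,3)] by linarith
next
  case False
  then have "(X - t)\<^sup>2 \<le> h\<^sup>2" using assms by (intro power_mono) auto
  moreover have "(X - t)\<^sup>2 = X\<^sup>2 - 2 * X * t + t\<^sup>2" by (simp add: power2_diff)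
  ultimately show ?thesis using zero_le_power2[of t] by linarith
qed

text \<open>
  Sums of \<open>m\<close> almost disjoint unit vectors have norm at least of order \<open>m^(1/2)\<close> in the space, but
  at most of order \<open>m^(1/4)\<close> in the complement.
\<close>

lemma annihilator_incomparable:
  assumes W: "subspace W" "W \<subseteq> coord_annihilator" "\<not> finite_dim W"
    and V: "V \<subseteq> jvecs"
    and iso: "isomorphic_nspaces (restrict_nspace (bidual jspace) W) (restrict_nspace jspace V)"
  shows False
proof -
  obtain T S where T0: "bounded_op (restrict_nspace (bidual jspace) W) (restrict_nspace jspace V) T"
    and S0: "bounded_op (restrict_nspace jspace V) (restrict_nspace (bidual jspace) W) S"
    and ST: "\<And>\<Phi>. \<Phi> \<in> W \<Longrightarrow> S (T \<Phi>) = \<Phi>"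
    using iso unfolding isomorphic_nspaces_def restrict_nspace_def by auto
  let ?n = "bnorm"
  have TV: "T \<Phi> \<in> V" if "\<Phi> \<in> W" for \<Phi> using T0 that by (auto simp: bounded_op_def restrict_nspace_def)
  then have TJ: "T \<Phi> \<in> jvecs" if "\<Phi> \<in> W" for \<Phi> using that V by blast
  have Tadd: "T (\<Phi> + \<Psi>) = T \<Phi> + T \<Psi>" if "\<Phi> \<in> W" "\<Psi> \<in> W" for \<Phi> \<Psi>
    using T0 that by (auto simp: bounded_op_def restrict_nspace_def)
  have Tscale: "T (c *\<^sub>R \<Phi>) = c *\<^sub>R T \<Phi>" if "\<Phi> \<in> W" for c \<Phi>
    using T0 that by (auto simp: bounded_op_def restrict_nspace_def)
  obtain A0 where "\<forall>\<Phi>\<in>W. jnorm (T \<Phi>) \<le> A0 * ?n \<Phi>"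
    using T0 unfolding bounded_op_def restrict_nspace_def by auto
  then have A0: "jnorm (T \<Phi>) \<le> A0 * ?n \<Phi>" if "\<Phi> \<in> W" for \<Phi> using that by blast
  obtain B0 where "\<forall>x\<in>V. ?n (S x) \<le> B0 * jnorm x"
    using S0 unfolding bounded_op_def restrict_nspace_def by auto
  then have B0: "?n (S x) \<le> B0 * jnorm x" if "x \<in> V" for x using that by blast
  define A B where "A = max A0 1" and "B = max B0 1"
  have AB: "1 \<le> A" "1 \<le> B" by (auto simp: A_def B_def)
  have WB: "\<Phi> \<in> bvecs" if "\<Phi> \<in> W" for \<Phi>
    using that W(2) by (auto simp: coord_annihilator_def)
  note nn = nspace_nonneg[OF normed_BJ WB]
  have upper: "jnorm (T \<Phi>) \<le> A * ?n \<Phi>" if "\<Phi> \<in> W" for \<Phi>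
    using A0[OF that] mult_right_mono[OF _ nn[OF that], of A0 A] by (simp add: A_def)
  have lower: "?n \<Phi> \<le> B * jnorm (T \<Phi>)" if "\<Phi> \<in> W" for \<Phi>
    using B0[OF TV[OF that]] mult_right_mono[OF _ jnorm_nonneg[OF TJ[OF that]], of B0 B]
    by (simp add: B_def ST[OF that])
  define d where "d = 1 / B"
  have d: "0 < d" using AB by (simp add: d_def)
  \<comment> \<open>A gliding hump carried out on both sides at once. Per step, disjoint unit
    vectors would add at most \<open>1\<close> to the fourth power in the complement and at least
    \<open>d\<^sup>2\<close> to the square in the space; \<open>2\<close> and
    \<open>d\<^sup>2 / 2\<close> leave room for the overlaps, with \<open>(1 / 10 + 1)^4 < 2\<close>
    on the first side.\<close>
  have step: "\<exists>\<Psi>\<in>W. (\<forall>K. wnorm K (labval \<Psi>) ^ 4 \<le> 2 * real m) \<and> real m * (d\<^sup>2 / 2) \<le> (jnorm (T \<Psi>))\<^sup>2" for m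
  proof (induction m)
    case 0
    define \<Psi>0 :: "((nat \<Rightarrow> real) \<Rightarrow> real) \<Rightarrow> real" where "\<Psi>0 = 0"
    have "labval \<Psi>0 = 0" by (auto simp: \<Psi>0_def labval_def fun_eq_iff)
    then have "wnorm K (labval \<Psi>0) = 0" for K
      using seminorm_0[OF seminorm_wnorm, of K] by simp
    moreover have "\<Psi>0 \<in> W" unfolding \<Psi>0_def by (rule subspace_0[OF W(1)])
    ultimately show ?case by (intro bexI[of _ \<Psi>0]) simp_all
  next
    case (Suc m)
    then obtain \<Psi> where \<Psi>: "\<Psi> \<in> W" "\<And>K. wnorm K (labval \<Psi>) ^ 4 \<le> 2 * real m"
      "real m * (d\<^sup>2 / 2) \<le> (jnorm (T \<Psi>))\<^sup>2" by blast
    obtain n where n: "\<And>K. wnorm K (tail (off n) (labval \<Psi>)) \<le> 1 / 10"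
      using wnorm_tails_small[OF wnorm_labval_le[OF WB[OF \<Psi>(1)]], of "1 / 10"] by auto
    define X where "X = jnorm (T \<Psi>)"
    have X0: "0 \<le> X" unfolding X_def by (rule jnorm_nonneg[OF TJ[OF \<Psi>(1)]])
    \<comment> \<open>Chosen so that the two error terms \<open>2 * X * t\<close> and
      \<open>2 * d * t\<close> together cost at most \<open>d\<^sup>2 / 2\<close>.\<close>
    define \<eta> where "\<eta> = d\<^sup>2 / (4 * (X + d))"
    have \<eta>: "0 < \<eta>" using d X0 by (simp add: \<eta>_def)
    obtain L where L: "jnorm (tail L (T \<Psi>)) < \<eta>"
      using order_tendstoD(2)[OF tail_tendsto_0[OF TJ[OF \<Psi>(1)]] \<eta>] by (auto simp: eventually_sequentially)
    \<comment> \<open>The new vector must have image zero on the first \<open>L\<close> coordinates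
      and zero label values in the first \<open>n\<close> groups: \<open>L + off n\<close> linear
      conditions, indexed consecutively.\<close>
    define lf where "lf j \<Phi> = (if j < L then T \<Phi> j else labval \<Phi> (j - L))" for j \<Phi>
    obtain \<Theta> where \<Theta>: "\<Theta> \<in> W" "\<Theta> \<noteq> 0" "\<And>j. j < L + off n \<Longrightarrow> lf j \<Theta> = 0"
      by (rule infinite_dim_kernel[OF W(1,3), of lf "L + off n"]) (auto simp: lf_def Tadd Tscale labval_def)
    have n0: "0 < ?n \<Theta>" using nn[OF \<Theta>(1)] nspace_eq_0[OF normed_BJ WB[OF \<Theta>(1)]] \<Theta>(2) by linarith
    define \<Phi> where "\<Phi> = (1 / ?n \<Theta>) *\<^sub>R \<Theta>"
    have \<Phi>W: "\<Phi> \<in> W" unfolding \<Phi>_def by (intro subspace_scale W(1) \<Theta>(1))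
    have \<Phi>1: "?n \<Phi> = 1" using n0 by (simp add: \<Phi>_def nspace_scale[OF normed_BJ WB[OF \<Theta>(1)]])
    have T0: "T \<Phi> i = 0" if "i < L" for i
      using \<Theta>(3)[of i] that by (simp add: \<Phi>_def Tscale[OF \<Theta>(1)] lf_def)
    have lab0: "labval \<Phi> c = 0" if "c < off n" for c
      using \<Theta>(3)[of "L + c"] that by (simp add: \<Phi>_def lf_def labval_def)
    have lab_add: "labval (\<Psi> + \<Phi>) = labval \<Psi> + labval \<Phi>" by (auto simp: labval_def)
    have w: "wnorm K (labval (\<Psi> + \<Phi>)) ^ 4 \<le> 2 * real (Suc m)" for K
    proof -
      define K' where "K' = max K n"
      have "wnorm K (labval (\<Psi> + \<Phi>)) ^ 4 \<le> wnorm K' (labval (\<Psi> + \<Phi>)) ^ 4"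
        by (intro power_mono wnorm_mono wnorm_nonneg) (simp add: K'_def)
      also have "\<dots> = wnorm n (labval (\<Psi> + \<Phi>)) ^ 4 + wnorm K' (tail (off n) (labval (\<Psi> + \<Phi>))) ^ 4"
        by (rule wnorm_tail_split) (simp add: K'_def)
      also have "wnorm n (labval (\<Psi> + \<Phi>)) = wnorm n (labval \<Psi>)"
        by (rule wnorm_cong) (simp add: lab_add lab0)
      also have "wnorm K' (tail (off n) (labval (\<Psi> + \<Phi>))) ^ 4 \<le> (1 / 10 + 1) ^ 4"
      proof (rule power_mono[OF _ wnorm_nonneg])
        have "tail (off n) (labval (\<Psi> + \<Phi>)) = tail (off n) (labval \<Psi>) + tail (off n) (labval \<Phi>)"
          unfolding lab_add by (rule linear_add[OF linear_tail])
        then have "wnorm K' (tail (off n) (labval (\<Psi> + \<Phi>))) \<le>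
            wnorm K' (tail (off n) (labval \<Psi>)) + wnorm K' (tail (off n) (labval \<Phi>))"
          using seminorm_add[OF seminorm_wnorm, of K'] by simp
        also have "\<dots> \<le> 1 / 10 + 1"
          using n[of K'] wnorm_tail_le[of K' n "labval \<Phi>"] wnorm_labval_le[OF WB[OF \<Phi>W], of K'] \<Phi>1
          by (intro add_mono) linarith+
        finally show "wnorm K' (tail (off n) (labval (\<Psi> + \<Phi>))) \<le> 1 / 10 + 1" .
      qed
      also have "wnorm n (labval \<Psi>) ^ 4 + (1 / 10 + 1) ^ 4 \<le> 2 * real (Suc m)"
        using \<Psi>(2)[of n] by (simp add: power_divide)
      finally show ?thesis by (simp only: add_le_cancel_right)
    qed
    define t where "t = jnorm (tail L (T \<Psi>))"
    have t: "0 \<le> t" "t < \<eta>" using L jnorm_nonneg[OF tail_in_jvecs[OF TJ[OF \<Psi>(1)]]] by (auto simp: t_def)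
    define Z where "Z = T (\<Psi> + \<Phi>)"
    have Z: "Z = T \<Psi> + T \<Phi>" unfolding Z_def by (rule Tadd[OF \<Psi>(1) \<Phi>W])
    have ZJ: "Z \<in> jvecs" unfolding Z by (intro jvecs_add TJ \<Psi>(1) \<Phi>W)
    have hZ: "head L Z = head L (T \<Psi>)" by (auto simp: Z head_def T0 fun_eq_iff)
    have tZ: "tail L Z = tail L (T \<Psi>) + T \<Phi>" by (auto simp: Z tail_def T0 fun_eq_iff)
    have "X \<le> jnorm (head L Z) + t"
      unfolding X_def t_def hZ using jnorm_add[OF head_in_jvecs tail_in_jvecs[OF TJ[OF \<Psi>(1)]], of L "T \<Psi>" L]
      by (simp add: head_plus_tail)
    then have h1: "X\<^sup>2 - 2 * X * t \<le> (jnorm (head L Z))\<^sup>2"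
      by (intro square_diff_le jnorm_nonneg head_in_jvecs X0 t)
    have "d \<le> jnorm (T \<Phi>)" using lower[OF \<Phi>W] \<Phi>1 AB by (simp add: d_def field_simps)
    moreover have "jnorm (T \<Phi>) - t \<le> jnorm (T \<Phi> + tail L (T \<Psi>))"
      unfolding t_def by (rule nspace_triangle_minus[OF normed_J TJ[OF \<Phi>W] tail_in_jvecs[OF TJ[OF \<Psi>(1)]]])
    ultimately have "d \<le> jnorm (tail L Z) + t" unfolding tZ by (simp add: add.commute)
    then have h2: "d\<^sup>2 - 2 * d * t \<le> (jnorm (tail L Z))\<^sup>2"
      using d by (intro square_diff_le jnorm_nonneg tail_in_jvecs ZJ t) auto
    have "2 * t * (X + d) \<le> 2 * \<eta> * (X + d)"
      using t X0 d by (intro mult_right_mono) auto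
    also have "\<dots> = d\<^sup>2 / 2" using X0 d by (simp add: \<eta>_def field_simps)
    finally have "2 * X * t + 2 * d * t \<le> d\<^sup>2 / 2" by (simp add: algebra_simps)
    then have "X\<^sup>2 + d\<^sup>2 / 2 \<le> (jnorm Z)\<^sup>2"
      using h1 h2 jnorm_head_tail[OF ZJ, of L] by linarith
    then have "real (Suc m) * (d\<^sup>2 / 2) \<le> (jnorm Z)\<^sup>2"
      using \<Psi>(3) by (simp add: X_def distrib_right)
    then show ?case using w subspace_add[OF W(1) \<Psi>(1) \<Phi>W] unfolding Z_def by blast
  qed
  \<comment> \<open>Comparing \<open>m\<^sup>2 * d^4 / 4\<close> with \<open>A^4 * 2 * m\<close>
    would force \<open>m \<le> 8 * A^4 / d^4\<close>.\<close>
  obtain m :: nat where m: "8 * A ^ 4 / d ^ 4 < real m" using reals_Archimedean2 by blast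
  have "0 \<le> 8 * A ^ 4 / d ^ 4" using AB d by simp
  then have m0: "0 < real m" using m by linarith
  obtain \<Psi> where \<Psi>: "\<Psi> \<in> W" "\<And>K. wnorm K (labval \<Psi>) ^ 4 \<le> 2 * real m"
    "real m * (d\<^sup>2 / 2) \<le> (jnorm (T \<Psi>))\<^sup>2" using step[of m] by blast
  define \<omega> where "\<omega> = sqrt (sqrt (2 * real m))"
  have \<omega>4: "\<omega> ^ 4 = 2 * real m"
  proof -
    have "\<omega> ^ 4 = (\<omega>\<^sup>2)\<^sup>2" by simp
    then show ?thesis by (simp add: \<omega>_def)
  qed
  have \<omega>0: "0 \<le> \<omega>" by (simp add: \<omega>_def)
  have "wnorm K (labval \<Psi>) \<le> \<omega>" for K
    by (rule power4_le_imp_le[OF _ \<omega>0]) (simp add: \<omega>4 \<Psi>(2))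
  then have "?n \<Psi> \<le> \<omega>" using annihilator_norm_le \<Psi>(1) W(2) by blast
  then have "jnorm (T \<Psi>) \<le> A * \<omega>" using upper[OF \<Psi>(1)] mult_left_mono[of "?n \<Psi>" \<omega> A] AB by linarith
  then have "(jnorm (T \<Psi>)) ^ 4 \<le> (A * \<omega>) ^ 4" by (intro power_mono jnorm_nonneg TJ \<Psi>(1))
  also have "(A * \<omega>) ^ 4 = A ^ 4 * (2 * real m)" by (simp add: power_mult_distrib \<omega>4)
  finally have up: "(jnorm (T \<Psi>)) ^ 4 \<le> A ^ 4 * (2 * real m)" .
  have "(real m * (d\<^sup>2 / 2))\<^sup>2 \<le> ((jnorm (T \<Psi>))\<^sup>2)\<^sup>2" using \<Psi>(3) by (intro power_mono) auto
  then have "real m * (real m * d ^ 4) \<le> (jnorm (T \<Psi>)) ^ 4 * 4"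
    by (simp add: power_mult_distrib power_divide power2_eq_square[of "real m"] mult.assoc)
  also have "\<dots> \<le> A ^ 4 * (2 * real m) * 4" by (rule mult_right_mono[OF up]) simp
  also have "\<dots> = real m * (8 * A ^ 4)" by simp
  finally have "real m * (real m * d ^ 4) \<le> real m * (8 * A ^ 4)" .
  then have "real m * d ^ 4 \<le> 8 * A ^ 4" using m0 by (subst (asm) mult_le_cancel_left_pos) auto
  then show False using m d by (simp add: field_simps)
qed

section \<open>Rademacher functions\<close>

text \<open>The sign is read off the \<open>i\<close>-th binary digit of \<open>t\<close>, so
  \<open>t < 2 ^ D\<close> runs exactly once through all sign vectors of length
  \<open>D\<close>.\<close>

definition rad :: "nat \<Rightarrow> nat \<Rightarrow> real" where
  "rad i t = (if even (t div 2 ^ i) then 1 else - 1)"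

lemma rad_shift: "i < D \<Longrightarrow> rad i (t + 2 ^ D) = rad i t"
proof -
  assume i: "i < D"
  have "(2::nat) ^ D = 2 ^ (D - i) * 2 ^ i" using i by (simp add: power_add[symmetric])
  then have "(t + 2 ^ D) div 2 ^ i = t div 2 ^ i + 2 ^ (D - i)" by simp
  then show ?thesis using i by (simp add: rad_def)
qed

lemma rad_top: "t < 2 ^ D \<Longrightarrow> rad D t = 1" "t < 2 ^ D \<Longrightarrow> rad D (t + 2 ^ D) = - 1"
  by (auto simp: rad_def)

text \<open>Splitting by the top binary digit; this is the induction step for the moments and for
  the product weights.\<close>

lemma sum_power_Suc: "(\<Sum>t<2 ^ Suc D. f t) = (\<Sum>t<2 ^ D. f t + f (t + 2 ^ D :: nat) :: real)"
proof -
  have "(\<Sum>t<n + m. f t) = (\<Sum>t<n. f t) + (\<Sum>t<m. f (t + n))" for n m :: nat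
    by (induction m) (auto simp: add.commute)
  from this[of "2 ^ D" "2 ^ D"] show ?thesis by (simp add: sum.distrib mult_2)
qed

definition rsum :: "nat \<Rightarrow> (nat \<Rightarrow> real) \<Rightarrow> nat \<Rightarrow> real" where
  "rsum D a t = (\<Sum>i<D. rad i t * a i)"

lemma rsum_Suc: "t < 2 ^ D \<Longrightarrow> rsum (Suc D) a t = rsum D a t + a D"
  "t < 2 ^ D \<Longrightarrow> rsum (Suc D) a (t + 2 ^ D) = rsum D a t - a D"
  by (simp_all add: rsum_def rad_top rad_shift)

lemma rsum_moment2: "(\<Sum>t<2 ^ D. (rsum D a t)\<^sup>2) = 2 ^ D * (\<Sum>i<D. (a i)\<^sup>2)"
proof (induction D)
  case (Suc D)
  have "(\<Sum>t<2 ^ Suc D. (rsum (Suc D) a t)\<^sup>2) = (\<Sum>t<2 ^ D. 2 * (rsum D a t)\<^sup>2 + 2 * (a D)\<^sup>2)"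
    unfolding sum_power_Suc by (rule sum.cong) (auto simp: rsum_Suc power2_eq_square algebra_simps)
  also have "\<dots> = 2 * (2 ^ D * (\<Sum>i<D. (a i)\<^sup>2)) + 2 ^ D * (2 * (a D)\<^sup>2)"
    by (simp add: sum.distrib sum_distrib_left[symmetric] Suc)
  finally show ?case by (simp add: algebra_simps)
qed (simp add: rsum_def)

lemma rsum_moment4: "(\<Sum>t<2 ^ D. (rsum D a t) ^ 4) \<le> 2 ^ D * (3 * (\<Sum>i<D. (a i)\<^sup>2)\<^sup>2)"
proof (induction D)
  case (Suc D)
  define A where "A = (\<Sum>i<D. (a i)\<^sup>2)"
  have "(x + y) ^ 4 + (x - y) ^ 4 = 2 * x ^ 4 + 12 * (y\<^sup>2 * x\<^sup>2) + 2 * y ^ 4" for x y :: real by algebra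
  then have "(\<Sum>t<2 ^ Suc D. (rsum (Suc D) a t) ^ 4) =
      (\<Sum>t<2 ^ D. 2 * (rsum D a t) ^ 4 + 12 * ((a D)\<^sup>2 * (rsum D a t)\<^sup>2) + 2 * (a D) ^ 4)"
    unfolding sum_power_Suc by (intro sum.cong) (auto simp: rsum_Suc)
  also have "\<dots> = 2 * (\<Sum>t<2 ^ D. (rsum D a t) ^ 4) + 12 * ((a D)\<^sup>2 * (2 ^ D * A)) + 2 ^ D * (2 * (a D) ^ 4)"
    by (simp add: sum.distrib sum_distrib_left[symmetric] rsum_moment2 A_def)
  \<comment> \<open>The last coefficient is raised from \<open>2\<close> to \<open>6\<close> to
    complete the square of \<open>A + (a D)\<^sup>2\<close>.\<close>
  also have "\<dots> \<le> 2 * (2 ^ D * (3 * A\<^sup>2)) + 12 * ((a D)\<^sup>2 * (2 ^ D * A)) + 2 ^ D * (6 * (a D) ^ 4)"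
    using Suc by (intro add_mono mult_left_mono) (auto simp: A_def)
  also have "\<dots> = 2 ^ Suc D * (3 * (A + (a D)\<^sup>2)\<^sup>2)"
    by (simp add: power2_sum algebra_simps power_mult[symmetric])
  finally show ?case by (simp add: A_def)
qed (simp add: rsum_def)

text \<open>Bounds a first moment from below by a second and a fourth moment, both of which are
  computable for Rademacher sums.\<close>

lemma abs_ge_quartic: "0 \<le> u \<Longrightarrow> u\<^sup>2 - u ^ 4 / 4 \<le> (u::real)"
proof -
  assume u: "0 \<le> u"
  \<comment> \<open>\<open>6/5\<close> is a rational number close to the minimum
    \<open>2 / sqrt 3\<close> of \<open>1 - u + u^3 / 4\<close>; the root \<open>- 12/5\<close>
    cancels the quadratic term.\<close>
  have "0 \<le> (u - 6/5)\<^sup>2 * (u + 12/5)" using u by (intro mult_nonneg_nonneg) auto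
  also have "\<dots> = u ^ 3 - 108/25 * u + 432/125" by (simp add: power2_eq_square power3_eq_cube field_simps)
  finally have "0 \<le> 1 - u + u ^ 3 / 4" using u by (simp add: field_simps)
  then have "0 \<le> u * (1 - u + u ^ 3 / 4)" using u by (rule mult_nonneg_nonneg[rotated])
  also have "\<dots> = u - u\<^sup>2 + u ^ 4 / 4" by (simp add: power2_eq_square numeral_eq_Suc algebra_simps)
  finally show ?thesis by simp
qed

text \<open>The quartic bound is averaged for the sum divided by \<open>sqrt A\<close>: the second
  moment is \<open>1\<close> and the fourth at most \<open>3\<close>, which leaves
  \<open>1 - 3/4\<close>.\<close>

lemma khintchine: "2 ^ D * sqrt (\<Sum>i<D. (a i)\<^sup>2) / 4 \<le> (\<Sum>t<2 ^ D. \<bar>rsum D a t\<bar>)"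
proof -
  define A where "A = (\<Sum>i<D. (a i)\<^sup>2)"
  have A0: "0 \<le> A" unfolding A_def by (rule sum_nonneg) simp
  show ?thesis
  proof (cases "A = 0")
    case True
    then show ?thesis by (simp add: A_def[symmetric] sum_nonneg)
  next
    case False
    then have A: "0 < A" using A0 by simp
    have "sqrt A * ((rsum D a t)\<^sup>2 / A - (rsum D a t) ^ 4 / (4 * A\<^sup>2)) \<le> \<bar>rsum D a t\<bar>" for t
    proof -
      define u where "u = \<bar>rsum D a t\<bar> / sqrt A"
      have "u\<^sup>2 = (rsum D a t)\<^sup>2 / A" using A by (simp add: u_def power_divide)
      moreover have "u ^ 4 = (u\<^sup>2)\<^sup>2" by simp
      ultimately have "u ^ 4 / 4 = (rsum D a t) ^ 4 / (4 * A\<^sup>2)" by (simp add: power_divide)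
      then have "(rsum D a t)\<^sup>2 / A - (rsum D a t) ^ 4 / (4 * A\<^sup>2) \<le> u"
        using abs_ge_quartic[of u] \<open>u\<^sup>2 = _\<close> A by (simp add: u_def)
      then have "sqrt A * ((rsum D a t)\<^sup>2 / A - (rsum D a t) ^ 4 / (4 * A\<^sup>2)) \<le> sqrt A * u"
        using A by (intro mult_left_mono) auto
      then show ?thesis using A by (simp add: u_def)
    qed
    then have "(\<Sum>t<2 ^ D. sqrt A * ((rsum D a t)\<^sup>2 / A - (rsum D a t) ^ 4 / (4 * A\<^sup>2)))
        \<le> (\<Sum>t<2 ^ D. \<bar>rsum D a t\<bar>)" by (intro sum_mono)
    moreover have "(\<Sum>t<2 ^ D. sqrt A * ((rsum D a t)\<^sup>2 / A - (rsum D a t) ^ 4 / (4 * A\<^sup>2))) =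
        sqrt A * ((\<Sum>t<2 ^ D. (rsum D a t)\<^sup>2) / A - (\<Sum>t<2 ^ D. (rsum D a t) ^ 4) / (4 * A\<^sup>2))"
      by (simp add: sum_distrib_left[symmetric] sum_subtractf sum_divide_distrib[symmetric])
    moreover have "(\<Sum>t<2 ^ D. (rsum D a t)\<^sup>2) / A = 2 ^ D" using A by (simp add: rsum_moment2 A_def)
    moreover have "(\<Sum>t<2 ^ D. (rsum D a t) ^ 4) / (4 * A\<^sup>2) \<le> 2 ^ D * (3 / 4)"
    proof -
      have "(\<Sum>t<2 ^ D. (rsum D a t) ^ 4) \<le> 2 ^ D * (3 / 4) * (4 * A\<^sup>2)"
        using rsum_moment4[of D a, folded A_def] by (simp add: mult_ac)
      then show ?thesis using A by (simp add: pos_divide_le_eq mult_ac)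
    qed
    then have "sqrt A * (2 ^ D - 2 ^ D * (3 / 4)) \<le> sqrt A * (2 ^ D - (\<Sum>t<2 ^ D. (rsum D a t) ^ 4) / (4 * A\<^sup>2))"
      using A by (intro mult_left_mono) auto
    ultimately show ?thesis by (simp add: A_def[symmetric] algebra_simps)
  qed
qed

text \<open>
  The span of \<open>D\<close> Rademacher functions in \<open>\<ell>\<^sub>\<infinity>(2^D)\<close> is \<open>\<ell>\<^sub>1(D)\<close>, and this lemma says that its
  projection constant is of order at least \<open>sqrt D\<close>.
\<close>

lemma extension_lower_bound:
  fixes r \<rho> :: "nat \<Rightarrow> nat \<Rightarrow> real"
  assumes r: "\<And>i t. \<bar>r i t\<bar> = 1" and D: "0 < D"
  obtains \<sigma> \<phi> :: "nat \<Rightarrow> real" where "\<And>i. \<bar>\<sigma> i\<bar> \<le> 1" "\<And>t. \<bar>\<phi> t\<bar> \<le> 1"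
    "\<bar>\<Sum>i<D. \<Sum>t<n. r i t * \<rho> i t\<bar> / (4 * sqrt D) \<le> (\<Sum>i<D. \<sigma> i * (\<Sum>t<n. \<rho> i t * \<phi> t))"
proof -
  define E where "E = \<bar>\<Sum>i<D. \<Sum>t<n. r i t * \<rho> i t\<bar> / (4 * sqrt D)"
  define a where "a t i = \<rho> i t" for t i
  have "(r i t)\<^sup>2 = 1" for i t using power2_abs[of "r i t"] r[of i t] by simp
  then have L2r: "L2_set (\<lambda>i. r i t) {..<D} = sqrt D" for t by (simp add: L2_set_def)
  \<comment> \<open>For each \<open>t\<close>, Cauchy-Schwarz over \<open>i\<close> replaces the
    trace by the square function, at the price of \<open>sqrt D\<close>; Khintchine converts the
    latter into averages over sign patterns \<open>u\<close>.\<close>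
  have cs: "\<bar>\<Sum>i<D. r i t * \<rho> i t\<bar> \<le> sqrt D * sqrt (\<Sum>i<D. (a t i)\<^sup>2)" for t
  proof -
    have "\<bar>\<Sum>i<D. r i t * \<rho> i t\<bar> \<le> (\<Sum>i<D. \<bar>r i t\<bar> * \<bar>\<rho> i t\<bar>)"
      using sum_abs[of "\<lambda>i. r i t * \<rho> i t" "{..<D}"] by (simp add: abs_mult)
    also have "\<dots> \<le> L2_set (\<lambda>i. r i t) {..<D} * L2_set (\<lambda>i. \<rho> i t) {..<D}" by (rule L2_set_mult_ineq)
    finally show ?thesis unfolding L2r by (simp add: L2_set_def a_def)
  qed
  have "2 ^ D * E \<le> (\<Sum>t<n. 2 ^ D * sqrt (\<Sum>i<D. (a t i)\<^sup>2) / 4)"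
  proof -
    have "\<bar>\<Sum>i<D. \<Sum>t<n. r i t * \<rho> i t\<bar> = \<bar>\<Sum>t<n. \<Sum>i<D. r i t * \<rho> i t\<bar>" by (subst sum.swap) simp
    also have "\<dots> \<le> (\<Sum>t<n. \<bar>\<Sum>i<D. r i t * \<rho> i t\<bar>)" by (rule sum_abs)
    also have "\<dots> \<le> (\<Sum>t<n. sqrt D * sqrt (\<Sum>i<D. (a t i)\<^sup>2))" by (intro sum_mono cs)
    finally have "\<bar>\<Sum>i<D. \<Sum>t<n. r i t * \<rho> i t\<bar> \<le> sqrt D * (\<Sum>t<n. sqrt (\<Sum>i<D. (a t i)\<^sup>2))"
      by (simp add: sum_distrib_left)
    then have "E \<le> (\<Sum>t<n. sqrt (\<Sum>i<D. (a t i)\<^sup>2)) / 4" using D by (simp add: E_def field_simps)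
    then have "2 ^ D * E \<le> 2 ^ D * ((\<Sum>t<n. sqrt (\<Sum>i<D. (a t i)\<^sup>2)) / 4)" by (intro mult_left_mono) auto
    then show ?thesis by (simp add: sum_distrib_left sum_divide_distrib)
  qed
  also have "\<dots> \<le> (\<Sum>t<n. \<Sum>u<2 ^ D. \<bar>rsum D (a t) u\<bar>)" by (intro sum_mono khintchine)
  also have "\<dots> = (\<Sum>u<2 ^ D. \<Sum>t<n. \<bar>rsum D (a t) u\<bar>)" by (rule sum.swap)
  finally have avg: "(\<Sum>u<(2::nat) ^ D. E) \<le> (\<Sum>u<2 ^ D. \<Sum>t<n. \<bar>rsum D (a t) u\<bar>)" by simp
  \<comment> \<open>Some sign pattern does at least as well as the average; it becomes
    \<open>\<sigma>\<close>, and \<open>\<phi>\<close> records the resulting signs in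
    \<open>t\<close>.\<close>
  have "\<exists>u. E \<le> (\<Sum>t<n. \<bar>rsum D (a t) u\<bar>)"
  proof (rule ccontr)
    assume "\<not> ?thesis"
    then have "(\<Sum>t<n. \<bar>rsum D (a t) u\<bar>) < E" for u by (meson not_le)
    then have "(\<Sum>u<2 ^ D. \<Sum>t<n. \<bar>rsum D (a t) u\<bar>) < (\<Sum>u<(2::nat) ^ D. E)"
      by (intro sum_strict_mono) (auto simp: lessThan_empty_iff)
    then show False using avg by simp
  qed
  then obtain u where u: "E \<le> (\<Sum>t<n. \<bar>rsum D (a t) u\<bar>)" by blast
  define \<phi> where "\<phi> t = sgn (rsum D (a t) u)" for t
  have "(\<Sum>t<n. \<bar>rsum D (a t) u\<bar>) = (\<Sum>t<n. \<Sum>i<D. rad i u * (\<rho> i t * \<phi> t))"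
  proof (rule sum.cong[OF refl])
    fix t
    have "\<bar>rsum D (a t) u\<bar> = rsum D (a t) u * \<phi> t" by (simp add: \<phi>_def abs_sgn)
    then show "\<bar>rsum D (a t) u\<bar> = (\<Sum>i<D. rad i u * (\<rho> i t * \<phi> t))"
      by (simp add: rsum_def a_def sum_distrib_right mult.assoc)
  qed
  also have "\<dots> = (\<Sum>i<D. rad i u * (\<Sum>t<n. \<rho> i t * \<phi> t))"
    by (subst sum.swap) (simp add: sum_distrib_left)
  finally have "E \<le> (\<Sum>i<D. rad i u * (\<Sum>t<n. \<rho> i t * \<phi> t))" using u by simp
  then show thesis
    unfolding E_def by (intro that[of "\<lambda>i. rad i u" \<phi>]) (auto simp: rad_def \<phi>_def sgn_if)
qed

text \<open>
  The weights form a product measure on sign vectors with prescribed means, which realizes a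
  functional on the Rademacher span by one of the same norm on \<open>\<ell>\<^sub>\<infinity>(2^D)\<close>.
\<close>

definition bweight :: "nat \<Rightarrow> (nat \<Rightarrow> real) \<Rightarrow> nat \<Rightarrow> real" where
  "bweight D b t = (\<Prod>i<D. (1 + b i * rad i t) / 2)"

lemma bweight_Suc: "t < 2 ^ D \<Longrightarrow> bweight (Suc D) b t = bweight D b t * ((1 + b D) / 2)"
  "t < 2 ^ D \<Longrightarrow> bweight (Suc D) b (t + 2 ^ D) = bweight D b t * ((1 - b D) / 2)"
  by (simp_all add: bweight_def rad_top rad_shift)

lemma bweight_nonneg:
  assumes "\<And>i. i < D \<Longrightarrow> \<bar>b i\<bar> \<le> 1"
  shows "0 \<le> bweight D b t"
  unfolding bweight_def
proof (rule prod_nonneg)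
  fix i assume "i \<in> {..<D}"
  then have "- 1 \<le> b i" "b i \<le> 1" using assms[of i] by (auto simp: abs_le_iff)
  then show "0 \<le> (1 + b i * rad i t) / 2" by (simp add: rad_def)
qed

lemma bweight_sum: "(\<Sum>t<2 ^ D. bweight D b t) = 1"
proof (induction D)
  case (Suc D)
  have "(\<Sum>t<2 ^ Suc D. bweight (Suc D) b t) = (\<Sum>t<2 ^ D. bweight D b t)"
    unfolding sum_power_Suc by (rule sum.cong) (auto simp: bweight_Suc field_simps)
  then show ?case by (simp add: Suc)
qed (simp add: bweight_def)

lemma bweight_mean: "i < D \<Longrightarrow> (\<Sum>t<2 ^ D. bweight D b t * rad i t) = b i"
proof (induction D)
  case (Suc D)
  show ?case
  proof (cases "i = D")
    case True
    have "(\<Sum>t<2 ^ Suc D. bweight (Suc D) b t * rad i t) = (\<Sum>t<2 ^ D. bweight D b t * b D)"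
      unfolding sum_power_Suc by (rule sum.cong) (auto simp: bweight_Suc rad_top True field_simps)
    also have "\<dots> = b i" by (simp add: sum_distrib_right[symmetric] bweight_sum True)
    finally show ?thesis .
  next
    case False
    then have i: "i < D" using Suc.prems by simp
    have "(\<Sum>t<2 ^ Suc D. bweight (Suc D) b t * rad i t) = (\<Sum>t<2 ^ D. bweight D b t * rad i t)"
      unfolding sum_power_Suc by (rule sum.cong) (auto simp: bweight_Suc rad_shift[OF i] field_simps)
    then show ?thesis using Suc.IH[OF i] by simp
  qed
qed simp

section \<open>A norming subspace\<close>

text \<open>Limits along \<open>m\<close> stand for elements of the bidual: the condition says that
  \<open>f\<close> annihilates the limit of the Rademacher combinations plus
  \<open>(1 / 2) ^ n\<close> times a basis vector of the \<open>\<ell>\<^sub>1\<close> part.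
  Membership includes existence of these limits.\<close>

definition thin :: "((nat \<Rightarrow> real) \<Rightarrow> real) set" where
  "thin = {f \<in> dvecs. \<forall>n. \<forall>i<dm n.
     (\<lambda>m. \<Sum>t<2 ^ dm n. rad i t * f (unit_vec (idx (off n + dm n + t) m)))
       \<longlonglongrightarrow> - ((1 / 2) ^ n) * f (unit_vec (idx (off n + i) 0))}"

lemma thin_subspace: "subspace thin"
proof (rule subspaceI)
  show "0 \<in> thin" by (simp add: thin_def subspace_0[OF nspace_subspace[OF normed_DJ]])
next
  fix f g assume fg: "f \<in> thin" "g \<in> thin"
  show "f + g \<in> thin"
    unfolding thin_def
  proof (intro CollectI conjI allI impI)
    show "f + g \<in> dvecs" using fg by (auto simp: thin_def intro: subspace_add[OF nspace_subspace[OF normed_DJ]])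
    fix n i assume "i < dm n"
    then have "(\<lambda>m. (\<Sum>t<2 ^ dm n. rad i t * f (unit_vec (idx (off n + dm n + t) m))) +
        (\<Sum>t<2 ^ dm n. rad i t * g (unit_vec (idx (off n + dm n + t) m))))
       \<longlonglongrightarrow> - ((1 / 2) ^ n) * f (unit_vec (idx (off n + i) 0)) + - ((1 / 2) ^ n) * g (unit_vec (idx (off n + i) 0))"
      using fg by (intro tendsto_add) (auto simp: thin_def)
    then show "(\<lambda>m. \<Sum>t<2 ^ dm n. rad i t * (f + g) (unit_vec (idx (off n + dm n + t) m)))
       \<longlonglongrightarrow> - ((1 / 2) ^ n) * (f + g) (unit_vec (idx (off n + i) 0))"
      by (simp add: algebra_simps sum.distrib)
  qed
next
  fix c f assume f: "f \<in> thin"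
  show "c *\<^sub>R f \<in> thin"
    unfolding thin_def
  proof (intro CollectI conjI allI impI)
    show "c *\<^sub>R f \<in> dvecs" using f by (auto simp: thin_def intro: subspace_scale[OF nspace_subspace[OF normed_DJ]])
    fix n i assume "i < dm n"
    then have "(\<lambda>m. c * (\<Sum>t<2 ^ dm n. rad i t * f (unit_vec (idx (off n + dm n + t) m))))
       \<longlonglongrightarrow> c * (- ((1 / 2) ^ n) * f (unit_vec (idx (off n + i) 0)))"
      using f by (intro tendsto_mult tendsto_const) (auto simp: thin_def)
    then show "(\<lambda>m. \<Sum>t<2 ^ dm n. rad i t * (c *\<^sub>R f) (unit_vec (idx (off n + dm n + t) m)))
       \<longlonglongrightarrow> - ((1 / 2) ^ n) * (c *\<^sub>R f) (unit_vec (idx (off n + i) 0))"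
      by (simp add: sum_distrib_left mult.left_commute)
  qed
qed

lemma jnorm_unit_vec: "jnorm (unit_vec k) \<le> 1"
proof -
  have "unit_vec k = head (Suc k) (unit_vec k)" by (auto simp: head_def unit_vec_def fun_eq_iff)
  moreover have "(\<Sum>i<Suc k. \<bar>unit_vec k i\<bar>) = (\<Sum>i<Suc k. if i = k then 1 else 0)"
    by (rule sum.cong) (auto simp: unit_vec_def)
  ultimately show ?thesis using jnorm_head_le_sum[of "Suc k" "unit_vec k"] by simp
qed

lemma sum_off:
  fixes h :: "nat \<Rightarrow> real"
  shows "(\<Sum>c<off K. h c) = (\<Sum>n<K. (\<Sum>i<dm n. h (off n + i)) + (\<Sum>t<2 ^ dm n. h (off n + dm n + t)))"
proof (induction K)
  case (Suc K)
  have "(\<Sum>t<n + m. h t) = (\<Sum>t<n. h t) + (\<Sum>t<m. h (n + t))" for n m :: nat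
    by (induction m) auto
  then show ?case unfolding off_Suc by (simp add: Suc)
qed (simp add: off_def)

definition grp :: "nat \<Rightarrow> nat" where "grp c = (THE n. off n \<le> c \<and> c < off (Suc n))"

lemma grp_eq: "off n \<le> c \<Longrightarrow> c < off (Suc n) \<Longrightarrow> grp c = n"
  unfolding grp_def using group_unique by (intro the_equality) blast+

text \<open>
  A functional with finitely many coefficients is corrected far out, by a functional depending on
  labels only, so that it satisfies the relations
  defining \<open>thin\<close>.
\<close>

lemma thin_correction:
  assumes f: "f \<in> dvecs" "dnorm f \<le> 1"
    and supp: "\<And>i. N \<le> i \<Longrightarrow> f (unit_vec i) = 0"
  obtains h where "f + h \<in> thin" "h \<in> dvecs" "dnorm h \<le> 2"
    "\<And>i. i < N \<Longrightarrow> h (unit_vec i) = 0"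
proof -
  define b where "b n i = f (unit_vec (idx (off n + i) 0))" for n i
  define wt where "wt n t = bweight (dm n) (b n) t" for n t
  \<comment> \<open>On the \<open>\<ell>\<^sub>\<infinity>\<close> part of each group sits a
    probability weight whose Rademacher means are the values \<open>b n i\<close> of
    \<open>f\<close>, with the factor prescribed by \<open>thin\<close>. Each group thus has total
    mass \<open>(1 / 2) ^ n\<close>, and the masses sum to at most \<open>2\<close>.\<close>
  define \<beta> where "\<beta> c = (let n = grp c in if off n + dm n \<le> c then - ((1 / 2) ^ n) * wt n (c - (off n + dm n)) else 0)" for c
  have b1: "\<bar>b n i\<bar> \<le> 1" for n i
  proof -
    have "\<bar>b n i\<bar> \<le> dnorm f * jnorm (unit_vec (idx (off n + i) 0))"
      unfolding b_def by (rule dual_abs_le[OF normed_J f(1) unit_vec_in_jvecs])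
    also have "\<dots> \<le> 1 * 1"
      using f(2) jnorm_unit_vec by (intro mult_mono jnorm_nonneg unit_vec_in_jvecs) auto
    finally show ?thesis by simp
  qed
  have wt0: "0 \<le> wt n t" for n t unfolding wt_def by (rule bweight_nonneg[OF b1])
  have \<beta>_sum: "\<beta> (off n + i) = 0" if "i < dm n" for n i
    using grp_eq[of n "off n + i"] that by (simp add: \<beta>_def off_Suc)
  have \<beta>_max: "\<beta> (off n + dm n + t) = - ((1 / 2) ^ n) * wt n t" if "t < 2 ^ dm n" for n t
    using grp_eq[of n "off n + dm n + t"] that by (simp add: \<beta>_def off_Suc)
  have \<beta>: "wdual 2 \<beta>"
    unfolding wdual_def
  proof (intro conjI allI)
    fix K w
    have "\<bar>\<Sum>c<off K. \<beta> c * w c\<bar> = \<bar>\<Sum>n<K. \<Sum>t<2 ^ dm n. \<beta> (off n + dm n + t) * w (off n + dm n + t)\<bar>"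
      unfolding sum_off by (simp add: \<beta>_sum)
    also have "\<dots> \<le> (\<Sum>n<K. \<bar>\<Sum>t<2 ^ dm n. \<beta> (off n + dm n + t) * w (off n + dm n + t)\<bar>)" by (rule sum_abs)
    also have "\<dots> \<le> (\<Sum>n<K. (1 / 2) ^ n * wnorm K w)"
    proof (rule sum_mono)
      fix n assume n: "n \<in> {..<K}"
      have "\<bar>\<Sum>t<2 ^ dm n. \<beta> (off n + dm n + t) * w (off n + dm n + t)\<bar>
          \<le> (\<Sum>t<2 ^ dm n. \<bar>\<beta> (off n + dm n + t) * w (off n + dm n + t)\<bar>)" by (rule sum_abs)
      also have "\<dots> \<le> (\<Sum>t<2 ^ dm n. ((1 / 2) ^ n * wnorm K w) * wt n t)"
      proof (rule sum_mono)
        fix t :: nat assume t: "t \<in> {..<2 ^ dm n}"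
        have "\<bar>w (off n + dm n + t)\<bar> \<le> wnorm K w"
          using max_le_gnorm[of t n w] gnorm_le_wnorm[of n K w] t n by simp
        then have "((1 / 2) ^ n * wt n t) * \<bar>w (off n + dm n + t)\<bar> \<le> ((1 / 2) ^ n * wt n t) * wnorm K w"
          using wt0 by (intro mult_left_mono) auto
        then show "\<bar>\<beta> (off n + dm n + t) * w (off n + dm n + t)\<bar> \<le> ((1 / 2) ^ n * wnorm K w) * wt n t"
          using t wt0[of n t] by (simp add: \<beta>_max abs_mult mult_ac)
      qed
      also have "\<dots> = (1 / 2) ^ n * wnorm K w"
        by (simp add: sum_distrib_left[symmetric] wt_def bweight_sum)
      finally show "\<bar>\<Sum>t<2 ^ dm n. \<beta> (off n + dm n + t) * w (off n + dm n + t)\<bar> \<le> (1 / 2) ^ n * wnorm K w" .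
    qed
    also have "\<dots> = (\<Sum>n<K. (1 / 2) ^ n) * wnorm K w" by (simp add: sum_distrib_right)
    also have "\<dots> \<le> 2 * wnorm K w"
      by (intro mult_right_mono wnorm_nonneg) (simp add: geometric_sum)
    finally show "\<bar>\<Sum>c<off K. \<beta> c * w c\<bar> \<le> 2 * wnorm K w" .
  qed simp
  define h where "h = seqfun (labtail N \<beta>)"
  note hD = seqfun_dual[OF wdual_coef_bound[OF \<beta>, of N], folded h_def]
  have hu: "h (unit_vec i) = (if N \<le> i then \<beta> (lab i) else 0)" for i
    by (simp add: h_def seqfun_unit labtail_def)
  have "f + h \<in> thin"
    unfolding thin_def
  proof (intro CollectI conjI allI impI)
    show "f + h \<in> dvecs" by (intro subspace_add nspace_subspace[OF normed_DJ] f(1) hD(1))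
    fix n i assume i: "i < dm n"
    \<comment> \<open>For \<open>m \<ge> N\<close> the indices lie beyond the support of
      \<open>f\<close>, so only \<open>h\<close> contributes and the relation holds exactly, not
      merely in the limit.\<close>
    have "(\<Sum>t<2 ^ dm n. rad i t * (f + h) (unit_vec (idx (off n + dm n + t) m)))
        = - ((1 / 2) ^ n) * (f + h) (unit_vec (idx (off n + i) 0))" if m: "N \<le> m" for m
    proof -
      have N: "N \<le> idx c m" for c using m idx_ge[of m c] by simp
      have "(\<Sum>t<2 ^ dm n. rad i t * (f + h) (unit_vec (idx (off n + dm n + t) m)))
          = (\<Sum>t<2 ^ dm n. - ((1 / 2) ^ n) * (bweight (dm n) (b n) t * rad i t))"
        using N by (intro sum.cong) (auto simp: supp hu \<beta>_max wt_def)
      also have "\<dots> = - ((1 / 2) ^ n) * b n i"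
        unfolding sum_distrib_left[symmetric] bweight_mean[OF i] ..
      \<comment> \<open>The right-hand side still equals its value for \<open>f\<close>, because
        \<open>\<beta>\<close> vanishes on the labels of the \<open>\<ell>\<^sub>1\<close>
        part.\<close>
      finally show ?thesis using i by (simp add: b_def hu \<beta>_sum)
    qed
    then show "(\<lambda>m. \<Sum>t<2 ^ dm n. rad i t * (f + h) (unit_vec (idx (off n + dm n + t) m)))
        \<longlonglongrightarrow> - ((1 / 2) ^ n) * (f + h) (unit_vec (idx (off n + i) 0))"
      by (intro tendsto_eventually eventually_sequentiallyI[of N])
  qed
  then show thesis using that[of h] hD hu by simp
qed

text \<open>A functional norming a head is corrected without changing it on that head, at total norm
  \<open>1 + 2\<close>. A tail of norm below \<open>1/16\<close> of \<open>jnorm x\<close> costs at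
  most \<open>1/16 + 3/16\<close> of it, which leaves \<open>3/4\<close>; division by
  \<open>3\<close> gives the constant.\<close>

lemma norming_thin: "norming jspace thin"
  unfolding norming_def
proof (intro exI[of _ "1/4"] conjI ballI)
  fix x assume x: "x \<in> jvecs"
  show "ennreal (1 / 4 * jnorm x) \<le> (SUP f\<in>thin - {0}. ennreal (\<bar>f x\<bar> / dnorm f))"
  proof (cases "x = 0")
    case True
    then show ?thesis by (simp only: jnorm_0) simp
  next
    case False
    then have pos: "0 < jnorm x" using nspace_eq_0[OF normed_J x] jnorm_nonneg[OF x] by simp
    obtain N where N: "jnorm (tail N x) < jnorm x / 16"
      using order_tendstoD(2)[OF tail_tendsto_0[OF x], of "jnorm x / 16"] pos
      by (auto simp: eventually_sequentially)
    obtain f where f: "f \<in> dvecs" "dnorm f \<le> 1"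
      "f (head N x) = jnorm (head N x)" "\<And>i. N \<le> i \<Longrightarrow> f (unit_vec i) = 0"
      using norming_functional by blast
    obtain h where h: "f + h \<in> thin" "h \<in> dvecs" "dnorm h \<le> 2"
      "\<And>i. i < N \<Longrightarrow> h (unit_vec i) = 0" using thin_correction[OF f(1,2,4)] by blast
    have tJ: "tail N x \<in> jvecs" by (rule tail_in_jvecs[OF x])
    have fh: "f + h \<in> dvecs" by (intro subspace_add nspace_subspace[OF normed_DJ] f(1) h(2))
    have n3: "dnorm (f + h) \<le> 3" using nspace_add[OF normed_DJ f(1) h(2)] f(2) h(3) by linarith
    have "h (head N x) = 0" unfolding dual_head[OF h(2)] by (intro sum.neutral) (simp add: h(4))
    then have "(f + h) (head N x) = jnorm (head N x)" using f(3) by simp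
    moreover have "(f + h) x = (f + h) (head N x) + (f + h) (tail N x)"
      using dual_add[OF fh head_in_jvecs tJ, of N x] by (simp only: head_plus_tail)
    moreover have "\<bar>(f + h) (tail N x)\<bar> \<le> 3 * jnorm (tail N x)"
      using dual_abs_le[OF normed_J fh tJ] mult_right_mono[OF n3 jnorm_nonneg[OF tJ]] by linarith
    moreover have "jnorm x \<le> jnorm (head N x) + jnorm (tail N x)"
      using jnorm_add[OF head_in_jvecs tJ, of N x] by (simp only: head_plus_tail)
    ultimately have big: "3 / 4 * jnorm x \<le> \<bar>(f + h) x\<bar>" using N by linarith
    then have ne: "f + h \<noteq> 0" using pos by (metis abs_zero less_le_not_le mult_pos_pos zero_fun_apply zero_less_divide_iff zero_less_numeral)
    then have nfh: "0 < dnorm (f + h)"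
      using nspace_eq_0[OF normed_DJ fh] dual_norm_nonneg[OF fh] by (simp add: order_less_le)
    have "1 / 4 * jnorm x * dnorm (f + h) \<le> 1 / 4 * jnorm x * 3"
      using pos by (intro mult_left_mono n3) auto
    then have "1 / 4 * jnorm x \<le> \<bar>(f + h) x\<bar> / dnorm (f + h)"
      using big nfh by (simp add: pos_le_divide_eq)
    then show ?thesis
      using h(1) ne by (intro SUP_upper2[of "f + h"] ennreal_leI) auto
  qed
qed simp

section \<open>Failure of the total property of bounded approximation\<close>

text \<open>Banach-Steinhaus through Baire: one of the closed sets of vectors with all images
  bounded by \<open>n\<close> contains a ball.\<close>

lemma uniform_boundedness:
  assumes v: "\<And>l. bounded_op jspace jspace (v l)"
    and bdd: "\<And>x. x \<in> jvecs \<Longrightarrow> \<exists>C. \<forall>l. jnorm (v l x) \<le> C"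
  obtains C where "1 \<le> C" "\<And>l x. x \<in> jvecs \<Longrightarrow> jnorm (v l x) \<le> C * jnorm x"
proof -
  interpret Metric_space jvecs "ndist jspace" by (rule Metric_space_ndist[OF normed_J])
  have vJ: "v l x \<in> jvecs" if "x \<in> jvecs" for l x using v[of l] that by (auto simp: bounded_op_def)
  have vadd: "v l (x + y) = v l x + v l y" if "x \<in> jvecs" "y \<in> jvecs" for l x y
    using v[of l] that by (auto simp: bounded_op_def)
  have vscale: "v l (c *\<^sub>R x) = c *\<^sub>R v l x" if "x \<in> jvecs" for l c x
    using v[of l] that by (auto simp: bounded_op_def)
  have vK: "\<exists>K\<ge>0. \<forall>x\<in>jvecs. jnorm (v l x) \<le> K * jnorm x" for l
  proof -
    obtain K where K: "\<forall>x\<in>jvecs. jnorm (v l x) \<le> K * jnorm x" using v[of l] by (auto simp: bounded_op_def)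
    have "jnorm (v l x) \<le> max K 0 * jnorm x" if "x \<in> jvecs" for x
      using bspec[OF K that] mult_right_mono[OF max.cobounded1 jnorm_nonneg[OF that], of K 0] by linarith
    then show ?thesis by (intro exI[of _ "max K 0"]) auto
  qed
  define E where "E n = {x \<in> jvecs. \<forall>l. jnorm (v l x) \<le> real n}" for n :: nat
  have closed: "closedin mtopology (E n)" for n
    unfolding closedin_metric
  proof (intro conjI allI impI)
    show "E n \<subseteq> jvecs" by (auto simp: E_def)
    fix x assume "x \<in> jvecs - E n"
    then obtain l where x: "x \<in> jvecs" and l: "real n < jnorm (v l x)" by (auto simp: E_def not_le)
    obtain K where K: "0 \<le> K" "\<forall>x\<in>jvecs. jnorm (v l x) \<le> K * jnorm x" using vK by blast
    define r where "r = (jnorm (v l x) - real n) / (K + 1)"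
    have r: "0 < r" using l K by (simp add: r_def)
    have False if y: "y \<in> E n" "y \<in> mball x r" for y
    proof -
      have yJ: "y \<in> jvecs" and yn: "jnorm (v l y) \<le> real n" and d: "jnorm (x - y) < r"
        using y x by (auto simp: E_def mball_def ndist_def)
      have dJ: "x - y \<in> jvecs" by (intro subspace_diff jvecs_subspace x yJ)
      have "v l x = v l (x - y) + v l y" using vadd[OF dJ yJ, of l] by simp
      then have "jnorm (v l x) \<le> jnorm (v l (x - y)) + jnorm (v l y)"
        using jnorm_add[OF vJ[OF dJ] vJ[OF yJ]] by metis
      also have "\<dots> \<le> K * jnorm (x - y) + real n" using K(2) dJ yn by (intro add_mono) auto
      also have "K * jnorm (x - y) \<le> K * r" using K(1) d by (intro mult_left_mono) auto
      also have "K * r < (K + 1) * r" using r by simp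
      also have "(K + 1) * r = jnorm (v l x) - real n" using K(1) by (simp add: r_def)
      finally show False by simp
    qed
    then show "\<exists>r>0. disjnt (E n) (mball x r)" using r by (auto simp: disjnt_iff)
  qed
  have union: "\<Union> (range E) = jvecs"
  proof (intro equalityI subsetI)
    fix x assume x: "x \<in> jvecs"
    obtain C where C: "\<forall>l. jnorm (v l x) \<le> C" using bdd[OF x] by blast
    obtain n :: nat where "C \<le> real n" using real_arch_simple by blast
    then have "x \<in> E n" using C x order_trans unfolding E_def by blast
    then show "x \<in> \<Union> (range E)" by blast
  qed (auto simp: E_def)
  have "\<exists>n. mtopology interior_of (E n) \<noteq> {}"
  proof (rule ccontr)
    assume "\<not> ?thesis"
    then have "mtopology interior_of (\<Union> (range E)) = {}"
      using closed banach_space_jspace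
      by (intro metric_Baire_category_alt) (auto simp: banach_space_def)
    then show False
      unfolding union using jvecs_0 interior_of_topspace[of mtopology] by auto
  qed
  then obtain n x0 where "x0 \<in> mtopology interior_of (E n)" by blast
  then obtain r where r: "0 < r" "mball x0 r \<subseteq> E n" and x0: "x0 \<in> jvecs"
    by (auto simp: metric_interior_of)
  \<comment> \<open>For a displacement of length \<open>r / 2\<close> from \<open>x0\<close>, the
    image has norm at most \<open>2 * n\<close>, so homogeneity gives the factor
    \<open>4 * n / r\<close>.\<close>
  define C where "C = max 1 (4 * real n / r)"
  have "jnorm (v l x) \<le> C * jnorm x" if x: "x \<in> jvecs" for l x
  proof (cases "x = 0")
    case True
    have "v l 0 = 0" using vscale[OF jvecs_0, of l 0] by simp
    then show ?thesis unfolding True by (simp only: jnorm_0)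
  next
    case False
    then have pos: "0 < jnorm x" using nspace_eq_0[OF normed_J x] jnorm_nonneg[OF x] by simp
    define c where "c = r / (2 * jnorm x)"
    have c: "0 < c" using r pos by (simp add: c_def)
    have cJ: "c *\<^sub>R x \<in> jvecs" by (rule jvecs_scale[OF x])
    have yJ: "x0 + c *\<^sub>R x \<in> jvecs" by (rule jvecs_add[OF x0 cJ])
    have "x0 - (x0 + c *\<^sub>R x) = (- c) *\<^sub>R x" by simp
    then have "jnorm (x0 - (x0 + c *\<^sub>R x)) = c * jnorm x" using jnorm_scale[OF x, of "- c"] c by simp
    also have "\<dots> < r" using r pos by (simp add: c_def)
    finally have "x0 + c *\<^sub>R x \<in> mball x0 r" using x0 yJ by (simp add: mball_def ndist_def)
    moreover have "x0 \<in> mball x0 r" using x0 r by simp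
    ultimately have b: "jnorm (v l (x0 + c *\<^sub>R x)) \<le> real n" "jnorm (v l x0) \<le> real n"
      using r(2) by (auto simp: E_def)
    have "c * jnorm (v l x) = jnorm (v l (c *\<^sub>R x))"
      using c by (simp add: vscale[OF x] jnorm_scale[OF vJ[OF x]])
    also have "\<dots> \<le> jnorm (v l (x0 + c *\<^sub>R x)) + jnorm (v l x0)"
      using nspace_triangle_minus[OF normed_J vJ[OF cJ, of l] vJ[OF x0, of l]]
      by (simp add: vadd[OF x0 cJ] add.commute)
    also have "\<dots> \<le> 2 * real n" using b by simp
    finally have "jnorm (v l x) \<le> 2 * real n / c" using c by (simp add: pos_le_divide_eq mult.commute)
    also have "\<dots> = 4 * real n / r * jnorm x" using r pos by (simp add: c_def)
    also have "\<dots> \<le> C * jnorm x" by (intro mult_right_mono) (use pos in \<open>auto simp: C_def\<close>)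
    finally show ?thesis .
  qed
  then show thesis by (intro that[of C]) (auto simp: C_def)
qed

text \<open>The \<open>\<ell>\<^sub>\<infinity>\<close> part makes every vector of signs a
  legitimate test vector, whatever its length.\<close>

lemma wnorm_max_block:
  assumes \<phi>: "\<And>t. \<bar>\<phi> t\<bar> \<le> 1"
  shows "wnorm K (\<Sum>t<2 ^ dm n. \<phi> t *\<^sub>R unit_vec (off n + dm n + t)) \<le> 1"
proof -
  define w where "w = (\<Sum>t<2 ^ dm n. \<phi> t *\<^sub>R unit_vec (off n + dm n + t))"
  have w_at: "w c = (\<Sum>t<2 ^ dm n. if c = off n + dm n + t then \<phi> t else 0)" for c
    unfolding w_def sum_fun_apply by (rule sum.cong) (auto simp: unit_vec_def)
  have w_max: "w (off n + dm n + t) = \<phi> t" if "t < 2 ^ dm n" for t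
    unfolding w_at using that by simp
  have w0: "w c = 0" if "c < off n + dm n \<or> off (Suc n) \<le> c" for c
    unfolding w_at using that by (intro sum.neutral) (auto simp: off_Suc)
  have "gnorm m w = 0" if "m \<noteq> n" for m
  proof (rule gnorm_eq_0)
    fix c assume "off m \<le> c" "c < off (Suc m)"
    then have "\<not> (off n \<le> c \<and> c < off (Suc n))" using group_unique that by blast
    then show "w c = 0" by (intro w0) auto
  qed
  moreover have "gnorm n w \<le> 1"
  proof -
    have "Max ((\<lambda>t. \<bar>w (off n + dm n + t)\<bar>) ` {..<2 ^ dm n}) \<le> 1"
      by (rule Max.boundedI, simp, simp add: lessThan_empty_iff) (auto simp: w_max \<phi>)
    moreover have "(\<Sum>i<dm n. \<bar>w (off n + i)\<bar>) = 0" by (intro sum.neutral) (simp add: w0)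
    ultimately show ?thesis by (simp add: gnorm_def)
  qed
  ultimately have "gnorm m w ^ 4 \<le> (if m = n then 1 else 0)" for m
    using gnorm_nonneg[of n w] by (auto intro: power_le_one)
  then have "wnorm K w ^ 4 \<le> (\<Sum>m<K. if m = n then 1 else 0)"
    unfolding wnorm_power4 by (intro sum_mono)
  also have "\<dots> \<le> 1 ^ 4" by simp
  finally show ?thesis unfolding w_def by (rule power4_le_imp_le) simp
qed

text \<open>The matching statement for functionals: the dual of the \<open>\<ell>\<^sub>1\<close>
  part has a maximum norm, so all sign combinations of its coordinates have norm at most
  one.\<close>

lemma wdual_signs:
  assumes \<sigma>: "\<And>i. \<bar>\<sigma> i\<bar> \<le> 1"
  shows "wdual 1 (\<Sum>i<dm n. \<sigma> i *\<^sub>R unit_vec (off n + i))"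
  unfolding wdual_def
proof (intro conjI allI)
  define \<beta> where "\<beta> = (\<Sum>i<dm n. \<sigma> i *\<^sub>R unit_vec (off n + i))"
  have \<beta>_at: "\<beta> c = (\<Sum>i<dm n. if c = off n + i then \<sigma> i else 0)" for c
    unfolding \<beta>_def sum_fun_apply by (rule sum.cong) (auto simp: unit_vec_def)
  fix K w
  have "(\<Sum>c<off K. \<beta> c * w c) = (\<Sum>i<dm n. \<Sum>c<off K. if c = off n + i then \<sigma> i * w c else 0)"
    unfolding \<beta>_at sum_distrib_right by (subst sum.swap) (intro sum.cong refl, simp)
  also have "\<dots> = (\<Sum>i<dm n. if off n + i < off K then \<sigma> i * w (off n + i) else 0)"
    by (intro sum.cong) auto
  finally have eq: "(\<Sum>c<off K. \<beta> c * w c) = (\<Sum>i<dm n. if off n + i < off K then \<sigma> i * w (off n + i) else 0)" .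
  show "\<bar>\<Sum>c<off K. (\<Sum>i<dm n. \<sigma> i *\<^sub>R unit_vec (off n + i)) c * w c\<bar> \<le> 1 * wnorm K w"
    unfolding \<beta>_def[symmetric] eq
  proof (cases "n < K")
    case True
    have "\<bar>\<Sum>i<dm n. if off n + i < off K then \<sigma> i * w (off n + i) else 0\<bar> \<le> (\<Sum>i<dm n. \<bar>w (off n + i)\<bar>)"
    proof (rule order_trans[OF sum_abs sum_mono])
      fix i
      show "\<bar>if off n + i < off K then \<sigma> i * w (off n + i) else 0\<bar> \<le> \<bar>w (off n + i)\<bar>"
        using mult_right_mono[OF \<sigma>[of i], of "\<bar>w (off n + i)\<bar>"] by (simp add: abs_mult)
    qed
    also have "\<dots> \<le> gnorm n w" by (rule sum_le_gnorm)
    also have "\<dots> \<le> 1 * wnorm K w" using gnorm_le_wnorm[OF True] by simp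
    finally show "\<bar>\<Sum>i<dm n. if off n + i < off K then \<sigma> i * w (off n + i) else 0\<bar> \<le> 1 * wnorm K w" .
  next
    case False
    then have "\<not> off n + i < off K" for i using off_mono[of K n] by simp
    then show "\<bar>\<Sum>i<dm n. if off n + i < off K then \<sigma> i * w (off n + i) else 0\<bar> \<le> 1 * wnorm K w"
      by (simp add: wnorm_nonneg)
  qed
qed simp

text \<open>
  On vectors spread out to infinity, operators with adjoints mapping into \<open>thin\<close> extend, up to
  the factor \<open>- 2^(-n)\<close>, the map from the Rademacher span to the \<open>\<ell>\<^sub>1\<close> part of the group, and their
  norms are at least of order \<open>2^(-n) * sqrt (dm n) = 2^n\<close>.
\<close>

lemma not_quasibasic_thin: "\<not> quasibasic jspace thin"
proof
  assume "quasibasic jspace thin"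
  then obtain v where v: "\<And>l. bounded_op jspace jspace (v l)"
    and conv: "\<And>x. x \<in> jvecs \<Longrightarrow> (\<lambda>l. jnorm (v l x - x)) \<longlonglongrightarrow> 0"
    and adj: "\<And>l. adjoint_op jspace (v l) ` dvecs \<subseteq> thin"
    unfolding quasibasic_def by blast
  have vJ: "v l x \<in> jvecs" if "x \<in> jvecs" for l x using v[of l] that by (auto simp: bounded_op_def)
  obtain C where C: "1 \<le> C" "\<And>l x. x \<in> jvecs \<Longrightarrow> jnorm (v l x) \<le> C * jnorm x"
  proof (rule uniform_boundedness[OF v])
    fix x assume x: "x \<in> jvecs"
    obtain B where B: "\<And>l. \<bar>jnorm (v l x - x)\<bar> \<le> B"
      using convergent_imp_Bseq[OF convergentI[OF conv[OF x]]] unfolding Bseq_def by auto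
    have "jnorm (v l x) \<le> B + jnorm x" for l
    proof -
      have "jnorm ((v l x - x) + x) \<le> jnorm (v l x - x) + jnorm x"
        by (intro jnorm_add subspace_diff jvecs_subspace vJ x)
      then show ?thesis using abs_le_D1[OF B[of l]] by simp
    qed
    then show "\<exists>C. \<forall>l. jnorm (v l x) \<le> C" by blast
  qed blast
  \<comment> \<open>\<open>32 = 16 * 2\<close>: the extension bound loses \<open>4 * 4\<close>, and
    the test vector has norm at most twice the number \<open>R\<close> of blocks.\<close>
  obtain n :: nat where n: "32 * C < 2 ^ n" using real_arch_pow[of 2 "32 * C"] by auto
  define D where "D = dm n"
  define N :: nat where "N = 2 ^ D"
  define \<epsilon> :: real where "\<epsilon> = (1 / 2) ^ n"
  have \<epsilon>: "0 < \<epsilon>" by (simp add: \<epsilon>_def)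
  have D: "0 < D" by (simp add: D_def dm_def)
  have N: "0 < N" by (simp add: N_def)
  have sD: "sqrt D * \<epsilon> = 2 ^ n"
  proof -
    have "sqrt D = sqrt ((4 ^ n)\<^sup>2)" by (simp add: D_def dm_def power_mult_distrib[symmetric] power2_eq_square)
    also have "\<dots> = 4 ^ n" by (rule real_sqrt_unique[symmetric, THEN sym]) auto
    finally show ?thesis by (simp add: \<epsilon>_def power_mult_distrib[symmetric])
  qed
  define e where "e i = unit_vec (idx (off n + i) 0)" for i
  define u where "u t m = unit_vec (idx (off n + D + t) m)" for t m
  have eJ: "e i \<in> jvecs" and uJ: "u t m \<in> jvecs" for i t m by (simp_all add: e_def u_def unit_vec_in_jvecs)
  have "\<forall>\<^sub>F l in sequentially. \<forall>i\<in>{..<D}. jnorm (v l (e i) - e i) < 1 / 2"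
    by (intro eventually_ball_finite finite_lessThan ballI order_tendstoD(2)[OF conv[OF eJ]]) simp
  then obtain l where l: "\<And>i. i < D \<Longrightarrow> jnorm (v l (e i) - e i) < 1 / 2"
    by (auto simp: eventually_sequentially)
  define q where "q i = labfun (unit_vec (off n + i))" for i
  have qD: "q i \<in> dvecs" and q1: "dnorm (q i) \<le> 1" for i
    unfolding q_def by (rule labfun_dual[OF wdual_unit])+
  \<comment> \<open>\<open>G i\<close> reads coordinate \<open>off n + i\<close> of the label image
    of \<open>v l x\<close>. Lying in \<open>thin\<close>, it has far Rademacher combinations tied
    to its value at \<open>e i\<close>, which is at least \<open>1 / 2\<close>.\<close>
  define G where "G i = adjoint_op jspace (v l) (q i)" for i
  have Gthin: "G i \<in> thin" for i using adj[of l] qD by (auto simp: G_def)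
  then have GD: "G i \<in> dvecs" for i by (auto simp: thin_def)
  have G: "G i x = q i (v l x)" if "x \<in> jvecs" for i x using that by (simp add: G_def adjoint_op_def)
  have Ge: "1 / 2 \<le> G i (e i)" if i: "i < D" for i
  proof -
    have dJ: "v l (e i) - e i \<in> jvecs" by (intro subspace_diff jvecs_subspace vJ eJ)
    have "\<bar>q i (v l (e i) - e i)\<bar> \<le> dnorm (q i) * jnorm (v l (e i) - e i)"
      by (rule dual_abs_le[OF normed_J qD dJ])
    also have "\<dots> \<le> 1 * jnorm (v l (e i) - e i)" by (intro mult_right_mono q1 jnorm_nonneg dJ)
    finally have "\<bar>q i (v l (e i)) - q i (e i)\<bar> \<le> 1 / 2"
      using l[OF i] by (simp add: dual_diff[OF normed_J qD vJ[OF eJ] eJ])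
    moreover have "q i (e i) = 1" by (simp add: q_def e_def labfun_unit) (simp add: unit_vec_def)
    ultimately show ?thesis unfolding G[OF eJ] by linarith
  qed
  have "\<forall>\<^sub>F m in sequentially. \<forall>i\<in>{..<D}. (\<Sum>t<N. rad i t * G i (u t m)) < - (\<epsilon> / 4)"
  proof (intro eventually_ball_finite finite_lessThan ballI)
    fix i assume i: "i \<in> {..<D}"
    then have "(\<lambda>m. \<Sum>t<N. rad i t * G i (u t m)) \<longlonglongrightarrow> - \<epsilon> * G i (e i)"
      using Gthin[of i] unfolding thin_def D_def N_def \<epsilon>_def u_def e_def by auto
    moreover have "\<epsilon> * (1 / 2) \<le> \<epsilon> * G i (e i)" using Ge i \<epsilon> by (intro mult_left_mono) auto
    then have "- \<epsilon> * G i (e i) < - (\<epsilon> / 4)" using \<epsilon> by simp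
    ultimately show "\<forall>\<^sub>F m in sequentially. (\<Sum>t<N. rad i t * G i (u t m)) < - (\<epsilon> / 4)"
      by (rule order_tendstoD(2))
  qed
  then obtain m0 where m0: "\<And>m i. m0 \<le> m \<Longrightarrow> i < D \<Longrightarrow> (\<Sum>t<N. rad i t * G i (u t m)) < - (\<epsilon> / 4)"
    by (auto simp: eventually_sequentially)
  \<comment> \<open>Block \<open>s\<close> occupies indices from \<open>L s\<close> up to
    \<open>L (Suc s)\<close>; taking \<open>m s \<ge> m0\<close> keeps the bound \<open>m0\<close>
    available in every block.\<close>
  define L where "L s = ((\<lambda>k. Suc (\<Sum>t<N. idx (off n + D + t) (max m0 k))) ^^ s) 0" for s
  define m where "m s = max m0 (L s)" for s
  have LSuc: "L (Suc s) = Suc (\<Sum>t<N. idx (off n + D + t) (m s))" for s by (simp add: L_def m_def)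
  have idx_lo: "L s \<le> idx (off n + D + t) (m s)" for s t
    using idx_ge[of "m s" "off n + D + t"] by (simp add: m_def)
  have idx_hi: "idx (off n + D + t) (m s) < L (Suc s)" if "t < N" for s t
    unfolding LSuc using member_le_sum[of t "{..<N}" "\<lambda>t. idx (off n + D + t) (m s)"] that by simp
  have L: "mono L"
    unfolding incseq_Suc_iff using idx_lo idx_hi[OF N] by (meson le_less_trans less_imp_le)
  \<comment> \<open>With this many blocks the error \<open>2 * N * sqrt R\<close> in
    \<open>jnorm_sum_le\<close> equals the main term \<open>R\<close>.\<close>
  define R :: nat where "R = (2 * N)\<^sup>2"
  have R: "0 < R" "sqrt R = 2 * real N" using N by (simp_all add: R_def real_sqrt_mult)
  \<comment> \<open>The blocks are summed before the extension bound is applied, so that a single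
    pair \<open>\<sigma>\<close>, \<open>\<phi>\<close> serves all of them.\<close>
  define \<rho> where "\<rho> i t = (\<Sum>s<R. G i (u t (m s)))" for i t
  have rho: "real R * (\<epsilon> / 4) \<le> - (\<Sum>t<N. rad i t * \<rho> i t)" if i: "i < D" for i
  proof -
    have "(\<Sum>t<N. rad i t * \<rho> i t) = (\<Sum>s<R. \<Sum>t<N. rad i t * G i (u t (m s)))"
      unfolding \<rho>_def sum_distrib_left by (rule sum.swap)
    also have "\<dots> \<le> (\<Sum>s<R. - (\<epsilon> / 4))"
      by (intro sum_mono less_imp_le[OF m0[OF _ i]]) (simp add: m_def)
    finally show ?thesis by simp
  qed
  have "real D * (real R * (\<epsilon> / 4)) = (\<Sum>i<D. real R * (\<epsilon> / 4))" by simp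
  also have "\<dots> \<le> (\<Sum>i<D. - (\<Sum>t<N. rad i t * \<rho> i t))" by (intro sum_mono rho) simp
  finally have big: "real D * (real R * (\<epsilon> / 4)) \<le> \<bar>\<Sum>i<D. \<Sum>t<N. rad i t * \<rho> i t\<bar>"
    by (simp add: sum_negf)
  have rad1: "\<bar>rad i t\<bar> = 1" for i t by (simp add: rad_def)
  obtain \<sigma> \<phi> where \<sigma>: "\<And>i. \<bar>\<sigma> i\<bar> \<le> 1" and \<phi>: "\<And>t. \<bar>\<phi> t\<bar> \<le> 1"
    and ext: "\<bar>\<Sum>i<D. \<Sum>t<N. rad i t * \<rho> i t\<bar> / (4 * sqrt D) \<le> (\<Sum>i<D. \<sigma> i * (\<Sum>t<N. \<rho> i t * \<phi> t))"
    using extension_lower_bound[of rad D, OF rad1 D] by blast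
  define y where "y s = (\<Sum>t<N. \<phi> t *\<^sub>R u t (m s))" for s
  have yJ: "y s \<in> jvecs" for s unfolding y_def by (intro subspace_sum jvecs_subspace jvecs_scale uJ)
  define Q where "Q = labfun (\<Sum>i<dm n. \<sigma> i *\<^sub>R unit_vec (off n + i))"
  have QD: "Q \<in> dvecs" "dnorm Q \<le> 1"
    unfolding Q_def by (rule labfun_dual[OF wdual_signs], rule \<sigma>)+
  have Q: "Q = (\<Sum>i<D. \<sigma> i *\<^sub>R q i)"
  proof (rule dual_ext[OF QD(1)])
    show "(\<Sum>i<D. \<sigma> i *\<^sub>R q i) \<in> dvecs"
      by (intro subspace_sum subspace_scale nspace_subspace[OF normed_DJ] qD)
    fix k show "Q (unit_vec k) = (\<Sum>i<D. \<sigma> i *\<^sub>R q i) (unit_vec k)"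
      by (simp add: Q_def q_def labfun_unit sum_fun_apply D_def)
  qed
  define z where "z = (\<Sum>s<R. y s)"
  have zJ: "z \<in> jvecs" unfolding z_def by (intro subspace_sum jvecs_subspace yJ)
  have Gz: "G i z = (\<Sum>t<N. \<rho> i t * \<phi> t)" for i
  proof -
    have Gy: "G i (y s) = (\<Sum>t<N. \<phi> t * G i (u t (m s)))" for s
      unfolding y_def by (subst dual_sum[OF normed_J GD jvecs_scale[OF uJ]]) (simp add: dual_scale[OF GD uJ])
    have "G i z = (\<Sum>s<R. G i (y s))" unfolding z_def by (rule dual_sum[OF normed_J GD yJ])
    also have "\<dots> = (\<Sum>t<N. \<Sum>s<R. \<phi> t * G i (u t (m s)))" unfolding Gy by (rule sum.swap)
    also have "\<dots> = (\<Sum>t<N. \<rho> i t * \<phi> t)"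
      by (simp add: \<rho>_def sum_distrib_left[symmetric] mult.commute)
    finally show ?thesis .
  qed
  have "jnorm z \<le> 1 * real R + 2 * real N * sqrt (real R)"
    unfolding z_def
  proof (rule jnorm_sum_le[OF L])
    fix s
    show "y s i = 0" if "i < L s \<or> L (Suc s) \<le> i" for i
    proof -
      have "i \<noteq> idx (off n + D + t) (m s)" if "t < N" for t
        using \<open>i < L s \<or> L (Suc s) \<le> i\<close> idx_lo[of s t] idx_hi[OF that, of s] by linarith
      then show ?thesis unfolding y_def sum_fun_apply
        by (intro sum.neutral) (auto simp: u_def unit_vec_def)
    qed
    show "y s \<in> jvecs" by (rule yJ)
    \<comment> \<open>The triangle inequality suffices here, since this bound enters only with the
      factor \<open>sqrt R\<close>.\<close>
    have "jnorm (y s) \<le> (\<Sum>t<N. 1)"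
    proof -
      have "jnorm (\<Sum>t<k. \<phi> t *\<^sub>R u t (m s)) \<le> (\<Sum>t<k. 1)" for k
      proof (induction k)
        case (Suc k)
        have "jnorm (\<phi> k *\<^sub>R u k (m s)) \<le> 1 * 1"
          unfolding jnorm_scale[OF uJ] by (intro mult_mono \<phi> jnorm_nonneg uJ) (simp_all add: u_def jnorm_unit_vec)
        moreover have "(\<Sum>t<k. \<phi> t *\<^sub>R u t (m s)) \<in> jvecs"
          by (intro subspace_sum jvecs_subspace jvecs_scale uJ)
        then have "jnorm ((\<Sum>t<k. \<phi> t *\<^sub>R u t (m s)) + \<phi> k *\<^sub>R u k (m s))
            \<le> jnorm (\<Sum>t<k. \<phi> t *\<^sub>R u t (m s)) + jnorm (\<phi> k *\<^sub>R u k (m s))"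
          by (rule jnorm_add[OF _ jvecs_scale[OF uJ]])
        ultimately show ?case using Suc unfolding sum.lessThan_Suc by linarith
      qed (simp only: lessThan_0 sum.empty jnorm_0)
      then show ?thesis by (simp only: y_def)
    qed
    then show "jnorm (y s) \<le> real N" by simp
    fix K
    have "lsum (y s) (L s) (L (Suc s)) = (\<Sum>t<N. \<phi> t *\<^sub>R lsum (u t (m s)) (L s) (L (Suc s)))"
      unfolding y_def linear_sum[OF linear_lsum] by (intro sum.cong refl linear_scale[OF linear_lsum])
    also have "\<dots> = (\<Sum>t<2 ^ dm n. \<phi> t *\<^sub>R unit_vec (off n + dm n + t))"
      using idx_lo idx_hi by (intro sum.cong) (auto simp: u_def lsum_unit N_def D_def)
    finally have y_eq: "lsum (y s) (L s) (L (Suc s)) = (\<Sum>t<2 ^ dm n. \<phi> t *\<^sub>R unit_vec (off n + dm n + t))" .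
    show "wnorm K (lsum (y s) (L s) (L (Suc s))) \<le> 1" unfolding y_eq by (rule wnorm_max_block[OF \<phi>])
  qed simp_all
  also have "1 * real R + 2 * real N * sqrt R = 2 * real R"
    using R(2) by (simp add: R_def power2_eq_square)
  finally have z_le: "jnorm z \<le> 2 * real R" .
  have "real R * 2 ^ n / 16 = real D * (real R * (\<epsilon> / 4)) / (4 * sqrt D)"
  proof -
    have "real D = sqrt D * sqrt D" by simp
    then have "real D * (real R * (\<epsilon> / 4)) / (4 * sqrt D) = real R * (sqrt D * \<epsilon>) / 16"
      using D by (simp add: field_simps)
    then show ?thesis by (simp add: sD)
  qed
  also have "\<dots> \<le> \<bar>\<Sum>i<D. \<Sum>t<N. rad i t * \<rho> i t\<bar> / (4 * sqrt D)" by (intro divide_right_mono big) simp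
  also have "\<dots> \<le> (\<Sum>i<D. \<sigma> i * G i z)" using ext by (simp add: Gz)
  also have "\<dots> = Q (v l z)" unfolding Q by (simp add: sum_fun_apply G[OF zJ])
  also have "\<dots> \<le> dnorm Q * jnorm (v l z)" using dual_abs_le[OF normed_J QD(1) vJ[OF zJ, of l]] by simp
  also have "\<dots> \<le> 1 * jnorm (v l z)" by (intro mult_right_mono QD(2) jnorm_nonneg vJ zJ)
  also have "\<dots> \<le> C * jnorm z" using C(2)[OF zJ] by simp
  also have "\<dots> \<le> C * (2 * real R)" using C(1) z_le by (intro mult_left_mono) auto
  finally have "real R * 2 ^ n / 16 \<le> C * (2 * real R)" .
  then have "real R * 2 ^ n \<le> real R * (32 * C)" by (simp add: mult_ac)
  then have "2 ^ n \<le> 32 * C" using R(1) by (subst (asm) mult_le_cancel_left_pos) auto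
  then show False using n by simp
qed

theorem theorem4:
  shows "\<exists>X :: (nat \<Rightarrow> real) nspace.
    banach_space X \<and> separable_space (ntop X) \<and> (\<exists>b. schauder_basis X b) \<and>
    (\<exists>Y. closed_complement (bidual X) (canonical_emb X ` vecs X) Y \<and>
       \<not> (\<exists>W V. subspace W \<and> W \<subseteq> Y \<and> \<not> finite_dim W \<and> subspace V \<and> V \<subseteq> vecs X \<and>
            isomorphic_nspaces (restrict_nspace (bidual X) W) (restrict_nspace X V))) \<and>
    \<not> TPBA X"
proof (intro exI[of _ jspace] conjI)
  show "\<exists>b. schauder_basis jspace b" using schauder_basis_unit_vec by blast
  show "\<exists>Y. closed_complement (bidual jspace) (canonical_emb jspace ` jvecs) Y \<and>
       \<not> (\<exists>W V. subspace W \<and> W \<subseteq> Y \<and> \<not> finite_dim W \<and> subspace V \<and> V \<subseteq> jvecs \<and>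
            isomorphic_nspaces (restrict_nspace (bidual jspace) W) (restrict_nspace jspace V))"
    using closed_complement_jspace annihilator_incomparable by blast
  have "thin \<subseteq> dvecs" by (auto simp: thin_def)
  then show "\<not> TPBA jspace"
    using thin_subspace norming_thin not_quasibasic_thin unfolding TPBA_def by blast
qed (rule banach_space_jspace separable_jspace)+

end
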